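(* Let $n\ge 2$ and let $\frac{a}{b}$ (in lowest terms) be a term of the Farey sequence for $n$ with $0<\frac{a}{b}<1$. Let $w_1<w_2<\dots<w_k=\frac{a}{b}$ be all terms of the Farey sequence for $n$ lying in the interval $(0,\frac{a}{b}]$, and let $d_i$ be the denominator of $w_i$ in lowest terms. Define partitions of $n$ by $\lambda_0=(n)$ (the trivial representation) and $\lambda_i=\big(M_{d_i}(\lambda_{i-1})\big)^t$ for $i=1,\dots,k$. Then the Young diagram of $\lambda_k$ is exactly the set of the $n$ smallest boxes (among all boxes $(x,y)$ with $x\ge1$, $y\le -1$ integers) with respect to the total order $>_{a,b}$.
   Context: The Farey sequence for $n$ is the increasing sequence of all rational numbers in $[0,1]$ whose denominator (in lowest terms) is at most $n$. Young diagrams are drawn in the fourth quadrant in English convention; the box in column $i\ge1$ and row $j\ge1$ has coordinates $(x,y)=(i,-j)$. For integers $0<a<b$, the order $>_{a,b}$ on integer pairs is defined by $(x_1,y_1)>_{a,b}(x_2,y_2)$ if either $ax_1-(b-a)y_1>ax_2-(b-a)y_2$, or $ax_1-(b-a)y_1=ax_2-(b-a)y_2$ and $y_1>y_2$. For an integer $d\ge2$, $M_d$ denotes the Mullineux involution with base $d$ on partitions of $n$ (the $d$-Mullineux involution on $d$-regular partitions), and $\mu^t$ denotes the transposed (conjugate) partition of $\mu$. The operation $\mu\mapsto M_{d}(\mu)^t$ is called wall-crossing across the wall of denominator $d$. *)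

theory Defs
  imports Complex_Main
begin

text \<open>Partitions are weakly decreasing lists of positive integers.\<close>

definition is_partition :: "nat list \<Rightarrow> bool" where
  "is_partition \<nu> \<longleftrightarrow> sorted_wrt (\<ge>) \<nu> \<and> 0 \<notin> set \<nu>"

definition conjugate :: "nat list \<Rightarrow> nat list" where
  "conjugate \<nu> = (case \<nu> of [] \<Rightarrow> [] | p # _ \<Rightarrow> map (\<lambda>i. length (filter (\<lambda>q. i < q) \<nu>)) [0..<p])"

text \<open>English convention, fourth quadrant: the box in column \<open>i \<ge> 1\<close> and row \<open>j \<ge> 1\<close>
  is the pair \<open>(i, -j)\<close>. List indices start at 0, so row \<open>j + 1\<close> has length \<open>\<nu> ! j\<close>.\<close>

type_synonym box = "int \<times> int"

definition boxes :: "box set" where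
  "boxes = {(x, y). 1 \<le> x \<and> y \<le> -1}"

definition young_diagram :: "nat list \<Rightarrow> box set" where
  "young_diagram \<nu> = {(int i, - int (Suc j)) |i j. j < length \<nu> \<and> 1 \<le> i \<and> i \<le> \<nu> ! j}"

definition removable :: "nat list \<Rightarrow> box \<Rightarrow> bool" where
  "removable \<nu> B \<longleftrightarrow> B \<in> young_diagram \<nu> \<and>
     (\<exists>\<mu>. is_partition \<mu> \<and> young_diagram \<mu> = young_diagram \<nu> - {B})"

definition addable :: "nat list \<Rightarrow> box \<Rightarrow> bool" where
  "addable \<nu> B \<longleftrightarrow> B \<notin> young_diagram \<nu> \<and>
     (\<exists>\<mu>. is_partition \<mu> \<and> young_diagram \<mu> = insert B (young_diagram \<nu>))"

text \<open>The residue is the content (column minus row) modulo \<open>d\<close>; the row number of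
  \<open>(x, y)\<close> is \<open>-y\<close>.\<close>

definition residue :: "nat \<Rightarrow> box \<Rightarrow> int" where
  "residue d B = (fst B + snd B) mod int d"

definition d_regular :: "nat \<Rightarrow> nat list \<Rightarrow> bool" where
  "d_regular d \<nu> \<longleftrightarrow> (\<forall>p\<in>set \<nu>. count_list \<nu> p < d)"

text \<open>Kleshchev's normal and good boxes, in the convention adapted to \<open>d\<close>-regular
  (not \<open>d\<close>-restricted) partitions. A removable box \<open>A\<close> is normal if for every addable box
  \<open>C\<close> above it of the same residue there are at least as many removable boxes of that residue
  strictly between \<open>A\<close> and \<open>C\<close> as addable ones above \<open>A\<close> up to and including \<open>C\<close>;
  it is good if it is the lowest normal box of its residue.\<close>

definition normal_box :: "nat \<Rightarrow> nat list \<Rightarrow> box \<Rightarrow> bool" where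
  "normal_box d \<nu> A \<longleftrightarrow> removable \<nu> A \<and>
     (\<forall>C. addable \<nu> C \<and> residue d C = residue d A \<and> snd A < snd C \<longrightarrow>
        card {D. addable \<nu> D \<and> residue d D = residue d A \<and> snd A < snd D \<and> snd D \<le> snd C}
        \<le> card {D. removable \<nu> D \<and> residue d D = residue d A \<and> snd A < snd D \<and> snd D < snd C})"

definition good_box :: "nat \<Rightarrow> nat list \<Rightarrow> box \<Rightarrow> bool" where
  "good_box d \<nu> A \<longleftrightarrow> normal_box d \<nu> A \<and>
     (\<forall>C. normal_box d \<nu> C \<and> residue d C = residue d A \<longrightarrow> snd A \<le> snd C)"

text \<open>\<open>good_path d [r\<^sub>1, \<dots>, r\<^sub>n] \<nu>\<close>: the partition \<open>\<nu>\<close> is built up from the empty partition by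
  adding successively boxes of residues \<open>r\<^sub>1, \<dots>, r\<^sub>n\<close>, each good in the partition it
  completes.\<close>

inductive good_path :: "nat \<Rightarrow> int list \<Rightarrow> nat list \<Rightarrow> bool" for d :: nat where
  empty: "good_path d [] []"
| step: "good_path d rs \<mu> \<Longrightarrow> is_partition \<nu> \<Longrightarrow> good_box d \<nu> A \<Longrightarrow>
    young_diagram \<mu> = young_diagram \<nu> - {A} \<Longrightarrow> good_path d (rs @ [residue d A]) \<nu>"

text \<open>The Mullineux involution for an arbitrary base \<open>d \<ge> 2\<close>: negate all residues along a path
  of good boxes. The result does not depend on the path. Its domain consists of the
  \<open>d\<close>-regular partitions, which are exactly those reached by such paths.\<close>

definition mullineux :: "nat \<Rightarrow> nat list \<Rightarrow> nat list" where
  "mullineux d \<nu> =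
     (if is_partition \<nu> \<and> d_regular d \<nu>
      then THE \<mu>. \<exists>rs. good_path d rs \<nu> \<and> good_path d (map (\<lambda>r. (- r) mod int d) rs) \<mu>
      else undefined)"

definition wall_crossing :: "nat \<Rightarrow> nat list \<Rightarrow> nat list" where
  "wall_crossing d \<nu> = conjugate (mullineux d \<nu>)"

definition denominator :: "rat \<Rightarrow> nat" where
  "denominator q = nat (snd (quotient_of q))"

definition farey :: "nat \<Rightarrow> rat set" where
  "farey n = {q. 0 \<le> q \<and> q \<le> 1 \<and> denominator q \<le> n}"

definition box_greater :: "int \<Rightarrow> int \<Rightarrow> box \<Rightarrow> box \<Rightarrow> bool" where
  "box_greater a b = (\<lambda>(x1, y1) (x2, y2).
     a * x1 - (b - a) * y1 > a * x2 - (b - a) * y2 \<or>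
     a * x1 - (b - a) * y1 = a * x2 - (b - a) * y2 \<and> y1 > y2)"

definition is_n_smallest_boxes :: "int \<Rightarrow> int \<Rightarrow> nat \<Rightarrow> box set \<Rightarrow> bool" where
  "is_n_smallest_boxes a b n S \<longleftrightarrow> S \<subseteq> boxes \<and> finite S \<and> card S = n \<and>
     (\<forall>B\<in>S. \<forall>C\<in>boxes - S. box_greater a b C B)"

end

theory Submission
  imports Defs
begin

text \<open>
Order the boxes by weight \<open>a x - (b - a) y\<close>, which is \<open>a\<close> times the content minus \<open>b\<close> times \<open>y\<close>.
Boxes of equal weight then have the same residue modulo \<open>b\<close>, and breaking ties by increasing or
by decreasing content gives the order of the boxes for slopes just above or just below \<open>a/b\<close>.
In the diagram of the \<open>n\<close> smallest boxes for slopes just below \<open>a/b\<close> the last box is good, and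
after transposition the same holds above \<open>a/b\<close>. The two diagrams are thus built by adding good
boxes of residues that are negatives of each other, so \<open>M\<^sub>b\<close> followed by transposition takes the one
to the other. Between consecutive Farey fractions the set of the \<open>n\<close> smallest boxes does not change.

The Mullineux map does not depend on the choice of the path because good boxes satisfy the local
relations of Stembridge for simply laced crystals. A partition is encoded by its Maya diagram, the
set of the numbers \<open>\<nu>\<^sub>j - j\<close>. For each residue the numbers of removable minus addable boxes above a
given content form a walk, whose last maximum marks the good box, and the relations compare
the last maxima of two walks. The relations need a base of at least 3; for base 2 negating residues
changes nothing and the map is the identity.
\<close>

section \<open>Partitions and their diagrams\<close>

text \<open>The definite description in \<open>mullineux\<close> ranges over all pairs of paths, so
  exhibiting one convenient pair is not enough; most of the work is to show that every other path
  leads to the same partner. The convenient path is elementary: boxes of one residue have weights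
  congruent modulo \<open>b\<close>, whereas a step to a neighbouring box changes the weight by only
  \<open>a\<close> or \<open>b - a\<close>. This leaves only boxes of equal weight to compete with
  the last box, and the tie rule decides among them. For uniqueness the obstacle is that the partner
  is known only through a chain of residues. What can be transported along the chain are the numbers
  \<open>eps\<close> and \<open>phi\<close>, which tell whether a good box can be removed or added;
  they are therefore carried through the same induction as the removals themselves. Statements on
  adding come from those on removing by reflecting the Maya diagram. The reflection leaves the class
  of diagrams of partitions, so the local theory is set up for all sets of integers with finitely
  many corners.\<close>

definition row :: "nat list \<Rightarrow> nat \<Rightarrow> nat" where
  "row \<nu> j = (if j < length \<nu> then \<nu> ! j else 0)"

definition down_closed :: "box set \<Rightarrow> bool" where
  "down_closed S \<longleftrightarrow> S \<subseteq> boxes \<and>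
    (\<forall>x y x' y'. (x, y) \<in> S \<and> (x', y') \<in> boxes \<and> x' \<le> x \<and> y \<le> y' \<longrightarrow> (x', y') \<in> S)"

lemma mem_boxes [simp]: "(x, y) \<in> boxes \<longleftrightarrow> 1 \<le> x \<and> y \<le> -1"
  by (simp add: boxes_def)

lemma down_closedD:
  assumes "down_closed S" "(x, y) \<in> S"
  shows "1 \<le> x" "y \<le> -1" "1 \<le> x' \<Longrightarrow> x' \<le> x \<Longrightarrow> y \<le> y' \<Longrightarrow> y' \<le> -1 \<Longrightarrow> (x', y') \<in> S"
  using assms unfolding down_closed_def by auto

lemma mem_young_diagram:
  "(x, y) \<in> young_diagram \<nu> \<longleftrightarrow> 1 \<le> x \<and> y \<le> -1 \<and> x \<le> int (row \<nu> (nat (- y - 1)))"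
proof
  assume "(x, y) \<in> young_diagram \<nu>"
  then show "1 \<le> x \<and> y \<le> -1 \<and> x \<le> int (row \<nu> (nat (- y - 1)))"
    by (auto simp: young_diagram_def row_def)
next
  assume a: "1 \<le> x \<and> y \<le> -1 \<and> x \<le> int (row \<nu> (nat (- y - 1)))"
  then have "nat (- y - 1) < length \<nu>" by (auto simp: row_def split: if_splits)
  moreover have "x = int (nat x)" "y = - int (Suc (nat (- y - 1)))" using a by auto
  moreover have "1 \<le> nat x" "nat x \<le> \<nu> ! nat (- y - 1)"
    using a calculation(1) by (auto simp: row_def)
  ultimately show "(x, y) \<in> young_diagram \<nu>" unfolding young_diagram_def by blast
qed

lemma mem_young_diagram_row:
  "(x, - int j - 1) \<in> young_diagram \<nu> \<longleftrightarrow> 1 \<le> x \<and> x \<le> int (row \<nu> j)"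
  by (simp add: mem_young_diagram)

lemma row_antimono:
  assumes "is_partition \<nu>" "i \<le> j"
  shows "row \<nu> j \<le> row \<nu> i"
  using assms sorted_wrt_nth_less[of "(\<ge>)" \<nu> i j]
  by (cases "i = j") (auto simp: row_def is_partition_def)

lemma row_pos_iff: "is_partition \<nu> \<Longrightarrow> 0 < row \<nu> j \<longleftrightarrow> j < length \<nu>"
  unfolding row_def is_partition_def by (metis gr0I nth_mem less_irrefl)

lemma row_inject:
  assumes "is_partition \<nu>" "is_partition \<mu>" "row \<nu> = row \<mu>"
  shows "\<nu> = \<mu>"
proof -
  have len: "j < length \<nu> \<longleftrightarrow> j < length \<mu>" for j
    using assms row_pos_iff by metis
  then have "length \<nu> = length \<mu>" by (metis linorder_neqE_nat less_irrefl)
  moreover have "\<nu> ! j = \<mu> ! j" if "j < length \<nu>" for j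
    using assms(3) that len by (metis row_def)
  ultimately show ?thesis by (rule nth_equalityI)
qed

lemma young_diagram_inject:
  assumes "is_partition \<nu>" "is_partition \<mu>" "young_diagram \<nu> = young_diagram \<mu>"
  shows "\<nu> = \<mu>"
proof (rule row_inject[OF assms(1,2)], rule ext)
  fix j
  have eq: "1 \<le> x \<and> x \<le> int (row \<nu> j) \<longleftrightarrow> 1 \<le> x \<and> x \<le> int (row \<mu> j)" for x
    using mem_young_diagram_row assms(3) by metis
  show "row \<nu> j = row \<mu> j"
    using eq[of "int (row \<nu> j)"] eq[of "int (row \<mu> j)"] by linarith
qed

lemma finite_young_diagram: "finite (young_diagram \<nu>)"
proof -
  have "young_diagram \<nu> \<subseteq> (\<Union>j<length \<nu>. (\<lambda>i. (int i, - int (Suc j))) ` {..\<nu> ! j})"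
    by (auto simp: young_diagram_def)
  then show ?thesis by (rule finite_subset) auto
qed

lemma down_closed_young_diagram:
  assumes "is_partition \<nu>"
  shows "down_closed (young_diagram \<nu>)"
proof -
  have "x' \<le> int (row \<nu> (nat (- y' - 1)))"
    if "x \<le> int (row \<nu> (nat (- y - 1)))" "x' \<le> x" "y \<le> y'" for x y x' y'
    using that row_antimono[OF assms, of "nat (- y' - 1)" "nat (- y - 1)"] by force
  then show ?thesis unfolding down_closed_def using mem_young_diagram by auto
qed

lemma down_closed_int:
  assumes "finite A" "\<And>x::int. x \<in> A \<Longrightarrow> 1 \<le> x" "\<And>x x'. x \<in> A \<Longrightarrow> 1 \<le> x' \<Longrightarrow> x' \<le> x \<Longrightarrow> x' \<in> A"
  shows "x \<in> A \<longleftrightarrow> 1 \<le> x \<and> x \<le> int (card A)"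
proof (cases "A = {}")
  case False
  define M where "M = Max A"
  have "M \<in> A" using assms(1) False by (simp add: M_def)
  have le: "x \<le> M" if "x \<in> A" for x using that assms(1) by (simp add: M_def)
  have "x \<in> A \<longleftrightarrow> 1 \<le> x \<and> x \<le> M" for x
    using assms(2)[of x] assms(3)[of M x] le[of x] \<open>M \<in> A\<close> by blast
  then have A: "A = {1..M}" by (simp add: set_eq_iff)
  have "1 \<le> M" using \<open>M \<in> A\<close> assms(2) by blast
  then show ?thesis by (simp add: A)
qed auto

lemma partition_of_rows:
  assumes "\<And>i j. i \<le> j \<Longrightarrow> r j \<le> r i" "r M = (0::nat)"
  obtains \<nu> where "is_partition \<nu>" "row \<nu> = r"
proof
  define m where "m = (LEAST j. r j = 0)"
  have m: "r m = 0" unfolding m_def using assms(2) by (rule LeastI)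
  have pos: "0 < r j" if "j < m" for j
    using not_less_Least[of j "\<lambda>j. r j = 0"] that unfolding m_def by simp
  have zero: "r j = 0" if "m \<le> j" for j using assms(1)[OF that] m by simp
  show "is_partition (map r [0..<m])"
    using pos assms(1) by (force simp: is_partition_def sorted_wrt_iff_nth_less)
  show "row (map r [0..<m]) = r"
    using zero by (auto simp: row_def fun_eq_iff)
qed

text \<open>\<open>removable\<close> and \<open>addable\<close> ask for the existence of a
  partition. Building one from any finite down-closed set turns this into a condition on
  neighbouring boxes.\<close>

lemma partition_of_diagram:
  assumes "finite S" "down_closed S"
  obtains \<nu> where "is_partition \<nu>" "young_diagram \<nu> = S"
proof -
  define A where "A j = {x. (x, - int j - 1) \<in> S}" for j
  define r where "r j = card (A j)" for j
  have sub: "S \<subseteq> boxes" and dc: "\<And>x y x' y'. (x, y) \<in> S \<Longrightarrow> (x', y') \<in> boxes \<Longrightarrow> x' \<le> x \<Longrightarrow> y \<le> y' \<Longrightarrow> (x', y') \<in> S"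
    using assms(2) unfolding down_closed_def by blast+
  have finA: "finite (A j)" for j
    by (rule finite_subset[of _ "fst ` S"]) (use assms(1) in \<open>force simp: A_def\<close>)+
  have mem: "(x, - int j - 1) \<in> S \<longleftrightarrow> 1 \<le> x \<and> x \<le> int (r j)" for x j
  proof -
    have "x \<in> A j \<longleftrightarrow> 1 \<le> x \<and> x \<le> int (card (A j))"
    proof (rule down_closed_int[OF finA])
      show "1 \<le> x" if "x \<in> A j" for x using that sub by (auto simp: A_def)
      show "x' \<in> A j" if "x \<in> A j" "1 \<le> x'" "x' \<le> x" for x x'
        using that dc[of x "- int j - 1" x' "- int j - 1"] by (simp add: A_def)
    qed
    then show ?thesis by (simp add: A_def r_def)
  qed
  have anti: "r j \<le> r i" if "i \<le> j" for i j
    unfolding r_def using dc[of _ "- int j - 1" _ "- int i - 1"] that sub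
    by (intro card_mono[OF finA]) (auto simp: A_def)
  obtain N where N: "\<And>y. y \<in> snd ` S \<Longrightarrow> N \<le> y"
    using finite_imageI[OF assms(1), of snd] by (metis bdd_below.E bdd_below_finite)
  \<comment> \<open>Index \<open>j\<close> sits at height \<open>- j - 1\<close>, so index
    \<open>nat (- N)\<close> lies at height \<open>N - 1\<close> or lower, strictly below every box
    of \<open>S\<close>.\<close>
  have "A (nat (- N)) = {}"
  proof -
    have "(x, - int (nat (- N)) - 1) \<notin> S" for x
    proof
      assume "(x, - int (nat (- N)) - 1) \<in> S"
      then have "- int (nat (- N)) - 1 \<in> snd ` S" by (rule rev_image_eqI) simp
      then have "N \<le> - int (nat (- N)) - 1" by (rule N)
      then show False by linarith
    qed
    then show ?thesis by (simp add: A_def)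
  qed
  then have "r (nat (- N)) = 0" by (simp add: r_def)
  then obtain \<nu> where \<nu>: "is_partition \<nu>" "row \<nu> = r" using partition_of_rows[of r] anti by blast
  have "(x, y) \<in> young_diagram \<nu> \<longleftrightarrow> (x, y) \<in> S" for x y
  proof (cases "y \<le> -1")
    case True
    then have "y = - int (nat (- y - 1)) - 1" by simp
    then show ?thesis using mem mem_young_diagram_row \<nu>(2) by metis
  next
    case False
    then show ?thesis using sub by (auto simp: mem_young_diagram)
  qed
  then have "young_diagram \<nu> = S" by auto
  then show ?thesis using that \<nu> by blast
qed

section \<open>Removable and addable boxes in terms of neighbours and of row lengths\<close>

lemma removable_iff:
  assumes "is_partition \<nu>"
  shows "removable \<nu> (x, y) \<longleftrightarrow>
    (x, y) \<in> young_diagram \<nu> \<and> (x + 1, y) \<notin> young_diagram \<nu> \<and> (x, y - 1) \<notin> young_diagram \<nu>"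
proof
  let ?D = "young_diagram \<nu>"
  assume rem: "removable \<nu> (x, y)"
  then obtain \<mu> where \<mu>: "is_partition \<mu>" "young_diagram \<mu> = ?D - {(x, y)}" and "(x, y) \<in> ?D"
    by (auto simp: removable_def)
  have dc: "down_closed (?D - {(x, y)})" using \<mu> down_closed_young_diagram by metis
  have "1 \<le> x" "y \<le> -1" using \<open>(x, y) \<in> ?D\<close> by (auto simp: mem_young_diagram)
  then have "(p, q) \<notin> ?D" if "(p, q) \<noteq> (x, y)" "x \<le> p" "q \<le> y" for p q
    using down_closedD(3)[OF dc, of p q x y] that by auto
  from this[of "x + 1" y] this[of x "y - 1"] show "(x, y) \<in> ?D \<and> (x + 1, y) \<notin> ?D \<and> (x, y - 1) \<notin> ?D" using \<open>(x, y) \<in> ?D\<close> by simp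
next
  let ?D = "young_diagram \<nu>"
  assume a: "(x, y) \<in> ?D \<and> (x + 1, y) \<notin> ?D \<and> (x, y - 1) \<notin> ?D"
  have dc: "down_closed ?D" using down_closed_young_diagram assms by blast
  have xy: "1 \<le> x" "y \<le> -1" using a by (auto simp: mem_young_diagram)
  have "(p, q) = (x, y)" if "(p, q) \<in> ?D" "x \<le> p" "q \<le> y" for p q
  proof (rule ccontr)
    assume "(p, q) \<noteq> (x, y)"
    then have "x + 1 \<le> p \<or> q \<le> y - 1" using that by auto
    then show False
      using down_closedD(3)[OF dc that(1), of "x + 1" y] down_closedD(3)[OF dc that(1), of x "y - 1"] that a xy
      by auto
  qed
  then have "down_closed (?D - {(x, y)})" using dc unfolding down_closed_def by blast
  then obtain \<mu> where "is_partition \<mu>" "young_diagram \<mu> = ?D - {(x, y)}"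
    using partition_of_diagram finite_young_diagram by (metis finite_Diff)
  then show "removable \<nu> (x, y)" using a by (auto simp: removable_def)
qed

lemma addable_iff:
  assumes "is_partition \<nu>"
  shows "addable \<nu> (x, y) \<longleftrightarrow> (x, y) \<in> boxes \<and> (x, y) \<notin> young_diagram \<nu> \<and>
    (x = 1 \<or> (x - 1, y) \<in> young_diagram \<nu>) \<and> (y = -1 \<or> (x, y + 1) \<in> young_diagram \<nu>)"
proof
  let ?D = "young_diagram \<nu>"
  assume add: "addable \<nu> (x, y)"
  then obtain \<mu> where \<mu>: "is_partition \<mu>" "young_diagram \<mu> = insert (x, y) ?D" and n: "(x, y) \<notin> ?D"
    by (auto simp: addable_def)
  have dc: "down_closed (insert (x, y) ?D)" using \<mu> down_closed_young_diagram by metis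
  then have xy: "1 \<le> x" "y \<le> -1" unfolding down_closed_def by auto
  have "x = 1 \<or> (x - 1, y) \<in> ?D"
    using down_closedD(3)[OF dc, of x y "x - 1" y] xy by (cases "x = 1") auto
  moreover have "y = -1 \<or> (x, y + 1) \<in> ?D"
    using down_closedD(3)[OF dc, of x y x "y + 1"] xy by (cases "y = -1") auto
  ultimately show "(x, y) \<in> boxes \<and> (x, y) \<notin> ?D \<and> (x = 1 \<or> (x - 1, y) \<in> ?D) \<and> (y = -1 \<or> (x, y + 1) \<in> ?D)"
    using n xy by simp
next
  let ?D = "young_diagram \<nu>"
  assume a: "(x, y) \<in> boxes \<and> (x, y) \<notin> ?D \<and> (x = 1 \<or> (x - 1, y) \<in> ?D) \<and> (y = -1 \<or> (x, y + 1) \<in> ?D)"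
  have dc: "down_closed ?D" using down_closed_young_diagram assms by blast
  have "(p, q) \<in> insert (x, y) ?D" if "(p, q) \<in> boxes" "p \<le> x" "y \<le> q" for p q
  proof (rule ccontr)
    assume n: "(p, q) \<notin> insert (x, y) ?D"
    then have "p \<le> x - 1 \<or> y + 1 \<le> q" using that by auto
    then show False
    proof
      assume "p \<le> x - 1"
      then show False using down_closedD(3)[OF dc, of "x - 1" y p q] that a n by auto
    next
      assume "y + 1 \<le> q"
      then show False using down_closedD(3)[OF dc, of x "y + 1" p q] that a n by auto
    qed
  qed
  then have "down_closed (insert (x, y) ?D)" using dc a unfolding down_closed_def by blast
  then obtain \<mu> where "is_partition \<mu>" "young_diagram \<mu> = insert (x, y) ?D"
    using partition_of_diagram finite_young_diagram by (metis finite_insert)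
  then show "addable \<nu> (x, y)" using a by (auto simp: addable_def)
qed

lemma removable_row:
  assumes "is_partition \<nu>"
  shows "removable \<nu> A \<longleftrightarrow> (\<exists>j. A = (int (row \<nu> j), - int j - 1) \<and> row \<nu> (Suc j) < row \<nu> j)"
proof
  obtain x y where A: "A = (x, y)" by fastforce
  assume "removable \<nu> A"
  then have a: "(x, y) \<in> young_diagram \<nu>" "(x + 1, y) \<notin> young_diagram \<nu>" "(x, y - 1) \<notin> young_diagram \<nu>"
    using removable_iff[OF assms] A by auto
  define j where "j = nat (- y - 1)"
  have "nat (- (y - 1) - 1) = Suc j" "y = - int j - 1"
    using a(1) by (auto simp: j_def mem_young_diagram)
  then have "x = int (row \<nu> j)" "row \<nu> (Suc j) < row \<nu> j"
    using a by (auto simp: mem_young_diagram j_def[symmetric])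
  then show "\<exists>j. A = (int (row \<nu> j), - int j - 1) \<and> row \<nu> (Suc j) < row \<nu> j"
    using A \<open>y = - int j - 1\<close> by blast
next
  assume "\<exists>j. A = (int (row \<nu> j), - int j - 1) \<and> row \<nu> (Suc j) < row \<nu> j"
  then obtain j where j: "A = (int (row \<nu> j), - int j - 1)" "row \<nu> (Suc j) < row \<nu> j" by blast
  have "- int j - 1 - 1 = - int (Suc j) - 1" by simp
  then show "removable \<nu> A"
    unfolding j(1) removable_iff[OF assms] using j(2) by (simp only: mem_young_diagram_row) simp
qed

lemma addable_row:
  assumes "is_partition \<nu>"
  shows "addable \<nu> A \<longleftrightarrow> (\<exists>j. A = (int (row \<nu> j) + 1, - int j - 1) \<and> (j = 0 \<or> row \<nu> j < row \<nu> (j - 1)))"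
proof
  obtain x y where A: "A = (x, y)" by fastforce
  assume "addable \<nu> A"
  then have a: "(x, y) \<in> boxes" "(x, y) \<notin> young_diagram \<nu>" "x = 1 \<or> (x - 1, y) \<in> young_diagram \<nu>"
    "y = -1 \<or> (x, y + 1) \<in> young_diagram \<nu>"
    using addable_iff[OF assms] A by auto
  define j where "j = nat (- y - 1)"
  have y: "y = - int j - 1" using a(1) by (auto simp: j_def)
  have x: "x = int (row \<nu> j) + 1"
    using a by (auto simp: mem_young_diagram_row y)
  have less: "row \<nu> j < row \<nu> (j - 1)" if "j \<noteq> 0"
  proof -
    have "y + 1 = - int (j - 1) - 1" using y that by simp
    moreover have "y \<noteq> -1" using y that by simp
    ultimately have "(x, - int (j - 1) - 1) \<in> young_diagram \<nu>" using a(4) by metis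
    then show ?thesis using x by (simp add: mem_young_diagram_row)
  qed
  show "\<exists>j. A = (int (row \<nu> j) + 1, - int j - 1) \<and> (j = 0 \<or> row \<nu> j < row \<nu> (j - 1))"
  proof (intro exI conjI)
    show "A = (int (row \<nu> j) + 1, - int j - 1)" unfolding A x y by (rule refl)
    show "j = 0 \<or> row \<nu> j < row \<nu> (j - 1)" using less by blast
  qed
next
  assume "\<exists>j. A = (int (row \<nu> j) + 1, - int j - 1) \<and> (j = 0 \<or> row \<nu> j < row \<nu> (j - 1))"
  then obtain j where j: "A = (int (row \<nu> j) + 1, - int j - 1)" "j = 0 \<or> row \<nu> j < row \<nu> (j - 1)" by blast
  have "j = 0 \<or> (int (row \<nu> j) + 1, - int j - 1 + 1) \<in> young_diagram \<nu>"
  proof (cases "j = 0")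
    case False
    then have eq: "- int j - 1 + 1 = - int (j - 1) - 1" by simp
    show ?thesis unfolding eq mem_young_diagram_row using j(2) False by simp
  qed simp
  moreover have "int (row \<nu> j) + 1 = 1 \<or> (int (row \<nu> j) + 1 - 1, - int j - 1) \<in> young_diagram \<nu>"
    unfolding mem_young_diagram_row by (cases "row \<nu> j = 0") auto
  ultimately show "addable \<nu> A"
    unfolding j(1) addable_iff[OF assms] by (auto simp: mem_young_diagram_row)
qed

section \<open>Initial segments of the boxes\<close>

definition weight :: "int \<Rightarrow> int \<Rightarrow> box \<Rightarrow> int" where
  "weight a b B = a * fst B - (b - a) * snd B"

definition content :: "box \<Rightarrow> int" where
  "content B = fst B + snd B"

text \<open>Larger content first is the tie rule of slopes slightly smaller than
  \<open>a / b\<close>. The opposite rule gets no definition of its own: it is this order with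
  \<open>b - a\<close> in place of \<open>a\<close>, read through \<open>flip\<close>.\<close>

definition before :: "int \<Rightarrow> int \<Rightarrow> box \<Rightarrow> box \<Rightarrow> bool" where
  "before a b B C \<longleftrightarrow> weight a b B < weight a b C \<or> weight a b B = weight a b C \<and> content C < content B"

definition initial :: "int \<Rightarrow> int \<Rightarrow> box set \<Rightarrow> bool" where
  "initial a b S \<longleftrightarrow> S \<subseteq> boxes \<and> finite S \<and> (\<forall>B\<in>S. \<forall>C\<in>boxes - S. before a b B C)"

definition flip :: "box \<Rightarrow> box" where
  "flip B = (- snd B, - fst B)"

lemma flip_flip [simp]: "flip (flip B) = B"
  by (simp add: flip_def)

lemma flip_image_flip [simp]: "flip ` flip ` S = S"
  by (simp add: image_comp comp_def)

lemma inj_flip: "inj flip"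
  by (metis injI flip_flip)

lemma mem_flip_image: "B \<in> flip ` S \<longleftrightarrow> flip B \<in> S"
  by (metis image_eqI imageE flip_flip)

lemma flip_mem_boxes [simp]: "flip B \<in> boxes \<longleftrightarrow> B \<in> boxes"
  by (cases B) (auto simp: flip_def)

lemma weight_flip: "weight (b - a) b (flip B) = weight a b B"
  by (simp add: weight_def flip_def)

lemma content_flip: "content (flip B) = - content B"
  by (simp add: content_def flip_def)

lemma weight_content: "weight a b B = a * content B - b * snd B"
  by (simp add: weight_def content_def algebra_simps)

lemma box_eqI:
  assumes "0 < b" "weight a b B = weight a b C" "content B = content C"
  shows "B = C"
proof -
  have "b * snd B = b * snd C" using assms(2,3) by (simp add: weight_content)
  then show ?thesis using assms(1,3) by (simp add: content_def prod_eq_iff)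
qed

lemma before_total: "0 < b \<Longrightarrow> B \<noteq> C \<Longrightarrow> before a b B C \<or> before a b C B"
  using box_eqI[of b a B C] unfolding before_def by (meson linorder_neqE)

lemma before_trans: "before a b A B \<Longrightarrow> before a b B C \<Longrightarrow> before a b A C"
  unfolding before_def by linarith

lemma last_box:
  assumes "finite F" "F \<noteq> {}" "0 < b"
  obtains A where "A \<in> F" "\<And>B. B \<in> F \<Longrightarrow> B \<noteq> A \<Longrightarrow> before a b B A"
proof -
  have "\<exists>A\<in>F. \<forall>B\<in>F. B \<noteq> A \<longrightarrow> before a b B A"
    using assms(1,2)
  proof (induction rule: finite_ne_induct)
    case (insert C F)
    then obtain A where A: "A \<in> F" "\<forall>B\<in>F. B \<noteq> A \<longrightarrow> before a b B A" by blast
    have "A \<noteq> C" using A insert by blast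
    then consider "before a b C A" | "before a b A C" using before_total[OF assms(3)] by blast
    then show ?case
    proof cases
      case 1
      then show ?thesis using A by blast
    next
      case 2
      then have "\<forall>B\<in>insert C F. B \<noteq> C \<longrightarrow> before a b B C" using A before_trans by (metis insertE)
      then show ?thesis by blast
    qed
  qed simp
  then show ?thesis using that by blast
qed

lemma first_box:
  assumes "finite F" "F \<noteq> {}" "0 < b"
  obtains A where "A \<in> F" "\<And>B. B \<in> F \<Longrightarrow> B \<noteq> A \<Longrightarrow> before a b A B"
proof -
  have "\<exists>A\<in>F. \<forall>B\<in>F. B \<noteq> A \<longrightarrow> before a b A B"
    using assms(1,2)
  proof (induction rule: finite_ne_induct)
    case (insert C F)
    then obtain A where A: "A \<in> F" "\<forall>B\<in>F. B \<noteq> A \<longrightarrow> before a b A B" by blast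
    have "A \<noteq> C" using A insert by blast
    then consider "before a b A C" | "before a b C A" using before_total[OF assms(3)] by blast
    then show ?case
    proof cases
      case 1
      then show ?thesis using A by blast
    next
      case 2
      then have "\<forall>B\<in>insert C F. B \<noteq> C \<longrightarrow> before a b C B" using A before_trans by (metis insertE)
      then show ?thesis by blast
    qed
  qed simp
  then show ?thesis using that by blast
qed

lemma initial_before:
  "initial a b S \<Longrightarrow> B \<in> S \<Longrightarrow> C \<in> boxes \<Longrightarrow> C \<notin> S \<Longrightarrow> before a b B C"
  by (simp add: initial_def)

lemma initial_weight_le:
  "initial a b S \<Longrightarrow> B \<in> S \<Longrightarrow> C \<in> boxes \<Longrightarrow> C \<notin> S \<Longrightarrow> weight a b B \<le> weight a b C"
proof -
  assume "initial a b S" "B \<in> S" "C \<in> boxes" "C \<notin> S"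
  then have "before a b B C" by (simp add: initial_def)
  then show ?thesis by (auto simp: before_def)
qed

context
  fixes a b :: int
  assumes ab: "0 < a" "a < b"
begin

lemma weight_mono:
  assumes "x' \<le> x" "y \<le> y'" "(x', y') \<noteq> (x, y)"
  shows "weight a b (x', y') < weight a b (x, y)"
proof -
  have "a * x' \<le> a * x" "(b - a) * y \<le> (b - a) * y'" using assms ab by (auto intro: mult_left_mono)
  moreover have "a * x' < a * x \<or> (b - a) * y < (b - a) * y'"
    using assms ab by (auto simp: mult_less_cancel_left)
  ultimately show ?thesis by (auto simp: weight_def)
qed

lemma down_closed_initial: "initial a b S \<Longrightarrow> down_closed S"
  unfolding down_closed_def
proof (intro conjI allI impI)
  assume S: "initial a b S"
  then show "S \<subseteq> boxes" by (simp add: initial_def)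
  fix x y x' y'
  assume xy: "(x, y) \<in> S \<and> (x', y') \<in> boxes \<and> x' \<le> x \<and> y \<le> y'"
  show "(x', y') \<in> S"
  proof (rule ccontr)
    assume n: "(x', y') \<notin> S"
    then have "weight a b (x', y') < weight a b (x, y)" using xy by (intro weight_mono) auto
    then show False using initial_weight_le[OF S _ _ n] xy by force
  qed
qed

lemma finite_light_boxes: "finite {B \<in> boxes. weight a b B \<le> L}"
proof (rule finite_subset)
  show "{B \<in> boxes. weight a b B \<le> L} \<subseteq> {0..L} \<times> {- L..0}"
  proof
    fix B assume B: "B \<in> {B \<in> boxes. weight a b B \<le> L}"
    obtain x y where xy: "B = (x, y)" by fastforce
    have w: "a * x + (b - a) * (- y) \<le> L" "1 \<le> x" "y \<le> -1" using B xy by (auto simp: weight_def)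
    have "1 * x \<le> a * x" "1 * (- y) \<le> (b - a) * (- y)"
      using w ab by (intro mult_right_mono; simp)+
    moreover have "0 \<le> a * x" "0 \<le> (b - a) * (- y)" using w ab by (auto intro: mult_nonneg_nonneg simp: mult_nonneg_nonpos)
    ultimately have "x \<le> L" "- y \<le> L" using w by linarith+
    then show "B \<in> {0..L} \<times> {- L..0}" using w xy by simp
  qed
qed simp

lemma infinite_boxes: "infinite boxes"
proof
  assume "finite boxes"
  moreover have "(\<lambda>n. (int n + 1, -1)) ` UNIV \<subseteq> boxes" by auto
  ultimately have "finite (range (\<lambda>n. (int n + 1, -1 :: int)))" by (rule finite_subset[rotated])
  then show False using finite_imageD[of "\<lambda>n. (int n + 1, -1 :: int)" UNIV] by (simp add: inj_on_def)
qed

lemma ex_initial: "\<exists>S. initial a b S \<and> card S = n"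
proof (induction n)
  case 0
  then show ?case by (intro exI[of _ "{}"]) (simp add: initial_def)
next
  case (Suc n)
  then obtain S where S: "initial a b S" "card S = n" by blast
  then have fS: "finite S" "S \<subseteq> boxes" by (auto simp: initial_def)
  have "boxes - S \<noteq> {}" using infinite_boxes fS finite_subset[of boxes S] by blast
  then obtain C0 where C0: "C0 \<in> boxes - S" by blast
  \<comment> \<open>Only finitely many boxes are as light as \<open>C0\<close>, so the first of all
    remaining boxes can be sought in \<open>F\<close>.\<close>
  define F where "F = {B \<in> boxes. weight a b B \<le> weight a b C0} - S"
  have F: "finite F" "F \<noteq> {}" using finite_light_boxes C0 by (auto simp: F_def)
  have "0 < b" using ab by simp
  then obtain A where A: "A \<in> F" "\<And>B. B \<in> F \<Longrightarrow> B \<noteq> A \<Longrightarrow> before a b A B"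
    using first_box[OF F] by blast
  have first: "before a b A C" if "C \<in> boxes - S" "C \<noteq> A" for C
  proof (cases "C \<in> F")
    case False
    then have "weight a b A < weight a b C" using that A(1) by (auto simp: F_def)
    then show ?thesis by (simp add: before_def)
  qed (use A that in blast)
  have "A \<in> boxes - S" using A by (simp add: F_def)
  then have "initial a b (insert A S)"
    using S first unfolding initial_def by auto
  moreover have "card (insert A S) = Suc n" using S fS A by (simp add: F_def)
  ultimately show ?case by blast
qed

lemma initial_remove_last:
  assumes S: "initial a b S" and A: "A \<in> S" "\<And>B. B \<in> S \<Longrightarrow> B \<noteq> A \<Longrightarrow> before a b B A"
  shows "initial a b (S - {A})"
  using assms unfolding initial_def by (auto; blast)

text \<open>No addable box of the residue of \<open>A\<close> lies above \<open>A\<close>, so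
  normality requires no counting; and every removable box of that residue lies level with
  \<open>A\<close> or above it, so \<open>A\<close> is the lowest normal one.\<close>

lemma good_last_box:
  assumes cop: "coprime a b" and \<nu>: "is_partition \<nu>" and S: "initial a b (young_diagram \<nu>)"
    and A: "A \<in> young_diagram \<nu>" "\<And>B. B \<in> young_diagram \<nu> \<Longrightarrow> B \<noteq> A \<Longrightarrow> before a b B A"
  shows "good_box (nat b) \<nu> A"
proof -
  let ?D = "young_diagram \<nu>" and ?w = "weight a b"
  have b0: "0 < b" using ab by simp
  have sub: "?D \<subseteq> boxes" using S by (simp add: initial_def)
  have light: "B \<in> ?D" if "?w B < ?w A" "B \<in> boxes" for B
    using initial_weight_le[OF S A(1) that(2)] that by force
  have heavy: "?w B \<le> ?w A" if "B \<in> ?D" for B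
    using A(2)[OF that] by (cases "B = A") (auto simp: before_def)
  have res: "b dvd ?w C - ?w A" if "residue (nat b) C = residue (nat b) A" for C
  proof -
    have "content C mod b = content A mod b" using that b0 by (simp add: residue_def content_def)
    then have "b dvd content C - content A" by (simp add: mod_eq_dvd_iff)
    moreover have "?w C - ?w A = a * (content C - content A) - b * (snd C - snd A)"
      by (simp add: weight_content algebra_simps)
    ultimately show ?thesis by (metis dvd_diff dvd_mult dvd_triv_left)
  qed
  obtain x y where xy: "A = (x, y)" by fastforce
  have xy1: "1 \<le> x" "y \<le> -1" using A(1) sub xy by auto
  have rem: "removable \<nu> A"
    unfolding xy removable_iff[OF \<nu>]
    using A(1) xy heavy[of "(x + 1, y)"] heavy[of "(x, y - 1)"]
      weight_mono[of x "x + 1" y y] weight_mono[of x x "y - 1" y] by force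
  have no_add: False if C: "addable \<nu> C" "residue (nat b) C = residue (nat b) A" "snd A < snd C" for C
  proof -
    obtain p q where pq: "C = (p, q)" by fastforce
    have C': "C \<in> boxes" "C \<notin> ?D" "p = 1 \<or> (p - 1, q) \<in> ?D" "q = -1 \<or> (p, q + 1) \<in> ?D"
      using C(1) addable_iff[OF \<nu>, of p q] pq by auto
    have "before a b A C" using S A(1) C' by (simp add: initial_def)
    moreover have "?w C \<noteq> ?w A"
    proof
      assume eq: "?w C = ?w A"
      then have "content C < content A" using \<open>before a b A C\<close> by (simp add: before_def)
      then have "a * content C < a * content A" using ab by simp
      then have "b * snd C < b * snd A" using eq by (simp add: weight_content)
      then show False using C(3) b0 by (simp add: mult_less_cancel_left)
    qed
    ultimately have "0 < ?w C - ?w A" by (auto simp: before_def)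
    \<comment> \<open>A strictly heavier box of the same residue is heavier by at least
      \<open>b\<close>. The boxes to its left and above it are then still heavier than
      \<open>A\<close>, hence outside the diagram.\<close>
    then have far: "b \<le> ?w C - ?w A" using res[OF C(2)] zdvd_imp_le by blast
    have up: "?w (p, q + 1) = ?w C - (b - a)" "?w (p - 1, q) = ?w C - a"
      by (simp_all add: weight_def pq algebra_simps)
    have "q = -1"
    proof (rule ccontr)
      assume "q \<noteq> -1"
      then have "?w (p, q + 1) \<le> ?w A" using C'(4) heavy by blast
      then show False using up far ab by simp
    qed
    have "p = 1"
    proof (rule ccontr)
      assume "p \<noteq> 1"
      then have "?w (p - 1, q) \<le> ?w A" using C'(3) heavy by blast
      then show False using up far ab by simp
    qed
    \<comment> \<open>Only the corner box \<open>(1, -1)\<close> is left, and it lies in every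
      nonempty diagram.\<close>
    then have "(p, q) \<in> ?D"
      using down_closedD(3)[OF down_closed_young_diagram[OF \<nu>], of x y p q] A(1) xy xy1 \<open>q = -1\<close> by simp
    then show False using C' pq by simp
  qed
  have lowest: "snd A \<le> snd C" if C: "removable \<nu> C" "residue (nat b) C = residue (nat b) A" for C
  proof -
    obtain p q where pq: "C = (p, q)" by fastforce
    have C': "C \<in> ?D" "(p + 1, q) \<notin> ?D" using C(1) removable_iff[OF \<nu>, of p q] pq by auto
    then have "(p + 1, q) \<in> boxes" using sub pq by auto
    \<comment> \<open>The right neighbour of a removable box is outside the diagram, so
      \<open>C\<close> is lighter than \<open>A\<close> by at most \<open>a\<close>; divisibility by
      \<open>b\<close> then forces equal weights.\<close>
    then have "?w A \<le> ?w (p + 1, q)" using light[of "(p + 1, q)"] C'(2) by linarith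
    then have "?w A - ?w C < b" using ab by (simp add: weight_def pq algebra_simps)
    moreover have "?w C \<le> ?w A" using heavy C' by blast
    moreover have "b dvd ?w A - ?w C" using res[OF C(2)] by (simp add: dvd_diff_commute)
    ultimately have "?w A = ?w C" using zdvd_imp_le[of b "?w A - ?w C"] by linarith
    then have "content A \<le> content C"
      using A(2)[OF C'(1)] by (cases "C = A") (auto simp: before_def)
    then have "a * content A \<le> a * content C" using ab by simp
    then have "b * snd A \<le> b * snd C" using \<open>?w A = ?w C\<close> by (simp add: weight_content)
    then show ?thesis using b0 by simp
  qed
  have "normal_box (nat b) \<nu> A" using rem no_add unfolding normal_box_def by blast
  then show ?thesis using lowest unfolding good_box_def normal_box_def by blast
qed

text \<open>Needed because \<open>mullineux\<close> is specified on regular partitions only. If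
  \<open>b\<close> rows had equal length, the box to the right of the uppermost one would come
  before the last box of the lowest one: its weight is not larger and its content is.\<close>

lemma d_regular_initial:
  assumes \<nu>: "is_partition \<nu>" and S: "initial a b (young_diagram \<nu>)"
  shows "d_regular (nat b) \<nu>"
  unfolding d_regular_def
proof
  fix p assume "p \<in> set \<nu>"
  define k where "k = nat b - 1"
  have b: "b = int k + 1" using ab by (simp add: k_def)
  show "count_list \<nu> p < nat b"
  proof (rule ccontr)
    assume "\<not> count_list \<nu> p < nat b"
    then have len: "k < length (filter ((=) p) \<nu>)"
      by (simp add: k_def count_list_eq_length_filter) (use ab in linarith)
    define I where "I = {i. i < length \<nu> \<and> \<nu> ! i = p}"
    have "card I = length (filter ((=) p) \<nu>)"
      by (simp add: I_def length_filter_conv_card eq_commute)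
    then have I: "finite I" "k < card I" using len by (auto simp: I_def)
    then have "I \<noteq> {}" by auto
    note I = I this
    define i where "i = Min I"
    define j where "j = Max I"
    have "I \<subseteq> {i..j}" using I by (auto simp: i_def j_def)
    then have "card I \<le> j + 1 - i" using card_mono[of "{i..j}" I] by simp
    then have ij: "i + k \<le> j" using I by simp
    have "i \<in> I" "j \<in> I" using I by (auto simp: i_def j_def)
    then have rows: "row \<nu> i = p" "row \<nu> j = p" "0 < p"
      using row_pos_iff[OF \<nu>, of i] by (auto simp: I_def row_def)
    let ?B = "(int p, - int j - 1)" and ?C = "(int p + 1, - int i - 1)"
    have "?B \<in> young_diagram \<nu>" "?C \<notin> young_diagram \<nu>" "?C \<in> boxes"
      using rows unfolding mem_young_diagram_row by auto
    then have "before a b ?B ?C" using S by (simp add: initial_def)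
    moreover have "weight a b ?C - weight a b ?B = a - (b - a) * (int j - int i)"
      by (simp add: weight_def algebra_simps)
    moreover have "(b - a) * int k \<le> (b - a) * (int j - int i)"
      using ij ab by (intro mult_left_mono) auto
    \<comment> \<open>This value is at most 0 since \<open>b - a\<close> is at least 1; equality is
      settled by the contents.\<close>
    moreover have "a - (b - a) * int k = b - (b - a) * b" by (simp add: b algebra_simps)
    moreover have "1 * b \<le> (b - a) * b" using ab by (intro mult_right_mono) auto
    ultimately show False using ij by (auto simp: before_def content_def)
  qed
qed

end

text \<open>Each set contains all boxes below its top weight and none above it; only the boxes of
  top weight depend on the tie rule. Equal cardinalities then force equal top weights. In the
  application \<open>U\<close> is a transposed diagram, whose ties are broken the other way.\<close>

lemma max_weight_eq:
  assumes S: "initial a b S" "A \<in> S" "\<And>B. B \<in> S \<Longrightarrow> weight a b B \<le> weight a b A"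
    and U: "finite U" "A' \<in> U" "\<And>B C. B \<in> U \<Longrightarrow> C \<in> boxes - U \<Longrightarrow> weight a b B \<le> weight a b C"
      "\<And>B. B \<in> U \<Longrightarrow> weight a b B \<le> weight a b A'" "U \<subseteq> boxes"
    and card: "card S = card U"
  shows "weight a b A = weight a b A'"
proof (rule ccontr)
  assume "weight a b A \<noteq> weight a b A'"
  then consider "weight a b A < weight a b A'" | "weight a b A' < weight a b A" by linarith
  then show False
  proof cases
    case 1
    have "S \<subseteq> U - {A'}"
    proof
      fix B assume "B \<in> S"
      then have "weight a b B < weight a b A'" "B \<in> boxes"
        using S(1) S(3)[of B] 1 by (auto simp: initial_def)
      then show "B \<in> U - {A'}" using U(3)[OF U(2), of B] by fastforce
    qed
    then have "card S \<le> card (U - {A'})" using U(1) by (simp add: card_mono)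
    also have "\<dots> < card U" using U(1,2) by (rule card_Diff1_less)
    finally show False using card by simp
  next
    case 2
    have fS: "finite S" using S by (simp add: initial_def)
    have "U \<subseteq> S - {A}"
    proof
      fix B assume "B \<in> U"
      then have "weight a b B < weight a b A" "B \<in> boxes" using U(4)[of B] U(5) 2 by auto
      then show "B \<in> S - {A}" using initial_weight_le[OF S(1,2), of B] by fastforce
    qed
    then have "card U \<le> card (S - {A})" using fS by (simp add: card_mono)
    also have "\<dots> < card S" using fS S(2) by (rule card_Diff1_less)
    finally show False using card by simp
  qed
qed

section \<open>Walks and their last maxima\<close>

text \<open>For a walk with finitely many values that vanishes far to the right, such a position
  exists exactly if the maximum is positive.\<close>

definition last_argmax :: "(int \<Rightarrow> int) \<Rightarrow> int \<Rightarrow> bool" where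
  "last_argmax P t \<longleftrightarrow> (\<forall>k>t. P k < P t) \<and> (\<forall>k\<le>t. P k \<le> P t)"

lemma last_argmax_unique: "last_argmax P s \<Longrightarrow> last_argmax P t \<Longrightarrow> s = t"
  unfolding last_argmax_def by (metis linorder_neqE not_less order.strict_implies_order)

lemma last_argmax_Max:
  assumes "last_argmax P t" "finite (range P)"
  shows "Max (range P) = P t"
  using assms unfolding last_argmax_def
  by (intro Max_eqI) (auto, metis le_less linear)

lemma Max_range_eqI:
  fixes P :: "int \<Rightarrow> int"
  assumes "finite (range P)" "\<And>t. P t \<le> m" "P s = m"
  shows "Max (range P) = m"
  using assms by (intro Max_eqI) auto

lemma last_below:
  fixes A :: "int \<Rightarrow> bool"
  assumes "A k" "k \<le> t"
  obtains u where "A u" "k \<le> u" "u \<le> t" "\<And>l. u < l \<Longrightarrow> l \<le> t \<Longrightarrow> \<not> A l"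
proof -
  let ?S = "{l\<in>{k..t}. A l}"
  have "finite ?S" by (rule finite_subset[of _ "{k..t}"]) auto
  moreover have "?S \<noteq> {}" using assms by auto
  ultimately have f: "finite ?S" "?S \<noteq> {}" .
  have "Max ?S \<in> ?S" using f Max_in by blast
  moreover have "\<not> A l" if "Max ?S < l" "l \<le> t" for l
  proof
    assume "A l"
    then have "l \<in> ?S" using that \<open>Max ?S \<in> ?S\<close> by auto
    then have "l \<le> Max ?S" using f by auto
    then show False using that by simp
  qed
  moreover have "A (Max ?S)" "k \<le> Max ?S" "Max ?S \<le> t" using \<open>Max ?S \<in> ?S\<close> by auto
  ultimately show ?thesis using that by metis
qed

lemma last_argmax_exists:
  assumes "finite (range P)" "\<And>t. N \<le> t \<Longrightarrow> P t = 0" "Max (range P) > 0"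
  obtains t where "last_argmax P t"
proof -
  have "Max (range P) \<in> range P" using assms(1) Max_in by blast
  then obtain k where k: "P k = Max (range P)" by auto
  have "k < N" using assms k by (metis not_less order_less_irrefl)
  then obtain t where t: "P t = Max (range P)" "t \<le> N" "\<And>l. t < l \<Longrightarrow> l \<le> N \<Longrightarrow> P l \<noteq> Max (range P)"
    using last_below[of "\<lambda>l. P l = Max (range P)" k N] k by (metis order_less_imp_le)
  have le: "P l \<le> P t" for l using assms(1) t by simp
  have "P l \<noteq> P t" if "t < l" for l
    using t(1,3) that assms(2,3) by (metis linear order_less_irrefl)
  then have "last_argmax P t" using le unfolding last_argmax_def by (metis le_neq_trans)
  then show ?thesis using that by blast
qed

text \<open>Removing a box at position \<open>s\<close> adds \<open>up_to s\<close> to the walk of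
  an adjacent residue and \<open>- 2 * up_to s\<close> to its own: minus the entries of the Cartan
  matrix.\<close>

definition up_to :: "int \<Rightarrow> int \<Rightarrow> int" where
  "up_to s t = (if t \<le> s then 1 else 0)"

text \<open>\<open>P\<close> and \<open>Q\<close> are walks of adjacent residues. If
  \<open>Q\<close> stays below its maximum up to \<open>t0\<close>, raising it there by 1 gives at
  most a tie to the left of \<open>t1\<close>. The walk \<open>P\<close> is raised on a range that
  contains \<open>t0\<close> and all that precedes it. So neither removal displaces the other last
  maximum.\<close>

lemma commuting_argmax:
  assumes P: "last_argmax P t0" and Q: "last_argmax Q t1"
    and low: "\<And>k. k \<le> t0 \<Longrightarrow> Q k < Q t1"
  shows "last_argmax (\<lambda>t. Q t + up_to t0 t) t1" "last_argmax (\<lambda>t. P t + up_to t1 t) t0" "t0 < t1"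
proof -
  show t: "t0 < t1" using low by (metis not_le order_less_irrefl)
  show "last_argmax (\<lambda>t. Q t + up_to t0 t) t1"
    using Q low t unfolding last_argmax_def up_to_def by (smt (verit))
  show "last_argmax (\<lambda>t. P t + up_to t1 t) t0"
    using P t unfolding last_argmax_def up_to_def by (smt (verit))
qed

text \<open>The opposite case: \<open>Q\<close> reaches its maximum also at or before
  \<open>t0\<close>, so the removal at \<open>t0\<close> moves the last maximum of \<open>Q\<close>
  back to \<open>u\<close>, and \<open>t1\<close> becomes the place of the second removal. The
  orders \<open>t0\<close>, \<open>u\<close>, \<open>t1\<close>, \<open>v\<close> and
  \<open>t1\<close>, \<open>t0\<close>, \<open>v\<close>, \<open>u\<close> use the same four boxes;
  this is Stembridge's relation of degree four.\<close>

lemma braided_argmax: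
  assumes P: "last_argmax P t0" and Q: "last_argmax Q t1" and t: "t0 < t1"
    and k: "k \<le> t0" "Q k = Q t1"
    and step: "P (t0 + 1) \<ge> P t0 - 1"
  obtains u v where
    "last_argmax (\<lambda>t. Q t + up_to t0 t) u"
    "last_argmax (\<lambda>t. Q t + up_to t0 t - 2 * up_to u t) t1"
    "last_argmax (\<lambda>t. P t - 2 * up_to t0 t + up_to u t + up_to t1 t) v"
    "P v - 2 * up_to t0 v + up_to u v + up_to t1 v = P t0"
    "last_argmax (\<lambda>t. P t + up_to t1 t) t0"
    "last_argmax (\<lambda>t. P t + up_to t1 t - 2 * up_to t0 t) v"
    "last_argmax (\<lambda>t. Q t - 2 * up_to t1 t + up_to t0 t + up_to v t) u"
    "Q u - 2 * up_to t1 u + up_to t0 u + up_to v u = Q t1"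
proof -
  obtain u where u: "Q u = Q t1" "u \<le> t0" "\<And>l. u < l \<Longrightarrow> l \<le> t0 \<Longrightarrow> Q l \<noteq> Q t1"
    using last_below[of "\<lambda>l. Q l = Q t1" k t0] k by metis
  have Pn: "P (t0 + 1) = P t0 - 1" using P step unfolding last_argmax_def by (smt (verit))
  \<comment> \<open>Before the second removal for \<open>P\<close>, its values on
    \<open>(t0, t1]\<close> have gained 1 and no value further left has gained. The maximum is again
    \<open>P t0\<close>, and its last occurrence is the last point of that range where
    \<open>P\<close> was one below its top.\<close>
  obtain v where v: "P v = P t0 - 1" "t0 + 1 \<le> v" "v \<le> t1" "\<And>l. v < l \<Longrightarrow> l \<le> t1 \<Longrightarrow> P l \<noteq> P t0 - 1"
    using last_below[of "\<lambda>l. P l = P t0 - 1" "t0 + 1" t1] Pn t by (metis zless_imp_add1_zle)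
  have Pt: "\<And>l. t0 < l \<Longrightarrow> P l \<le> P t0 - 1" "\<And>l. P l \<le> P t0"
    using P unfolding last_argmax_def by (force, metis linear less_le)
  have Pv: "\<And>l. v < l \<Longrightarrow> l \<le> t1 \<Longrightarrow> P l \<le> P t0 - 2" using v Pt by (smt (verit))
  have Qt: "\<And>l. t1 < l \<Longrightarrow> Q l \<le> Q t1 - 1" "\<And>l. Q l \<le> Q t1"
    using Q unfolding last_argmax_def by (force, metis linear less_le)
  have Qu: "\<And>l. u < l \<Longrightarrow> l \<le> t0 \<Longrightarrow> Q l \<le> Q t1 - 1" using u Qt by (smt (verit))
  show ?thesis
  proof
    show "last_argmax (\<lambda>t. Q t + up_to t0 t) u"
      unfolding last_argmax_def up_to_def using u Qu Qt by (smt (verit))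
    show "last_argmax (\<lambda>t. Q t + up_to t0 t - 2 * up_to u t) t1"
      unfolding last_argmax_def up_to_def using u Qu Qt t by (smt (verit))
    show "last_argmax (\<lambda>t. P t - 2 * up_to t0 t + up_to u t + up_to t1 t) v"
      unfolding last_argmax_def up_to_def using u(2) v(1-3) Pv Pt t by (smt (verit))
    show "P v - 2 * up_to t0 v + up_to u v + up_to t1 v = P t0"
      unfolding up_to_def using u(2) v(1-3) by auto
    show "last_argmax (\<lambda>t. P t + up_to t1 t) t0"
      unfolding last_argmax_def up_to_def using Pt t by (smt (verit))
    show "last_argmax (\<lambda>t. P t + up_to t1 t - 2 * up_to t0 t) v"
      unfolding last_argmax_def up_to_def using v(1-3) Pv Pt t by (smt (verit))
    show "last_argmax (\<lambda>t. Q t - 2 * up_to t1 t + up_to t0 t + up_to v t) u"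
      unfolding last_argmax_def up_to_def using u(1,2) v(2,3) Qu Qt t by (smt (verit))
    show "Q u - 2 * up_to t1 u + up_to t0 u + up_to v u = Q t1"
      unfolding up_to_def using u(1,2) v(2,3) by auto
  qed
qed

section \<open>Good moves of Maya diagrams\<close>

definition bead :: "int set \<Rightarrow> int \<Rightarrow> int" where
  "bead B c = of_bool (c \<in> B)"

definition corners :: "int set \<Rightarrow> int set" where
  "corners B = {c. (c \<in> B) \<noteq> (c + 1 \<in> B)}"

text \<open>Removable minus addable boxes of content at least \<open>c\<close> in the residue class
  of \<open>c\<close>: a bead at \<open>c + 1\<close> and a gap at \<open>c\<close> make a removable
  box of content \<open>c\<close>, the reverse an addable one. Other places contribute 0, and
  omitting them keeps the index set finite.\<close>

definition height :: "int \<Rightarrow> int set \<Rightarrow> int \<Rightarrow> int" where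
  "height d B c = (\<Sum>k | k \<in> corners B \<and> c \<le> k \<and> d dvd k - c. bead B (k + 1) - bead B k)"

definition track :: "int \<Rightarrow> int set \<Rightarrow> int \<Rightarrow> int \<Rightarrow> int" where
  "track d B c t = height d B (c + d * t)"

definition lower_at :: "int \<Rightarrow> int set \<Rightarrow> int set" where
  "lower_at c B = insert c (B - {c + 1})"

text \<open>Position 0 of the walk started at \<open>c\<close> is the box of content
  \<open>c\<close>. The good box is thus named by its content, so that the positions of two moves
  can be compared; \<open>lowers\<close> keeps only the residue.\<close>

definition good_move :: "int \<Rightarrow> int set \<Rightarrow> int \<Rightarrow> int set \<Rightarrow> bool" where
  "good_move d B c B' \<longleftrightarrow> finite (corners B) \<and> last_argmax (track d B c) 0 \<and> B' = lower_at c B"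

text \<open>A reflection without complement: a bead at \<open>c + 1\<close> and a gap at
  \<open>c\<close> become a bead at \<open>- c - 1\<close> and a gap at \<open>- c\<close>.
  Removable and addable boxes are exchanged, and content \<open>c\<close> becomes
  \<open>- c - 1\<close>.\<close>

definition mirror :: "int set \<Rightarrow> int set" where
  "mirror B = uminus ` B"

text \<open>\<open>eps\<close> and \<open>phi\<close> are Kashiwara's string lengths; additions are
  read as removals in the mirror image.\<close>

definition eps :: "int \<Rightarrow> int set \<Rightarrow> int \<Rightarrow> int" where
  "eps d B r = Max (range (track d B r))"

definition phi :: "int \<Rightarrow> int set \<Rightarrow> int \<Rightarrow> int" where
  "phi d B r = eps d (mirror B) (- r - 1)"

lemma mem_mirror [simp]: "c \<in> mirror B \<longleftrightarrow> - c \<in> B"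
  unfolding mirror_def by (metis image_eqI imageE minus_minus)

lemma mirror_mirror [simp]: "mirror (mirror B) = B"
  by auto

lemma bead_mirror: "bead (mirror B) c = bead B (- c)"
  by (simp add: bead_def)

lemma bead_inject: "(\<And>c. bead A c = bead B c) \<Longrightarrow> A = B"
  unfolding bead_def by (metis of_bool_eq_iff subsetI subset_antisym)

lemma finite_corners_mirror: "finite (corners B) \<Longrightarrow> finite (corners (mirror B))"
proof -
  assume "finite (corners B)"
  moreover have "corners (mirror B) \<subseteq> (\<lambda>c. - c - 1) ` corners B"
  proof
    fix c assume "c \<in> corners (mirror B)"
    then have "- c - 1 \<in> corners B" by (auto simp: corners_def)
    then show "c \<in> (\<lambda>c. - c - 1) ` corners B" by (rule rev_image_eqI) simp
  qed
  ultimately show ?thesis by (metis finite_imageI finite_subset)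
qed

lemma finite_corners_lower_at: "finite (corners B) \<Longrightarrow> finite (corners (lower_at c B))"
proof -
  assume "finite (corners B)"
  moreover have "corners (lower_at c B) \<subseteq> corners B \<union> {c - 1, c, c + 1}"
    by (auto simp: corners_def lower_at_def)
  ultimately show ?thesis by (metis finite_Un finite.emptyI finite.insertI finite_subset)
qed

lemma finite_corners_good_move:
  "good_move d B c B' \<Longrightarrow> finite (corners B)" "good_move d B c B' \<Longrightarrow> finite (corners B')"
  by (auto simp: good_move_def finite_corners_lower_at)

lemma periodic_one:
  fixes H :: "int \<Rightarrow> 'a"
  assumes "\<And>t. H t = H (t + 1)"
  shows "H t = H 0"
proof (induction t rule: int_induct[of _ 0])
  case base
  then show ?case by simp
next
  case (step1 i)
  then show ?case using assms by metis
next
  case (step2 i)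
  then show ?case using assms[of "i - 1"] by simp
qed

context
  fixes d :: int
  assumes d_pos: "0 < d"
begin

lemma height_step:
  assumes "finite (corners B)"
  shows "height d B c = height d B (c + d) + (bead B (c + 1) - bead B c)"
proof -
  let ?A = "{k. k \<in> corners B \<and> c + d \<le> k \<and> d dvd k - (c + d)}"
  have eq: "{k. k \<in> corners B \<and> c \<le> k \<and> d dvd k - c} = ?A \<union> ({c} \<inter> corners B)"
  proof -
    have "d dvd k - (c + d) \<longleftrightarrow> d dvd k - c" for k
      by (metis mod_add_self2 mod_eq_dvd_iff)
    moreover have "c + d \<le> k" if "c \<le> k" "d dvd k - c" "k \<noteq> c" for k
      using that zdvd_imp_le[of d "k - c"] by auto
    moreover have "c \<le> k" if "c + d \<le> k" for k using that d_pos by simp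
    moreover have "d dvd c - c" by simp
    ultimately show ?thesis by blast
  qed
  have "height d B c = sum (\<lambda>k. bead B (k + 1) - bead B k) ?A
      + sum (\<lambda>k. bead B (k + 1) - bead B k) ({c} \<inter> corners B)"
    unfolding height_def eq using assms d_pos by (intro sum.union_disjoint) auto
  also have "sum (\<lambda>k. bead B (k + 1) - bead B k) ({c} \<inter> corners B) = bead B (c + 1) - bead B c"
    by (cases "c \<in> corners B") (auto simp: corners_def bead_def)
  finally show ?thesis by (simp add: height_def)
qed

lemma height_large:
  assumes "finite (corners B)"
  obtains N where "\<And>c. N \<le> c \<Longrightarrow> height d B c = 0"
proof -
  define N where "N = Max (corners B) + 1"
  have N: "\<forall>k\<in>corners B. k < N" using assms by (simp add: N_def zle_add1_eq_le)
  have "height d B c = 0" if "N \<le> c" for c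
  proof -
    have "{k. k \<in> corners B \<and> c \<le> k \<and> d dvd k - c} = {}" using N that by force
    then show ?thesis unfolding height_def by (metis sum.empty)
  qed
  then show ?thesis using that by blast
qed

lemma track_step:
  assumes "finite (corners B)"
  shows "track d B c t = track d B c (t + 1) + (bead B (c + d * t + 1) - bead B (c + d * t))"
  using height_step[OF assms, of "c + d * t"] by (simp add: track_def algebra_simps)

lemma track_large:
  assumes "finite (corners B)"
  obtains N where "\<And>t. N \<le> t \<Longrightarrow> track d B c t = 0"
proof -
  obtain N where N: "\<And>c. N \<le> c \<Longrightarrow> height d B c = 0" using height_large assms by blast
  have "track d B c t = 0" if "max 0 (N - c) \<le> t" for t
  proof -
    have "1 * t \<le> d * t" using that d_pos by (intro mult_right_mono) auto
    then show ?thesis unfolding track_def using that by (intro N) auto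
  qed
  then show ?thesis using that by blast
qed

lemma finite_range_track:
  assumes "finite (corners B)"
  shows "finite (range (track d B c))"
proof -
  have "\<bar>height d B e\<bar> \<le> int (card (corners B))" for e
  proof -
    have "\<bar>height d B e\<bar> \<le> (\<Sum>k | k \<in> corners B \<and> e \<le> k \<and> d dvd k - e. \<bar>bead B (k + 1) - bead B k\<bar>)"
      unfolding height_def by (rule sum_abs)
    also have "\<dots> \<le> (\<Sum>k | k \<in> corners B \<and> e \<le> k \<and> d dvd k - e. 1)"
      by (intro sum_mono) (auto simp: bead_def)
    also have "\<dots> = int (card {k. k \<in> corners B \<and> e \<le> k \<and> d dvd k - e})"
      by simp
    also have "\<dots> \<le> int (card (corners B))"
      using card_mono[OF assms, of "{k. k \<in> corners B \<and> e \<le> k \<and> d dvd k - e}"] by auto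
    finally show ?thesis .
  qed
  then have "range (track d B c) \<subseteq> {- int (card (corners B))..int (card (corners B))}"
    unfolding track_def abs_le_iff atLeastAtMost_iff image_subset_iff by (metis minus_le_iff)
  then show ?thesis using finite_subset by blast
qed

lemma track_shift: "track d B (c + d * u) t = track d B c (u + t)"
  by (simp add: track_def algebra_simps)

lemma last_argmax_shift: "last_argmax (track d B (c + d * u)) t \<longleftrightarrow> last_argmax (track d B c) (u + t)"
proof -
  have eq: "(\<forall>k. R k (u + k)) \<longleftrightarrow> (\<forall>k. R (k - u) k)" for R :: "int \<Rightarrow> int \<Rightarrow> bool"
    by (metis add_diff_cancel_left' diff_add_cancel add.commute)
  show ?thesis unfolding last_argmax_def track_shift
    using eq[of "\<lambda>k l. t < k \<longrightarrow> track d B c l < track d B c (u + t)"]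
      eq[of "\<lambda>k l. k \<le> t \<longrightarrow> track d B c l \<le> track d B c (u + t)"]
    by (simp add: less_diff_eq diff_le_eq add.commute)
qed

lemma good_move_iff:
  "good_move d B (c + d * u) B' \<longleftrightarrow>
    finite (corners B) \<and> last_argmax (track d B c) u \<and> B' = lower_at (c + d * u) B"
  unfolding good_move_def last_argmax_shift by simp

lemma range_track_shift: "range (track d B (c + d * u)) = range (track d B c)"
proof -
  have "track d B (c + d * u) = track d B c \<circ> (+) u" by (simp add: track_shift fun_eq_iff)
  then show ?thesis by (metis image_comp surj_plus)
qed

lemma eps_cong: "d dvd r - s \<Longrightarrow> eps d B r = eps d B s"
proof -
  assume "d dvd r - s"
  then obtain k where "r - s = d * k" by blast
  then have "r = s + d * k" by simp
  then show ?thesis unfolding eps_def by (simp only: range_track_shift)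
qed

lemma phi_cong: "d dvd r - s \<Longrightarrow> phi d B r = phi d B s"
  unfolding phi_def by (rule eps_cong) (simp add: dvd_diff_commute)

lemma good_move_beads:
  assumes "good_move d B c B'"
  shows "c \<notin> B" "c + 1 \<in> B" "track d B c 1 = track d B c 0 - 1"
proof -
  have "track d B c 1 < track d B c 0" "finite (corners B)"
    using assms unfolding good_move_def last_argmax_def by auto
  then show "c \<notin> B" "c + 1 \<in> B" "track d B c 1 = track d B c 0 - 1"
    using track_step[of B c 0] by (auto simp: bead_def split: if_splits)
qed

lemma bead_good_move:
  assumes "good_move d B c B'"
  shows "bead B' k = bead B k + of_bool (k = c) - of_bool (k = c + 1)"
  using good_move_beads[OF assms] assms by (auto simp: good_move_def bead_def lower_at_def)

text \<open>At \<open>- t\<close> the mirrored walk counts addable minus removable boxes up to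
  content \<open>s + d * t\<close>, and \<open>track d B s (t + 1)\<close> counts removable minus
  addable ones beyond it. The difference is addable minus removable boxes of the whole residue
  class, whatever \<open>t\<close> is.\<close>

lemma track_mirror:
  assumes "finite (corners B)"
  shows "track d (mirror B) (- s - 1) (- t) - track d B s (t + 1)
       = track d (mirror B) (- s - 1) 0 - track d B s 1"
proof -
  define H where "H t = track d (mirror B) (- s - 1) (- t) - track d B s (t + 1)" for t
  have "H t = H (t + 1)" for t
  proof -
    have "- (- s - 1 + d * (- t - 1) + 1) = s + d * (t + 1)"
      "- (- s - 1 + d * (- t - 1)) = s + d * (t + 1) + 1" "- t - 1 + 1 = - t" "- t - 1 = - (t + 1)"
      by (simp_all add: algebra_simps)
    then have "track d (mirror B) (- s - 1) (- (t + 1)) = track d (mirror B) (- s - 1) (- t)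
        + (bead B (s + d * (t + 1)) - bead B (s + d * (t + 1) + 1))"
      using track_step[OF finite_corners_mirror[OF assms], of "- s - 1" "- t - 1"]
      unfolding bead_mirror by metis
    then show ?thesis
      unfolding H_def using track_step[OF assms, of s "t + 1"] by simp
  qed
  then have "H t = H 0" by (rule periodic_one)
  then show ?thesis by (simp add: H_def)
qed

text \<open>The mirrored walk is the walk read backwards plus a constant, so the maxima differ by
  that constant. Hence \<open>phi - eps\<close> is the number of addable minus removable boxes of
  the residue.\<close>

lemma phi_eq:
  assumes "finite (corners B)"
  shows "phi d B s = eps d B s + track d (mirror B) (- s - 1) 0 - track d B s 1"
proof -
  have fin: "finite (range (track d B s))" using finite_range_track assms by blast
  have "Max (range (track d B s)) \<in> range (track d B s)" using fin by (intro Max_in) auto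
  then obtain t where t: "track d B s t = eps d B s" by (auto simp: eps_def)
  have le: "track d B s u \<le> eps d B s" for u unfolding eps_def using fin by simp
  show ?thesis unfolding phi_def eps_def[of d "mirror B"]
  proof (rule Max_range_eqI)
    show "finite (range (track d (mirror B) (- s - 1)))"
      using finite_range_track finite_corners_mirror assms by blast
    show "track d (mirror B) (- s - 1) u \<le> eps d B s + track d (mirror B) (- s - 1) 0 - track d B s 1" for u
      using track_mirror[OF assms, of s "- u"] le[of "- u + 1"] by simp
    show "track d (mirror B) (- s - 1) (- (t - 1)) = eps d B s + track d (mirror B) (- s - 1) 0 - track d B s 1"
      using track_mirror[OF assms, of s "t - 1"] t by simp
  qed
qed

lemma eps_nonneg: "finite (corners B) \<Longrightarrow> 0 \<le> eps d B r"
proof -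
  assume fin: "finite (corners B)"
  obtain N where "\<And>t. N \<le> t \<Longrightarrow> track d B r t = 0" using track_large[OF fin] by blast
  then have "track d B r N = 0" by simp
  then show ?thesis unfolding eps_def using finite_range_track[OF fin] by (metis Max_ge rangeI)
qed

lemma good_move_exists:
  assumes "finite (corners B)" "0 < eps d B r"
  obtains c B' where "d dvd c - r" "good_move d B c B'"
proof -
  obtain N where "\<And>t. N \<le> t \<Longrightarrow> track d B r t = 0" using track_large assms by blast
  then obtain t where "last_argmax (track d B r) t"
    using last_argmax_exists[OF finite_range_track[OF assms(1)]] assms(2) unfolding eps_def by blast
  then have "good_move d B (r + d * t) (lower_at (r + d * t) B)"
    using good_move_iff assms by blast
  then show ?thesis using that by (metis add_diff_cancel_left' dvd_triv_left)
qed

lemma eps_good_move: "good_move d B c B' \<Longrightarrow> eps d B c = track d B c 0"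
  unfolding eps_def good_move_def using last_argmax_Max finite_range_track by blast

lemma eps_pos:
  assumes "good_move d B c B'"
  shows "0 < eps d B c"
proof -
  have "finite (corners B)" using assms by (simp add: good_move_def)
  then obtain N where "\<And>t. N \<le> t \<Longrightarrow> track d B c t = 0" using track_large by blast
  then have "track d B c (max N 1) = 0" by simp
  then show ?thesis using assms eps_good_move[OF assms]
    unfolding good_move_def last_argmax_def by (smt (verit))
qed

lemma good_move_det:
  assumes "good_move d B c1 B1" "good_move d B c2 B2" "d dvd c2 - c1"
  shows "c1 = c2" "B1 = B2"
proof -
  obtain u where "c2 - c1 = d * u" using assms(3) by blast
  then have u: "c2 = c1 + d * u" by simp
  have "last_argmax (track d B c1) u" using assms(2) u good_move_iff by blast
  moreover have "last_argmax (track d B c1) 0" using assms(1) by (simp add: good_move_def)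
  ultimately have "u = 0" using last_argmax_unique by blast
  then show "c1 = c2" using u by simp
  then show "B1 = B2" using assms by (simp add: good_move_def)
qed

end

definition lowers :: "int \<Rightarrow> int \<Rightarrow> int set \<Rightarrow> int set \<Rightarrow> bool" where
  "lowers d r B B' \<longleftrightarrow> (\<exists>c. d dvd c - r \<and> good_move d B c B')"

text \<open>The affine Cartan matrix of type A for \<open>d\<close> at least 3. For
  \<open>d = 2\<close> the two neighbours of a residue coincide and the true entry is -2.\<close>

definition cartan :: "int \<Rightarrow> int \<Rightarrow> int \<Rightarrow> int" where
  "cartan d r s = (if d dvd s - r then 2 else if d dvd s - r - 1 \<or> d dvd s - r + 1 then -1 else 0)"

text \<open>Both walks vanish far to the right, so one changed increment at 0 shifts all values up
  to 0 by the same amount.\<close>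

lemma track_change:
  assumes d: "0 < d" and fin: "finite (corners B)" "finite (corners B')"
    and change: "\<And>t. (bead B' (c + d * t + 1) - bead B' (c + d * t)) - (bead B (c + d * t + 1) - bead B (c + d * t))
      = (if t = 0 then \<alpha> else 0)"
  shows "track d B' c t = track d B c t + \<alpha> * up_to 0 t"
proof -
  define H where "H t = track d B' c t - track d B c t - \<alpha> * up_to 0 t" for t
  have "H t = H (t + 1)" for t
    using track_step[OF d fin(1), of c t] track_step[OF d fin(2), of c t] change[of t]
    by (auto simp: H_def up_to_def split: if_splits)
  then have const: "H t = H 0" for t by (rule periodic_one)
  obtain N where N: "\<And>t. N \<le> t \<Longrightarrow> track d B c t = 0" using track_large[OF d fin(1)] by blast
  obtain N' where N': "\<And>t. N' \<le> t \<Longrightarrow> track d B' c t = 0" using track_large[OF d fin(2)] by blast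
  have "H (max 1 (max N N')) = 0" using N N' by (simp add: H_def up_to_def)
  then have "H t = 0" using const by metis
  then show ?thesis by (simp add: H_def)
qed

lemma small_multiple:
  fixes d t :: int
  assumes "\<bar>d * t\<bar> < d"
  shows "t = 0"
  using dvd_imp_le_int[of "d * t" d] assms by fastforce

text \<open>Removing a good box is undone by a good addition. After the removal the walk has dropped
  by 2 up to position 0, so its maximum, one less than before, is first attained at 1; the mirror
  image turns first maxima into last ones.\<close>

lemma good_move_mirror:
  assumes d: "2 \<le> d" and m: "good_move d B c B'"
  shows "good_move d (mirror B') (- c - 1) (mirror B)"
proof -
  have d0: "0 < d" using d by simp
  have fin: "finite (corners B)" "finite (corners B')" using finite_corners_good_move[OF m] by auto
  note bits = good_move_beads[OF d0 m]
  have own: "track d B' c t = track d B c t + (- 2) * up_to 0 t" for t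
  proof -
    have small: "d * t = x \<longleftrightarrow> x = 0 \<and> t = 0" if "\<bar>x\<bar> \<le> 1" for x t
    proof -
      have "t = 0" if "d * t = x" using that \<open>\<bar>x\<bar> \<le> 1\<close> d by (intro small_multiple[of d t]) auto
      then show ?thesis using d by auto
    qed
    have "track d B' c t = track d B c t + (- 2) * up_to 0 t"
    proof (rule track_change[OF d0 fin])
      fix t
      show "(bead B' (c + d * t + 1) - bead B' (c + d * t)) - (bead B (c + d * t + 1) - bead B (c + d * t))
        = (if t = 0 then - 2 else 0)"
        using small[of 0 t] small[of 1 t] small[of "-1" t]
        by (auto simp: bead_good_move[OF d0 m] of_bool_def)
    qed
    then show ?thesis by simp
  qed
  define K where "K = track d (mirror B') (- c - 1) 0 - track d B' c 1"
  have mir: "track d (mirror B') (- c - 1) t = track d B c (1 - t) - 2 * up_to 0 (1 - t) + K" for t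
    using track_mirror[OF d0 fin(2), of c "- t"] own[of "1 - t"] by (simp add: K_def add.commute)
  have "last_argmax (track d (mirror B') (- c - 1)) 0"
    using m bits(3) unfolding good_move_def last_argmax_def mir up_to_def
    by (smt (verit))
  moreover have "mirror B = lower_at (- c - 1) (mirror B')"
  proof (rule bead_inject)
    fix k
    show "bead (mirror B) k = bead (lower_at (- c - 1) (mirror B')) k"
      using bits(1,2) m unfolding good_move_def lower_at_def by (auto simp: bead_def)
  qed
  ultimately show ?thesis
    using fin finite_corners_mirror unfolding good_move_def by blast
qed

lemma lowers_mirror_iff:
  assumes "2 \<le> d"
  shows "lowers d (- r - 1) (mirror B') (mirror B) \<longleftrightarrow> lowers d r B B'"
proof
  assume "lowers d r B B'"
  then obtain c where c: "d dvd c - r" "good_move d B c B'" by (auto simp: lowers_def)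
  then have "d dvd (- c - 1) - (- r - 1)" by (simp add: dvd_diff_commute)
  then show "lowers d (- r - 1) (mirror B') (mirror B)"
    using good_move_mirror[OF assms c(2)] unfolding lowers_def by blast
next
  assume "lowers d (- r - 1) (mirror B') (mirror B)"
  then obtain c where c: "d dvd c - (- r - 1)" "good_move d (mirror B') c (mirror B)"
    by (auto simp: lowers_def)
  have "- (c - (- r - 1)) = (- c - 1) - r" by simp
  then have "d dvd (- c - 1) - r" using c(1) by (metis dvd_minus_iff)
  then show "lowers d r B B'"
    using good_move_mirror[OF assms c(2)] unfolding lowers_def by auto
qed

lemma dvd_diff_trans: "(d::int) dvd a - c \<Longrightarrow> d dvd b - c \<Longrightarrow> d dvd a - b"
  by (metis dvd_diff diff_diff_eq2 diff_add_cancel)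

lemma lowers_det:
  assumes "0 < d" "lowers d r B B1" "lowers d r B B2"
  shows "B1 = B2"
  using assms good_move_det(2) dvd_diff_trans unfolding lowers_def by metis

text \<open>In the mirror image this is determinism of removal.\<close>

lemma lowers_inj:
  assumes "2 \<le> d" "lowers d r B1 B" "lowers d r B2 B"
  shows "B1 = B2"
proof -
  have "mirror B1 = mirror B2"
    using assms lowers_mirror_iff[OF assms(1)] lowers_det[of d "- r - 1" "mirror B"] by auto
  then show ?thesis by (metis mirror_mirror)
qed

context
  fixes d :: int
  assumes d3: "3 \<le> d"
begin

lemma three_imp_pos: "0 < d" and three_imp_two: "2 \<le> d" using d3 by auto

text \<open>Moving one bead affects only the increments at \<open>c - 1\<close>, \<open>c\<close>
  and \<open>c + 1\<close>. For \<open>d\<close> at least 3 these belong to three different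
  residues, which makes the situation simply laced.\<close>

lemma good_move_tracks:
  assumes m: "good_move d B c B'"
  shows "track d B' c t = track d B c t - 2 * up_to 0 t"
    and "\<delta> = 1 \<or> \<delta> = -1 \<Longrightarrow> track d B' (c + \<delta>) t = track d B (c + \<delta>) t + up_to 0 t"
    and "cartan d c e = 0 \<Longrightarrow> track d B' e t = track d B e t"
proof -
  note fin = finite_corners_good_move[OF m] and b = bead_good_move[OF three_imp_pos m]
  have small: "d * t = x \<longleftrightarrow> x = 0 \<and> t = 0" if "\<bar>x\<bar> \<le> 2" for x t
    using small_multiple[of d t] that d3 by auto
  have "track d B' c t = track d B c t + (- 2) * up_to 0 t"
  proof (rule track_change[OF three_imp_pos fin])
    fix t
    show "(bead B' (c + d * t + 1) - bead B' (c + d * t)) - (bead B (c + d * t + 1) - bead B (c + d * t))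
      = (if t = 0 then - 2 else 0)"
      using small[of 0 t] small[of 1 t] small[of "-1" t] by (simp add: b of_bool_def)
  qed
  then show "track d B' c t = track d B c t - 2 * up_to 0 t" by simp
  have "track d B' (c + \<delta>) t = track d B (c + \<delta>) t + 1 * up_to 0 t" if "\<delta> = 1 \<or> \<delta> = -1"
  proof (rule track_change[OF three_imp_pos fin])
    fix t
    show "(bead B' (c + \<delta> + d * t + 1) - bead B' (c + \<delta> + d * t)) - (bead B (c + \<delta> + d * t + 1) - bead B (c + \<delta> + d * t))
      = (if t = 0 then 1 else 0)"
      using that small[of 0 t] small[of 1 t] small[of "-1" t] small[of 2 t] small[of "-2" t]
      by (elim disjE) (auto simp: b of_bool_def algebra_simps)
  qed
  then show "track d B' (c + \<delta>) t = track d B (c + \<delta>) t + up_to 0 t" if "\<delta> = 1 \<or> \<delta> = -1"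
    using that by simp
  have "track d B' e t = track d B e t + 0 * up_to 0 t" if "cartan d c e = 0"
  proof (rule track_change[OF three_imp_pos fin])
    fix t
    have *: "\<not> d dvd e + d * t - c" "\<not> d dvd e + d * t - c - 1" "\<not> d dvd e + d * t - c + 1"
      using that dvd_add_left_iff[of d "d * t" "e - c"] dvd_add_left_iff[of d "d * t" "e - c - 1"]
        dvd_add_left_iff[of d "d * t" "e - c + 1"]
      by (auto simp: cartan_def algebra_simps split: if_splits)
    have "e + d * t \<noteq> c" "e + d * t \<noteq> c + 1" "e + d * t + 1 \<noteq> c" "e + d * t + 1 \<noteq> c + 1"
    proof -
      show "e + d * t \<noteq> c" using *(1) by auto
      show "e + d * t \<noteq> c + 1" using *(2) by auto
      have "e + d * t - c + 1 = (e + d * t + 1) - c" by simp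
      then show "e + d * t + 1 \<noteq> c" using *(3) by auto
      show "e + d * t + 1 \<noteq> c + 1" using *(1) by auto
    qed
    then show "(bead B' (e + d * t + 1) - bead B' (e + d * t)) - (bead B (e + d * t + 1) - bead B (e + d * t))
      = (if t = 0 then 0 else 0)"
      by (simp add: b)
  qed
  then show "track d B' e t = track d B e t" if "cartan d c e = 0" using that by simp
qed

text \<open>With base points \<open>b\<close> and \<open>b + \<delta>\<close> a position means the
  same multiple of \<open>d\<close> in both walks, and the change is \<open>up_to u\<close> for
  either sign of \<open>\<delta>\<close>. The two kinds of neighbours need no separate
  treatment.\<close>

lemma shifted_tracks:
  assumes m: "good_move d B (b + d * u) B'"
  shows "track d B' b = (\<lambda>t. track d B b t - 2 * up_to u t)"
    and "\<delta> = 1 \<or> \<delta> = -1 \<Longrightarrow> track d B' (b + \<delta>) = (\<lambda>t. track d B (b + \<delta>) t + up_to u t)"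
proof -
  have up: "up_to 0 (t - u) = up_to u t" for t by (simp add: up_to_def)
  have "track d B' b t = track d B b t - 2 * up_to u t" for t
    using good_move_tracks(1)[OF m, of "t - u"] by (simp add: track_shift[OF three_imp_pos] up)
  then show "track d B' b = (\<lambda>t. track d B b t - 2 * up_to u t)" by blast
  have "track d B' (b + \<delta>) t = track d B (b + \<delta>) t + up_to u t" if "\<delta> = 1 \<or> \<delta> = -1" for t
  proof -
    have eq: "b + d * u + \<delta> = b + \<delta> + d * u" by simp
    show ?thesis
      using good_move_tracks(2)[OF m that, of "t - u"] unfolding eq by (simp add: track_shift[OF three_imp_pos] up)
  qed
  then show "track d B' (b + \<delta>) = (\<lambda>t. track d B (b + \<delta>) t + up_to u t)" if "\<delta> = 1 \<or> \<delta> = -1"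
    using that by blast
qed

lemma cartan_sym: "cartan d r s = cartan d s r"
proof -
  have "d dvd s - r \<longleftrightarrow> d dvd r - s" "d dvd s - r - 1 \<longleftrightarrow> d dvd r - s + 1" "d dvd s - r + 1 \<longleftrightarrow> d dvd r - s - 1"
    using dvd_minus_iff[of d "r - s"] dvd_minus_iff[of d "r - s + 1"] dvd_minus_iff[of d "r - s - 1"]
    by (simp_all add: algebra_simps)
  then show ?thesis by (auto simp: cartan_def)
qed

lemma cartan_cong:
  assumes "d dvd r' - r" "d dvd s' - s"
  shows "cartan d r' s' = cartan d r s"
proof -
  have "d dvd (s' - s) - (r' - r)" using assms by (rule dvd_diff[rotated])
  then have "d dvd x + (s' - r') \<longleftrightarrow> d dvd x + (s - r)" for x
    using dvd_add_right_iff[of d "(s' - s) - (r' - r)" "x + (s - r)"] by (simp add: algebra_simps)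
  from this[of 0] this[of 1] this[of "-1"] show ?thesis by (simp add: cartan_def algebra_simps)
qed

lemma cartan_uminus: "cartan d (- r) (- s) = cartan d r s"
  using cartan_sym[of r s] by (simp add: cartan_def algebra_simps)

lemma cartan_mirror: "cartan d (- r - 1) (- s - 1) = cartan d r s"
  using cartan_sym[of r s] by (simp add: cartan_def algebra_simps)

end

section \<open>Local relations between good moves\<close>

definition wt :: "int \<Rightarrow> int set \<Rightarrow> int \<Rightarrow> int" where
  "wt d B r = phi d B r - eps d B r"

lemma finite_corners_lowers:
  "lowers d r B B' \<Longrightarrow> finite (corners B)" "lowers d r B B' \<Longrightarrow> finite (corners B')"
  by (auto simp: lowers_def finite_corners_good_move)

lemma wt_eq:
  assumes "0 < d" "finite (corners B)"
  shows "wt d B r = track d (mirror B) (- r - 1) 0 - track d B r 1"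
  using phi_eq[OF assms] by (simp add: wt_def)

lemma wt_cong: "0 < d \<Longrightarrow> d dvd r - s \<Longrightarrow> wt d B r = wt d B s"
  by (simp add: wt_def eps_cong phi_cong)

lemma Max_range_attained:
  fixes P :: "int \<Rightarrow> int"
  assumes "finite (range P)"
  obtains t where "P t = Max (range P)"
  using Max_in[OF assms] by auto

lemma ex_lowers_iff:
  assumes "0 < d" "finite (corners B)"
  shows "(\<exists>B'. lowers d r B B') \<longleftrightarrow> 0 < eps d B r"
proof
  assume "\<exists>B'. lowers d r B B'"
  then obtain c B' where "d dvd c - r" "good_move d B c B'" by (auto simp: lowers_def)
  then show "0 < eps d B r" using eps_pos eps_cong assms(1) by metis
next
  assume "0 < eps d B r"
  then show "\<exists>B'. lowers d r B B'" using good_move_exists[OF assms] unfolding lowers_def by metis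
qed

lemma ex_raises_iff:
  assumes "2 \<le> d" "finite (corners B)"
  shows "(\<exists>B'. lowers d r B' B) \<longleftrightarrow> 0 < phi d B r"
proof -
  have "(\<exists>B'. lowers d r B' B) \<longleftrightarrow> (\<exists>B'. lowers d (- r - 1) (mirror B) (mirror B'))"
    using lowers_mirror_iff[OF assms(1)] by simp
  also have "\<dots> \<longleftrightarrow> (\<exists>B'. lowers d (- r - 1) (mirror B) B')" by (metis mirror_mirror)
  also have "\<dots> \<longleftrightarrow> 0 < phi d B r"
    using ex_lowers_iff finite_corners_mirror assms by (simp add: phi_def)
  finally show ?thesis .
qed

context
  fixes d :: int
  assumes d3: "3 \<le> d"
begin

lemma eps_lowers:
  assumes "lowers d r B B'"
  shows "eps d B' r = eps d B r - 1"
proof -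
  obtain c where c: "d dvd c - r" and m: "good_move d B c B'" using assms by (auto simp: lowers_def)
  have fin: "finite (range (track d B' c))"
    using finite_range_track[OF three_imp_pos[OF d3]] finite_corners_good_move[OF m] by blast
  have "Max (range (track d B' c)) = track d B c 0 - 1"
  proof (rule Max_range_eqI[OF fin])
    show "track d B' c 1 = track d B c 0 - 1"
      using good_move_beads(3)[OF three_imp_pos[OF d3] m] good_move_tracks(1)[OF d3 m] by (simp add: up_to_def)
    fix t
    have "\<forall>k>0. track d B c k < track d B c 0" "\<forall>k\<le>0. track d B c k \<le> track d B c 0"
      using m by (auto simp: good_move_def last_argmax_def)
    then show "track d B' c t \<le> track d B c 0 - 1"
      using good_move_tracks(1)[OF d3 m, of t] by (smt (verit) up_to_def)
  qed
  then have "eps d B' c = eps d B c - 1"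
    using eps_good_move[OF three_imp_pos[OF d3] m] by (simp add: eps_def)
  then show ?thesis using eps_cong[OF three_imp_pos[OF d3] c] by metis
qed

lemma cartan_cases:
  obtains "cartan d r s = 2" "d dvd s - r"
  | \<delta> where "\<delta> = 1 \<or> \<delta> = -1" "cartan d r s = -1" "d dvd s - (r + \<delta>)"
  | "cartan d r s = 0"
proof -
  consider "d dvd s - r" | "\<not> d dvd s - r" "d dvd s - r - 1" | "\<not> d dvd s - r" "d dvd s - r + 1"
    | "\<not> d dvd s - r" "\<not> d dvd s - r - 1" "\<not> d dvd s - r + 1" by blast
  then show ?thesis
  proof cases
    case 1
    then show ?thesis using that(1) by (simp add: cartan_def)
  next
    case 2
    then show ?thesis using that(2)[of 1] by (simp add: cartan_def diff_diff_eq)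
  next
    case 3
    have "s - (r + - 1) = s - r + 1" by simp
    then show ?thesis using that(2)[of "-1"] 3 unfolding cartan_def by presburger
  next
    case 4
    then show ?thesis using that(3) by (simp add: cartan_def)
  qed
qed

lemma cartan_neg:
  assumes "cartan d r s = -1"
  obtains \<delta> where "\<delta> = 1 \<or> \<delta> = -1" "d dvd s - (r + \<delta>)"
proof (rule cartan_cases[of r s])
qed (use assms that in auto)

lemma wt_lowers:
  assumes "lowers d r B B'"
  shows "wt d B' s = wt d B s + cartan d r s"
proof -
  obtain c where c: "d dvd c - r" and m: "good_move d B c B'" using assms by (auto simp: lowers_def)
  note fin = finite_corners_good_move[OF m]
  \<comment> \<open>\<open>wt\<close> combines a value of the walk with one of the mirrored walk;
    the latter changes by the mirrored move, which runs from \<open>mirror B'\<close> to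
    \<open>mirror B\<close>.\<close>
  have m': "good_move d (mirror B') (- c - 1) (mirror B)" by (rule good_move_mirror[OF three_imp_two[OF d3] m])
  have "wt d B' s = wt d B s + cartan d c s"
  proof (rule cartan_cases[of c s])
    assume s: "cartan d c s = 2" "d dvd s - c"
    have "wt d B' c = wt d B c + 2"
      using good_move_tracks(1)[OF d3 m, of 1] good_move_tracks(1)[OF d3 m', of 0]
      by (simp add: wt_eq[OF three_imp_pos[OF d3]] fin up_to_def)
    then show ?thesis using wt_cong[OF three_imp_pos[OF d3] s(2)] s(1) by simp
  next
    fix \<delta> :: int
    assume \<delta>: "\<delta> = 1 \<or> \<delta> = -1" and s: "cartan d c s = -1" "d dvd s - (c + \<delta>)"
    have eq: "- (c + \<delta>) - 1 = (- c - 1) + (- \<delta>)" by simp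
    have "wt d B' (c + \<delta>) = wt d B (c + \<delta>) - 1"
      using good_move_tracks(2)[OF d3 m \<delta>, of 1] good_move_tracks(2)[OF d3 m', of "- \<delta>" 0] \<delta>
      unfolding wt_eq[OF three_imp_pos[OF d3] fin(1)] wt_eq[OF three_imp_pos[OF d3] fin(2)] eq by (auto simp: up_to_def)
    then show ?thesis using wt_cong[OF three_imp_pos[OF d3] s(2)] s(1) by simp
  next
    assume s: "cartan d c s = 0"
    then have s': "cartan d (- c - 1) (- s - 1) = 0" using cartan_mirror[OF d3] by simp
    show ?thesis
      using good_move_tracks(3)[OF d3 m s] good_move_tracks(3)[OF d3 m' s'] s
      by (simp add: wt_eq[OF three_imp_pos[OF d3]] fin)
  qed
  then show ?thesis using cartan_cong[OF d3, of c r s s] c by simp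
qed

lemma eps_lowers_orthogonal:
  assumes "lowers d r B B'" "cartan d r s = 0"
  shows "eps d B' s = eps d B s"
proof -
  obtain c where c: "d dvd c - r" and m: "good_move d B c B'" using assms by (auto simp: lowers_def)
  have "cartan d c s = 0" using cartan_cong[OF d3, of c r s s] c assms(2) by simp
  then have "track d B' s = track d B s" using good_move_tracks(3)[OF d3 m] by blast
  then show ?thesis by (simp add: eps_def)
qed

text \<open>The adjacent walk gains 0 or 1 at each position. Whether its maximum grows decides which
  of the two local relations applies.\<close>

lemma eps_lowers_adjacent:
  assumes "lowers d r B B'" "cartan d r s = -1"
  shows "eps d B' s = eps d B s \<or> eps d B' s = eps d B s + 1"
proof -
  obtain c where c: "d dvd c - r" and m: "good_move d B c B'" using assms by (auto simp: lowers_def)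
  have "cartan d c s = -1" using cartan_cong[OF d3, of c r s s] c assms(2) by simp
  then obtain \<delta> where \<delta>: "\<delta> = 1 \<or> \<delta> = -1" and s: "d dvd s - (c + \<delta>)"
    using cartan_neg by blast
  let ?Q = "track d B (c + \<delta>)" and ?Q' = "track d B' (c + \<delta>)"
  have fin: "finite (range ?Q)" "finite (range ?Q')"
    using finite_range_track[OF three_imp_pos[OF d3]] finite_corners_good_move[OF m] by blast+
  obtain t where t: "?Q t = Max (range ?Q)" using Max_range_attained[OF fin(1)] .
  obtain t' where t': "?Q' t' = Max (range ?Q')" using Max_range_attained[OF fin(2)] .
  have "?Q' t \<le> Max (range ?Q')" "?Q t' \<le> Max (range ?Q)" using fin by simp_all
  then have "Max (range ?Q) \<le> Max (range ?Q')" "Max (range ?Q') \<le> Max (range ?Q) + 1"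
    using good_move_tracks(2)[OF d3 m \<delta>, of t] good_move_tracks(2)[OF d3 m \<delta>, of t'] t t'
    by (auto simp: up_to_def split: if_splits)
  then have "eps d B' (c + \<delta>) = eps d B (c + \<delta>) \<or> eps d B' (c + \<delta>) = eps d B (c + \<delta>) + 1"
    unfolding eps_def by linarith
  then show ?thesis using eps_cong[OF three_imp_pos[OF d3] s] by simp
qed

lemma adjacent_moves:
  assumes "lowers d r B B1" "lowers d s B B2" "cartan d r s = -1"
  obtains b \<delta> t where "\<delta> = 1 \<or> \<delta> = -1" "d dvd b - r" "d dvd b + \<delta> - s"
    "good_move d B b B1" "good_move d B (b + \<delta> + d * t) B2"
proof -
  obtain b where b: "d dvd b - r" "good_move d B b B1" using assms(1) by (auto simp: lowers_def)
  obtain c where c: "d dvd c - s" "good_move d B c B2" using assms(2) by (auto simp: lowers_def)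
  have "cartan d b s = -1" using cartan_cong[OF d3, of b r s s] b assms(3) by simp
  then obtain \<delta> where \<delta>: "\<delta> = 1 \<or> \<delta> = -1" and s: "d dvd s - (b + \<delta>)"
    using cartan_neg by blast
  have "d dvd (c - s) + (s - (b + \<delta>))" using c(1) s by (rule dvd_add)
  moreover have "(c - s) + (s - (b + \<delta>)) = c - (b + \<delta>)" by simp
  ultimately obtain t where "c - (b + \<delta>) = d * t" by (metis dvdE)
  then have "c = b + \<delta> + d * t" by simp
  moreover have "d dvd b + \<delta> - s" using s by (simp add: dvd_diff_commute)
  ultimately show ?thesis using that \<delta> b c by blast
qed

lemma good_moves_commute:
  assumes "good_move d B c B1" "good_move d B1 c' C1" "good_move d B c' B2" "good_move d B2 c C2"
  shows "C1 = C2"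
  by (rule bead_inject) (simp add: bead_good_move[OF three_imp_pos[OF d3] assms(1)] bead_good_move[OF three_imp_pos[OF d3] assms(2)]
      bead_good_move[OF three_imp_pos[OF d3] assms(3)] bead_good_move[OF three_imp_pos[OF d3] assms(4)])

lemma good_move_intro:
  assumes "finite (corners B)" "last_argmax (track d B b) u"
  shows "good_move d B (b + d * u) (lower_at (b + d * u) B)"
  using assms good_move_iff[OF three_imp_pos[OF d3]] by blast

text \<open>If the maximum for \<open>s\<close> does not grow, the walk of \<open>s\<close> stays
  strictly below it on the raised range, which is the hypothesis of \<open>commuting_argmax\<close>.
  The value of \<open>eps d B2 r\<close> is recorded because it later determines \<open>phi\<close>
  at the bottom of the square.\<close>

lemma lowers_commute:
  assumes r: "lowers d r B B1" and s: "lowers d s B B2" and ne: "cartan d r s \<noteq> 2"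
    and eps: "eps d B1 s = eps d B s"
  obtains C where "lowers d s B1 C" "lowers d r B2 C" "eps d B2 r = eps d B r - cartan d r s"
proof -
  note fin = finite_corners_lowers[OF r] finite_corners_lowers[OF s]
  consider "cartan d r s = 0" | "cartan d r s = -1" using cartan_cases[of r s] ne by metis
  then show ?thesis
  proof cases
    case 1
    obtain b where b: "d dvd b - r" "good_move d B b B1" using r by (auto simp: lowers_def)
    obtain c where c: "d dvd c - s" "good_move d B c B2" using s by (auto simp: lowers_def)
    have bc: "cartan d b c = 0" "cartan d c b = 0"
      using cartan_cong[OF d3, of b r c s] cartan_sym[OF d3] b c 1 by simp_all
    have "track d B1 c = track d B c" "track d B2 b = track d B b"
      using good_move_tracks(3)[OF d3 b(2) bc(1)] good_move_tracks(3)[OF d3 c(2) bc(2)] by blast+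
    then have m: "good_move d B1 c (lower_at c B1)" "good_move d B2 b (lower_at b B2)"
      using b c fin by (auto simp: good_move_def)
    moreover have "lower_at c B1 = lower_at b B2"
      by (rule good_moves_commute[OF b(2) m(1) c(2) m(2)])
    ultimately have "lowers d s B1 (lower_at c B1)" "lowers d r B2 (lower_at c B1)"
      unfolding lowers_def using b c by metis+
    moreover have "eps d B2 r = eps d B r"
      using eps_lowers_orthogonal[OF s] 1 cartan_sym[OF d3] by simp
    ultimately show ?thesis using that 1 by simp
  next
    case 2
    obtain b \<delta> t where \<delta>: "\<delta> = 1 \<or> \<delta> = -1" and b: "d dvd b - r" "d dvd b + \<delta> - s"
      and m: "good_move d B b B1" "good_move d B (b + \<delta> + d * t) B2"
      using adjacent_moves[OF r s 2] .
    have \<delta>': "- \<delta> = 1 \<or> - \<delta> = -1" using \<delta> by auto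
    define P where "P = track d B b"
    define Q where "Q = track d B (b + \<delta>)"
    have finR: "finite (range P)" "finite (range Q)" "finite (range (track d B1 (b + \<delta>)))"
      unfolding P_def Q_def using finite_range_track[OF three_imp_pos[OF d3]] fin by blast+
    have am: "last_argmax P 0" "last_argmax Q t"
      using m good_move_iff[OF three_imp_pos[OF d3]] unfolding P_def Q_def good_move_def by auto
    have Q1: "track d B1 (b + \<delta>) = (\<lambda>k. Q k + up_to 0 k)"
      using shifted_tracks(2)[OF d3, of B b 0 B1] m(1) \<delta> by (simp add: Q_def)
    have P2: "track d B2 b = (\<lambda>k. P k + up_to t k)"
      using shifted_tracks(2)[OF d3 m(2) \<delta>'] by (simp add: P_def)
    have Max_eq: "Max (range (track d B1 (b + \<delta>))) = Q t"
      using eps eps_cong[OF three_imp_pos[OF d3] b(2)] last_argmax_Max[OF am(2) finR(2)]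
      by (simp add: eps_def Q_def)
    have "Q k < Q t" if "k \<le> 0" for k
    proof -
      have "track d B1 (b + \<delta>) k \<le> Q t" using finR(3) Max_eq by (metis Max_ge rangeI)
      then show ?thesis using that by (simp add: Q1 up_to_def)
    qed
    then have am': "last_argmax (track d B1 (b + \<delta>)) t" "last_argmax (track d B2 b) 0" "0 < t"
      using commuting_argmax[OF am] unfolding Q1 P2 by blast+
    have dvd: "d dvd b + \<delta> + d * t - s"
    proof -
      have "b + \<delta> + d * t - s = (b + \<delta> - s) + d * t" by simp
      then show ?thesis using b(2) by (metis dvd_add dvd_triv_left)
    qed
    have m1: "good_move d B1 (b + \<delta> + d * t) (lower_at (b + \<delta> + d * t) B1)"
      using good_move_intro am' fin by blast
    have m2: "good_move d B2 b (lower_at b B2)"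
      using am' fin by (simp add: good_move_def)
    have "lower_at (b + \<delta> + d * t) B1 = lower_at b B2"
      by (rule good_moves_commute[OF m(1) m1 m(2) m2])
    moreover have "lowers d s B1 (lower_at (b + \<delta> + d * t) B1)"
      unfolding lowers_def using m1 dvd by blast
    moreover have "lowers d r B2 (lower_at b B2)" unfolding lowers_def using m2 b(1) by blast
    moreover have "eps d B2 r = eps d B r + 1"
    proof -
      have "finite (range (track d B2 b))" using finite_range_track[OF three_imp_pos[OF d3]] fin by blast
      then have "eps d B2 b = track d B2 b 0" using last_argmax_Max[OF am'(2)] by (simp add: eps_def)
      moreover have "eps d B b = track d B b 0"
        using last_argmax_Max[OF am(1) finR(1)] by (simp add: eps_def P_def)
      ultimately have "eps d B2 b = eps d B b + 1"
        using am'(3) by (simp add: P_def P2 up_to_def)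
      then show ?thesis using eps_cong[OF three_imp_pos[OF d3] b(1)] by metis
    qed
    ultimately show ?thesis using that 2 by simp
  qed
qed

end

context
  fixes d :: int
  assumes d3: "3 \<le> d"
begin

lemma braid_moves:
  assumes \<delta>: "\<delta> = 1 \<or> \<delta> = -1"
    and m0: "good_move d B (b + d * t0) B1" and m1: "good_move d B (b + \<delta> + d * t1) B2"
    and t: "t0 < t1" and k: "k \<le> t0" "track d B (b + \<delta>) k = track d B (b + \<delta>) t1"
  obtains X1 X2 C Y1 Y2 u v where
    "good_move d B1 (b + \<delta> + d * u) X1" "good_move d X1 (b + \<delta> + d * t1) X2" "good_move d X2 (b + d * v) C"
    "good_move d B2 (b + d * t0) Y1" "good_move d Y1 (b + d * v) Y2" "good_move d Y2 (b + \<delta> + d * u) C"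
    "eps d X2 b = eps d B b" "eps d Y2 (b + \<delta>) = eps d B (b + \<delta>)"
proof -
  note dp = three_imp_pos[OF d3]
  have \<delta>': "- \<delta> = 1 \<or> - \<delta> = -1" using \<delta> by auto
  have base_eq: "b + \<delta> + - \<delta> = b" by simp
  define P where "P = track d B b"
  define Q where "Q = track d B (b + \<delta>)"
  have fin: "finite (corners B)" "finite (corners B1)" "finite (corners B2)"
    using finite_corners_good_move[OF m0] finite_corners_good_move[OF m1] by blast+
  have am: "last_argmax P t0" "last_argmax Q t1"
    using m0 m1 good_move_iff[OF dp] unfolding P_def Q_def by blast+
  have "P t0 - 1 \<le> P (t0 + 1)"
    using track_step[OF dp fin(1), of b t0] by (auto simp: P_def bead_def)
  then obtain u v where
    uv: "last_argmax (\<lambda>t. Q t + up_to t0 t) u"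
    "last_argmax (\<lambda>t. Q t + up_to t0 t - 2 * up_to u t) t1"
    "last_argmax (\<lambda>t. P t - 2 * up_to t0 t + up_to u t + up_to t1 t) v"
    "P v - 2 * up_to t0 v + up_to u v + up_to t1 v = P t0"
    "last_argmax (\<lambda>t. P t + up_to t1 t) t0"
    "last_argmax (\<lambda>t. P t + up_to t1 t - 2 * up_to t0 t) v"
    "last_argmax (\<lambda>t. Q t - 2 * up_to t1 t + up_to t0 t + up_to v t) u"
    "Q u - 2 * up_to t1 u + up_to t0 u + up_to v u = Q t1"
    using braided_argmax[OF am t k(1)] k(2) unfolding Q_def by blast
  note own = shifted_tracks(1)[OF d3] and adj = shifted_tracks(2)[OF d3 _ \<delta>]
    and adj' = shifted_tracks(2)[OF d3 _ \<delta>', unfolded base_eq]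
  have PQ1: "track d B1 b = (\<lambda>t. P t - 2 * up_to t0 t)" "track d B1 (b + \<delta>) = (\<lambda>t. Q t + up_to t0 t)"
    using own[OF m0] adj[OF m0] by (simp_all add: P_def Q_def)
  obtain X1 where X1: "good_move d B1 (b + \<delta> + d * u) X1"
    using good_move_intro[OF d3 fin(2)] uv(1) unfolding PQ1[symmetric] by blast
  have PX1: "track d X1 b = (\<lambda>t. P t - 2 * up_to t0 t + up_to u t)"
    "track d X1 (b + \<delta>) = (\<lambda>t. Q t + up_to t0 t - 2 * up_to u t)"
    using own[OF X1] adj'[OF X1] by (simp_all add: PQ1)
  have finX1: "finite (corners X1)" using finite_corners_good_move[OF X1] by blast
  obtain X2 where X2: "good_move d X1 (b + \<delta> + d * t1) X2"
    using good_move_intro[OF d3 finX1] uv(2) unfolding PX1[symmetric] by blast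
  have PX2: "track d X2 b = (\<lambda>t. P t - 2 * up_to t0 t + up_to u t + up_to t1 t)"
    using adj'[OF X2] by (simp add: PX1)
  have finX2: "finite (corners X2)" using finite_corners_good_move[OF X2] by blast
  obtain C where C: "good_move d X2 (b + d * v) C"
    using good_move_intro[OF d3 finX2] uv(3) unfolding PX2[symmetric] by blast
  have PQ2: "track d B2 b = (\<lambda>t. P t + up_to t1 t)" "track d B2 (b + \<delta>) = (\<lambda>t. Q t - 2 * up_to t1 t)"
    using own[OF m1] adj'[OF m1] by (simp_all add: P_def Q_def)
  obtain Y1 where Y1: "good_move d B2 (b + d * t0) Y1"
    using good_move_intro[OF d3 fin(3)] uv(5) unfolding PQ2[symmetric] by blast
  have PY1: "track d Y1 b = (\<lambda>t. P t + up_to t1 t - 2 * up_to t0 t)"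
    "track d Y1 (b + \<delta>) = (\<lambda>t. Q t - 2 * up_to t1 t + up_to t0 t)"
    using own[OF Y1] adj[OF Y1] by (simp_all add: PQ2)
  have finY1: "finite (corners Y1)" using finite_corners_good_move[OF Y1] by blast
  obtain Y2 where Y2: "good_move d Y1 (b + d * v) Y2"
    using good_move_intro[OF d3 finY1] uv(6) unfolding PY1[symmetric] by blast
  have PY2: "track d Y2 (b + \<delta>) = (\<lambda>t. Q t - 2 * up_to t1 t + up_to t0 t + up_to v t)"
    using adj[OF Y2] by (simp add: PY1)
  have finY2: "finite (corners Y2)" using finite_corners_good_move[OF Y2] by blast
  obtain C' where C': "good_move d Y2 (b + \<delta> + d * u) C'"
    using good_move_intro[OF d3 finY2] uv(7) unfolding PY2[symmetric] by blast
  \<comment> \<open>Both sequences move the same four beads in different orders.\<close>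
  have "C = C'"
    by (rule bead_inject) (simp add: bead_good_move[OF dp m0] bead_good_move[OF dp m1]
        bead_good_move[OF dp X1] bead_good_move[OF dp X2] bead_good_move[OF dp C]
        bead_good_move[OF dp Y1] bead_good_move[OF dp Y2] bead_good_move[OF dp C'])
  note fr = finite_range_track[OF dp]
  have "eps d X2 b = eps d B b"
    using last_argmax_Max[OF uv(3)[folded PX2] fr[OF finX2]] last_argmax_Max[OF am(1)] fr[OF fin(1), of b] uv(4)
    unfolding eps_def by (simp add: P_def PX2)
  moreover have "eps d Y2 (b + \<delta>) = eps d B (b + \<delta>)"
    using last_argmax_Max[OF uv(7)[folded PY2] fr[OF finY2]] last_argmax_Max[OF am(2)] fr[OF fin(1), of "b + \<delta>"] uv(8)
    unfolding eps_def by (simp add: Q_def PY2)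
  ultimately show ?thesis using that X1 X2 C Y1 Y2 C' \<open>C = C'\<close> by blast
qed

text \<open>A growing maximum of the adjacent walk must come from an old maximum inside the raised
  range, which is the point \<open>k\<close> that \<open>braid_moves\<close> asks for.\<close>

lemma raised_witness:
  assumes m: "good_move d B (b + d * t0) B1" and \<delta>: "\<delta> = 1 \<or> \<delta> = -1"
    and m1: "good_move d B (b + \<delta> + d * t1) B2"
    and eps: "eps d B1 (b + \<delta>) = eps d B (b + \<delta>) + 1"
  obtains k where "k \<le> t0" "track d B (b + \<delta>) k = track d B (b + \<delta>) t1"
proof -
  note dp = three_imp_pos[OF d3]
  have fin: "finite (corners B)" "finite (corners B1)"
    using finite_corners_good_move[OF m] by blast+
  obtain k where k: "track d B1 (b + \<delta>) k = eps d B1 (b + \<delta>)"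
    using Max_range_attained[OF finite_range_track[OF dp fin(2)]] unfolding eps_def by metis
  have max: "eps d B (b + \<delta>) = track d B (b + \<delta>) t1"
    using m1 good_move_iff[OF dp] last_argmax_Max finite_range_track[OF dp fin(1)] unfolding eps_def by blast
  have "track d B (b + \<delta>) k \<le> eps d B (b + \<delta>)"
    unfolding eps_def using finite_range_track[OF dp fin(1)] by simp
  then have "k \<le> t0 \<and> track d B (b + \<delta>) k = track d B (b + \<delta>) t1"
    using k eps max shifted_tracks(2)[OF d3 m \<delta>] by (auto simp: up_to_def split: if_splits)
  then show ?thesis using that by blast
qed

lemma lowers_braid:
  assumes r: "lowers d r B B1" and s: "lowers d s B B2" and adj: "cartan d r s = -1"
    and e: "eps d B1 s = eps d B s + 1" "eps d B2 r = eps d B r + 1"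
  obtains X1 X2 C Y1 Y2 where
    "lowers d s B1 X1" "lowers d s X1 X2" "lowers d r X2 C"
    "lowers d r B2 Y1" "lowers d r Y1 Y2" "lowers d s Y2 C"
    "eps d X2 r = eps d B r" "eps d Y2 s = eps d B s"
proof -
  note dp = three_imp_pos[OF d3]
  obtain b \<delta> t where \<delta>: "\<delta> = 1 \<or> \<delta> = -1" and b: "d dvd b - r" "d dvd b + \<delta> - s"
    and m: "good_move d B b B1" "good_move d B (b + \<delta> + d * t) B2"
    using adjacent_moves[OF d3 r s adj] .
  have \<delta>': "- \<delta> = 1 \<or> - \<delta> = -1" using \<delta> by auto
  have m0: "good_move d B (b + d * 0) B1" using m(1) by simp
  have base_eq: "b + \<delta> + - \<delta> + d * 0 = b" by simp
  have m0': "good_move d B (b + \<delta> + - \<delta> + d * 0) B1" unfolding base_eq by (rule m(1))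
  have eb: "eps d X b = eps d X r" "eps d X (b + \<delta>) = eps d X s" for X
    using eps_cong[OF dp b(1)] eps_cong[OF dp b(2)] by blast+
  have L: "lowers d r A A'" if "good_move d A (b + d * w) A'" for w A A'
  proof -
    have "b + d * w - r = (b - r) + d * w" by simp
    then have "d dvd b + d * w - r" using b(1) by (metis dvd_add dvd_triv_left)
    then show ?thesis unfolding lowers_def using that by blast
  qed
  have L': "lowers d s A A'" if "good_move d A (b + \<delta> + d * w) A'" for w A A'
  proof -
    have "b + \<delta> + d * w - s = (b + \<delta> - s) + d * w" by simp
    then have "d dvd b + \<delta> + d * w - s" using b(2) by (metis dvd_add dvd_triv_left)
    then show ?thesis unfolding lowers_def using that by blast
  qed
  \<comment> \<open>At equal positions one integer would have to be both a bead and a gap.\<close>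
  have "t \<noteq> 0"
    using good_move_beads(1,2)[OF dp m(1)] good_move_beads(1,2)[OF dp m(2)] \<delta> by auto
  then consider "0 < t" | "t < 0" by linarith
  then show ?thesis
  proof cases
    case 1
    obtain k where "k \<le> 0" "track d B (b + \<delta>) k = track d B (b + \<delta>) t"
      using raised_witness[OF m0 \<delta> m(2)] e(1) eb by metis
    then obtain X1 X2 C Y1 Y2 u v where
      "good_move d B1 (b + \<delta> + d * u) X1" "good_move d X1 (b + \<delta> + d * t) X2" "good_move d X2 (b + d * v) C"
      "good_move d B2 (b + d * 0) Y1" "good_move d Y1 (b + d * v) Y2" "good_move d Y2 (b + \<delta> + d * u) C"
      "eps d X2 b = eps d B b" "eps d Y2 (b + \<delta>) = eps d B (b + \<delta>)"
      using braid_moves[OF \<delta> m0 m(2) 1] by metis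
    then show ?thesis using that L L' eb by metis
  next
    case 2
    \<comment> \<open>The residues change roles: the base point is \<open>b + \<delta>\<close> and
      the offset \<open>- \<delta>\<close>.\<close>
    have bb: "b + \<delta> + - \<delta> = b" by simp
    obtain k where "k \<le> t" "track d B (b + \<delta> + - \<delta>) k = track d B (b + \<delta> + - \<delta>) 0"
      using raised_witness[OF m(2) \<delta>' m0'] e(2) eb bb by metis
    then obtain X1 X2 C Y1 Y2 u v where
      "good_move d B2 (b + \<delta> + - \<delta> + d * u) X1" "good_move d X1 (b + \<delta> + - \<delta> + d * 0) X2"
      "good_move d X2 (b + \<delta> + d * v) C"
      "good_move d B1 (b + \<delta> + d * t) Y1" "good_move d Y1 (b + \<delta> + d * v) Y2"
      "good_move d Y2 (b + \<delta> + - \<delta> + d * u) C"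
      "eps d X2 (b + \<delta>) = eps d B (b + \<delta>)" "eps d Y2 (b + \<delta> + - \<delta>) = eps d B (b + \<delta> + - \<delta>)"
      using braid_moves[OF \<delta>' m(2) m0' 2] by metis
    then show ?thesis using that L L' eb unfolding bb by metis
  qed
qed

text \<open>The mirror image turns removal of good boxes into addition, so the two local relations hold
  for the adding operators as well.\<close>

lemma raises_commute:
  assumes r: "lowers d r B1 B" and s: "lowers d s B2 B" and ne: "cartan d r s \<noteq> 2"
    and phi: "phi d B1 s = phi d B s"
  obtains C where "lowers d s C B1" "lowers d r C B2"
proof -
  note mi = lowers_mirror_iff[OF three_imp_two[OF d3]]
  obtain C where C: "lowers d (- s - 1) (mirror B1) C" "lowers d (- r - 1) (mirror B2) C"
    using lowers_commute[OF d3, of "- r - 1" "mirror B" "mirror B1" "- s - 1" "mirror B2"]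
      r s ne phi cartan_mirror[OF d3] mi unfolding phi_def by metis
  then show ?thesis using that[of "mirror C"] mi by (metis mirror_mirror)
qed

lemma raises_braid:
  assumes r: "lowers d r B1 B" and s: "lowers d s B2 B" and adj: "cartan d r s = -1"
    and p: "phi d B1 s = phi d B s + 1" "phi d B2 r = phi d B r + 1"
  obtains X1 X2 C Y1 Y2 where
    "lowers d s X1 B1" "lowers d s X2 X1" "lowers d r C X2"
    "lowers d r Y1 B2" "lowers d r Y2 Y1" "lowers d s C Y2"
proof -
  note mi = lowers_mirror_iff[OF three_imp_two[OF d3]]
  obtain X1 X2 C Y1 Y2 where
    "lowers d (- s - 1) (mirror B1) X1" "lowers d (- s - 1) X1 X2" "lowers d (- r - 1) X2 C"
    "lowers d (- r - 1) (mirror B2) Y1" "lowers d (- r - 1) Y1 Y2" "lowers d (- s - 1) Y2 C"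
    using lowers_braid[of "- r - 1" "mirror B" "mirror B1" "- s - 1" "mirror B2"]
      r s adj p cartan_mirror[OF d3] mi unfolding phi_def by metis
  then show ?thesis
    using that[of "mirror X1" "mirror X2" "mirror C" "mirror Y1" "mirror Y2"] mi by (metis mirror_mirror)
qed

end

section \<open>Independence of the path\<close>

definition vacuum :: "int set" where
  "vacuum = {c. c \<le> 0}"

text \<open>Pairs reached by paths with opposite residues. Only the number of steps is remembered,
  so uniqueness of the second component is independence of the path.\<close>

inductive twin :: "int \<Rightarrow> nat \<Rightarrow> int set \<Rightarrow> int set \<Rightarrow> bool" for d where
  twin_vacuum: "twin d 0 vacuum vacuum"
| twin_Suc: "twin d n y y' \<Longrightarrow> lowers d i x y \<Longrightarrow> lowers d (- i) x' y' \<Longrightarrow> twin d (Suc n) x x'"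

lemma corners_vacuum: "corners vacuum = {0}"
  by (auto simp: corners_def vacuum_def)

lemma twin_sym: "twin d n x x' \<Longrightarrow> twin d n x' x"
proof (induction rule: twin.induct)
  case twin_vacuum
  then show ?case by (rule twin.twin_vacuum)
next
  case (twin_Suc n y y' i x x')
  then show ?case using twin.twin_Suc[of d n y' y "- i" x' x] by simp
qed

lemma finite_corners_twin:
  assumes "twin d n x x'"
  shows "finite (corners x)" "finite (corners x')"
  using assms finite_corners_lowers by (cases; auto simp: corners_vacuum)+

lemma lowers_cong: "d dvd r - s \<Longrightarrow> lowers d r = lowers d s"
proof -
  assume a: "d dvd r - s"
  have "d dvd c - r \<longleftrightarrow> d dvd c - s" for c
    using dvd_add_left_iff[OF a, of "c - r"] by simp
  then show ?thesis by (simp add: lowers_def fun_eq_iff)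
qed

lemma twin_0: "twin d 0 x x' \<Longrightarrow> x = vacuum \<and> x' = vacuum"
  by (erule twin.cases) auto

lemma not_lowers_vacuum: "0 < d \<Longrightarrow> \<not> lowers d r vacuum B"
  using good_move_beads(1,2) by (fastforce simp: lowers_def vacuum_def)

lemma height_vacuum: "height d vacuum c = (if c \<le> 0 \<and> d dvd c then - 1 else 0)"
proof -
  have "{k. k \<in> corners vacuum \<and> c \<le> k \<and> d dvd k - c} = (if c \<le> 0 \<and> d dvd c then {0} else {})"
    by (auto simp: corners_vacuum)
  then show ?thesis by (simp add: height_def bead_def vacuum_def)
qed

lemma height_mirror_vacuum: "height d (mirror vacuum) c = (if c \<le> -1 \<and> d dvd c + 1 then 1 else 0)"
proof -
  have c: "corners (mirror vacuum) = {-1}" by (auto simp: corners_def vacuum_def)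
  have "- 1 - c = - (c + 1)" by simp
  then have "d dvd - 1 - c \<longleftrightarrow> d dvd c + 1" by (metis dvd_minus_iff)
  then have "{k. k \<in> corners (mirror vacuum) \<and> c \<le> k \<and> d dvd k - c} = (if c \<le> -1 \<and> d dvd c + 1 then {-1} else {})"
    by (auto simp: c)
  then show ?thesis by (simp add: height_def bead_def vacuum_def)
qed

text \<open>The empty partition has a single addable box, of residue 0, so its weights are unchanged
  when residues are negated. This starts the induction in \<open>wt_twin\<close>.\<close>

lemma wt_vacuum:
  assumes "0 < d"
  shows "wt d vacuum r = (if d dvd r then 1 else 0)"
proof -
  have "r \<le> - d" if "d dvd r" "r < 0"
    using that zdvd_imp_le[of d "- r"] by simp
  then show ?thesis
    using wt_eq[OF assms, of vacuum r] assms
    by (auto simp: corners_vacuum track_def height_vacuum height_mirror_vacuum)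
qed

context
  fixes d :: int
  assumes d3: "3 \<le> d"
begin

lemma wt_twin: "twin d n x x' \<Longrightarrow> wt d x r = wt d x' (- r)"
proof (induction rule: twin.induct)
  case twin_vacuum
  then show ?case by (simp add: wt_vacuum[OF three_imp_pos[OF d3]])
next
  case (twin_Suc n y y' i x x')
  then show ?case
    using wt_lowers[OF d3, of i x y r] wt_lowers[OF d3, of "- i" x' y' "- r"] cartan_uminus[OF d3, of i r] by simp
qed

text \<open>Stembridge's induction: two good boxes of a partition are joined by one of the two local
  relations below them, and the same relation read upwards in the other partition produces the
  corresponding pair of good boxes.\<close>

lemma twin_lowers_eps:
  "(\<forall>x x' j z. twin d n x x' \<and> lowers d j x z \<longrightarrow>
      0 < n \<and> (\<exists>z'. lowers d (- j) x' z' \<and> twin d (n - 1) z z'))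
   \<and> (\<forall>x x' r. twin d n x x' \<longrightarrow> eps d x r = eps d x' (- r))"
proof (induction n rule: less_induct)
  case (less n)
  note dp = three_imp_pos[OF d3]
  have IH_drop: "\<exists>k z'. m = Suc k \<and> lowers d (- j) x' z' \<and> twin d k z z'"
    if "twin d m x x'" "lowers d j x z" "m < n" for m x x' j z
  proof -
    have "0 < m \<and> (\<exists>z'. lowers d (- j) x' z' \<and> twin d (m - 1) z z')" using less that by blast
    then show ?thesis by (metis Suc_pred')
  qed
  have IH_phi: "phi d x r = phi d x' (- r)" if "twin d m x x'" "m < n" for m x x' r
    using less that wt_twin[OF that(1), of r] unfolding wt_def by force
  \<comment> \<open>Equal \<open>phi\<close> ensures that an addition on one side has a counterpart
    on the other; the second half of the induction hypothesis serves this purpose.\<close>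
  have IH_lift: "\<exists>z'. lowers d (- r) z' x' \<and> twin d (Suc m) z z'"
    if "twin d m x x'" "lowers d r z x" "m < n" for m x x' r z
  proof -
    note fin = finite_corners_twin[OF that(1)]
    have "0 < phi d x r" using ex_raises_iff[OF three_imp_two[OF d3] fin(1)] that(2) by blast
    then have "0 < phi d x' (- r)" using IH_phi that by simp
    then obtain z' where "lowers d (- r) z' x'" using ex_raises_iff[OF three_imp_two[OF d3] fin(2)] by blast
    then show ?thesis using twin_Suc that by blast
  qed
  have drop: "0 < n \<and> (\<exists>z'. lowers d (- j) x' z' \<and> twin d (n - 1) z z')"
    if x: "twin d n x x'" and z: "lowers d j x z" for x x' j z
  proof (cases n)
    case 0
    then show ?thesis using twin_0 x z not_lowers_vacuum[OF dp] by blast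
  next
    case (Suc m)
    from x[unfolded Suc] obtain y y' i where y: "twin d m y y'" "lowers d i x y" "lowers d (- i) x' y'"
      by cases auto
    have mn: "m < n" using Suc by simp
    have neg: "cartan d (- i) (- j) = cartan d i j" "cartan d (- j) (- i) = cartan d i j"
      "cartan d j i = cartan d i j"
      using cartan_uminus[OF d3] cartan_sym[OF d3] by metis+
    have "\<exists>z'. lowers d (- j) x' z' \<and> twin d m z z'"
    proof (rule cartan_cases[OF d3, of i j])
      assume "cartan d i j = 2" "d dvd j - i"
      moreover have "(- i) - (- j) = j - i" by simp
      ultimately have "lowers d j = lowers d i" "lowers d (- i) = lowers d (- j)"
        using lowers_cong by metis+
      then show ?thesis using y z lowers_det[OF dp] by metis
    next
      \<comment> \<open>The square with top \<open>x\<close>, sides \<open>y\<close> and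
        \<open>z\<close> and bottom \<open>C\<close> is copied along its edges: down from
        \<open>y'\<close> to \<open>C'\<close>, then up to \<open>z'\<close>. Reading the relation
        upwards closes the square at some \<open>W\<close>, which is \<open>x'\<close> because an
        addition to \<open>y'\<close> is determined by its residue.\<close>
      have commuting: ?thesis if ne: "cartan d i j \<noteq> 2" and same: "eps d y j = eps d x j"
      proof -
        obtain C where C: "lowers d j y C" "lowers d i z C" "eps d z i = eps d x i - cartan d i j"
          using lowers_commute[OF d3 y(2) z ne same] by metis
        obtain k C' where k: "m = Suc k" "lowers d (- j) y' C'" "twin d k C C'"
          using IH_drop[OF y(1) C(1) mn] by blast
        obtain z' where z': "lowers d (- i) z' C'" "twin d m z z'"
          using IH_lift[OF k(3) C(2)] k(1) mn by auto
        \<comment> \<open>From \<open>y\<close> to \<open>C\<close> the weight changes by the Cartan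
          entry and \<open>eps\<close> by its negative.\<close>
        have "phi d y i = phi d C i"
          using C(3) eps_lowers[OF d3 y(2)] eps_lowers[OF d3 C(2)] wt_lowers[OF d3 C(1), of i] neg(3)
          unfolding wt_def by linarith
        then have "phi d y' (- i) = phi d C' (- i)"
          using IH_phi[OF y(1) mn] IH_phi[OF k(3)] k(1) mn by simp
        then obtain W where W: "lowers d (- i) W y'" "lowers d (- j) W z'"
          using raises_commute[OF d3 k(2) z'(1)] ne neg by metis
        then have "W = x'" using lowers_inj[OF three_imp_two[OF d3]] y(3) by blast
        then show ?thesis using W z' by blast
      qed
      {
        assume "cartan d i j = 0"
        then show ?thesis using commuting eps_lowers_orthogonal[OF d3 y(2)] by simp
      next
        assume adj: "cartan d i j = -1"
        consider "eps d y j = eps d x j" | "eps d z i = eps d x i"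
          | "eps d y j = eps d x j + 1" "eps d z i = eps d x i + 1"
          using eps_lowers_adjacent[OF d3 y(2) adj] eps_lowers_adjacent[OF d3 z] adj neg(3) by metis
        then show ?thesis
        proof cases
          case 1
          then show ?thesis using commuting adj by simp
        next
          case 2
          have ne: "cartan d j i \<noteq> 2" using adj neg(3) by simp
          obtain C where C: "lowers d i z C" "lowers d j y C" "eps d y j = eps d x j - cartan d j i"
            using lowers_commute[OF d3 z y(2) ne 2] .
          obtain k C' where k: "m = Suc k" "lowers d (- j) y' C'" "twin d k C C'"
            using IH_drop[OF y(1) C(2) mn] by blast
          obtain z' where z': "lowers d (- i) z' C'" "twin d m z z'"
            using IH_lift[OF k(3) C(1)] k(1) mn by auto
          have "phi d z j = phi d C j"
            using C(3) eps_lowers[OF d3 z] eps_lowers[OF d3 C(2)] wt_lowers[OF d3 C(1), of j] neg(3)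
            unfolding wt_def by linarith
          then have "phi d z' (- j) = phi d C' (- j)"
            using IH_phi[OF z'(2) mn] IH_phi[OF k(3)] k(1) mn by simp
          moreover have "cartan d (- i) (- j) \<noteq> 2" using adj neg(1) by simp
          ultimately obtain W where W: "lowers d (- j) W z'" "lowers d (- i) W y'"
            using raises_commute[OF d3 z'(1) k(2)] by metis
          then have "W = x'" using lowers_inj[OF three_imp_two[OF d3]] y(3) by blast
          then show ?thesis using W z' by blast
        next
          case 3
          \<comment> \<open>The same copying around the relation of degree four: three steps down
            from \<open>y'\<close> to \<open>C'\<close> and three steps up to
            \<open>z'\<close>.\<close>
          obtain X1 X2 C Y1 Y2 where
            X: "lowers d j y X1" "lowers d j X1 X2" "lowers d i X2 C"
            and Y: "lowers d i z Y1" "lowers d i Y1 Y2" "lowers d j Y2 C"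
            and e: "eps d X2 i = eps d x i" "eps d Y2 j = eps d x j"
            using lowers_braid[OF d3 y(2) z adj 3] by metis
          obtain k1 X1' where k1: "m = Suc k1" "lowers d (- j) y' X1'" "twin d k1 X1 X1'"
            using IH_drop[OF y(1) X(1) mn] by blast
          obtain k2 X2' where k2: "k1 = Suc k2" "lowers d (- j) X1' X2'" "twin d k2 X2 X2'"
            using IH_drop[OF k1(3) X(2)] k1(1) mn by auto
          obtain k3 C' where k3: "k2 = Suc k3" "lowers d (- i) X2' C'" "twin d k3 C C'"
            using IH_drop[OF k2(3) X(3)] k1(1) k2(1) mn by auto
          obtain Y2' where Y2': "lowers d (- j) Y2' C'" "twin d k2 Y2 Y2'"
            using IH_lift[OF k3(3) Y(3)] k1(1) k2(1) k3(1) mn by auto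
          obtain Y1' where Y1': "lowers d (- i) Y1' Y2'" "twin d k1 Y1 Y1'"
            using IH_lift[OF Y2'(2) Y(2)] k1(1) k2(1) mn by auto
          obtain z' where z': "lowers d (- i) z' Y1'" "twin d m z z'"
            using IH_lift[OF Y1'(2) Y(1)] k1(1) mn by auto
          have "phi d X2 j = phi d C j + 1"
            using eps_lowers[OF d3 y(2)] eps_lowers[OF d3 X(1)] eps_lowers[OF d3 X(2)]
              eps_lowers[OF d3 Y(3)] e(2) 3 wt_lowers[OF d3 X(3), of j] adj
            unfolding wt_def by linarith
          then have p1: "phi d X2' (- j) = phi d C' (- j) + 1"
            using IH_phi[OF k2(3), of j] IH_phi[OF k3(3), of j] k1(1) k2(1) k3(1) mn by simp
          have "phi d Y2 i = phi d C i + 1"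
            using eps_lowers[OF d3 z] eps_lowers[OF d3 Y(1)] eps_lowers[OF d3 Y(2)]
              eps_lowers[OF d3 X(3)] e(1) 3 wt_lowers[OF d3 Y(3), of i] adj neg(3)
            unfolding wt_def by linarith
          then have p2: "phi d Y2' (- i) = phi d C' (- i) + 1"
            using IH_phi[OF Y2'(2), of i] IH_phi[OF k3(3), of i] k1(1) k2(1) k3(1) mn by simp
          have "cartan d (- i) (- j) = -1" using adj neg(1) by simp
          then obtain V1 V2 W U1 U2 where
            "lowers d (- j) V1 X2'" "lowers d (- j) V2 V1" "lowers d (- i) W V2"
            "lowers d (- i) U1 Y2'" "lowers d (- i) U2 U1" "lowers d (- j) W U2"
            using raises_braid[OF d3 k3(2) Y2'(1) _ p1 p2] by metis
          \<comment> \<open>Additions being determined by their residues, the upward relation passes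
            through \<open>X1'\<close>, \<open>y'\<close>, \<open>x'\<close> on one side and through
            \<open>Y1'\<close>, \<open>z'\<close> on the other.\<close>
          then have "lowers d (- j) x' z'"
            using lowers_inj[OF three_imp_two[OF d3]] k2(2) k1(2) y(3) Y1'(1) z'(1) by metis
          then show ?thesis using z' by blast
        qed
      }
    qed
    then show ?thesis using Suc by simp
  qed
  have "eps d x r = eps d x' (- r)" if x: "twin d n x x'" for x x' r
  proof -
    note fin = finite_corners_twin[OF x]
    note ex = ex_lowers_iff[OF dp fin(1)] ex_lowers_iff[OF dp fin(2)]
    consider z where "lowers d r x z" | "\<not> (\<exists>z. lowers d r x z)" by blast
    then show ?thesis
    proof cases
      case 1
      then obtain z' where z': "0 < n" "lowers d (- r) x' z'" "twin d (n - 1) z z'"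
        using drop[OF x] by blast
      then have "eps d z r = eps d z' (- r)" using less[of "n - 1"] by simp
      then show ?thesis using eps_lowers[OF d3 1] eps_lowers[OF d3 z'(2)] by simp
    next
      case 2
      \<comment> \<open>A removal on the right would give one on the left by symmetry of
        \<open>twin\<close>, so both values of \<open>eps\<close> are 0.\<close>
      have "\<not> (\<exists>z. lowers d (- r) x' z)"
        using drop[OF twin_sym[OF x], of "- r"] 2 by auto
      then show ?thesis
        using 2 ex[of r] ex[of "- r"] eps_nonneg[OF dp fin(1), of r] eps_nonneg[OF dp fin(2), of "- r"] by simp
    qed
  qed
  then show ?case using drop by blast
qed

text \<open>The last step of the path to \<open>x''\<close> is transported to \<open>x'\<close>. The
  lower ends agree by induction, and both partitions arise from that common end by adding residue
  \<open>- i\<close>.\<close>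

lemma twin_unique_3:
  "twin d n x x' \<Longrightarrow> twin d n x x'' \<Longrightarrow> x' = x''"
proof (induction n arbitrary: x x' x'')
  case 0
  then show ?case using twin_0 by blast
next
  case (Suc n)
  from Suc.prems(2) obtain y y'' i where y: "twin d n y y''" "lowers d i x y" "lowers d (- i) x'' y''"
    by cases auto
  have "\<exists>y'. lowers d (- i) x' y' \<and> twin d (Suc n - 1) y y'"
    using twin_lowers_eps[of "Suc n"] Suc.prems(1) y(2) by blast
  then obtain y' where y': "lowers d (- i) x' y'" "twin d n y y'" by auto
  then have "y' = y''" using Suc.IH y(1) by blast
  then show ?case using y' y(3) lowers_inj[OF three_imp_two[OF d3]] by blast
qed

end

lemma twin_2: "twin 2 n x x' \<Longrightarrow> x = x'"
proof (induction rule: twin.induct)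
  case (twin_Suc n y y' i x x')
  have "lowers 2 (- i) = lowers 2 i" by (rule lowers_cong) simp
  then show ?case using twin_Suc lowers_inj[of 2] by auto
qed simp

lemma twin_unique:
  assumes "2 \<le> d" "twin d n x x'" "twin d n x x''"
  shows "x' = x''"
proof (cases "d = 2")
  case True
  then show ?thesis using assms twin_2 by blast
next
  case False
  then show ?thesis using assms twin_unique_3[of d] by simp
qed

section \<open>Good boxes as good moves\<close>

text \<open>Normalised so that the box just right of row \<open>j\<close> has content
  \<open>slot \<nu> j\<close> and the last box of the row content \<open>slot \<nu> j - 1\<close>.
  Corners of the bead set are then the contents of addable and removable boxes.\<close>

definition slot :: "nat list \<Rightarrow> nat \<Rightarrow> int" where
  "slot \<nu> j = int (row \<nu> j) - int j"

definition beads :: "nat list \<Rightarrow> int set" where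
  "beads \<nu> = range (slot \<nu>)"

lemma beads_Nil: "beads [] = vacuum"
proof -
  have "c \<in> range (\<lambda>j. - int j)" if "c \<le> 0" for c
    using that by (intro rev_image_eqI[of "nat (- c)"]) auto
  then show ?thesis by (auto simp: beads_def slot_def row_def vacuum_def)
qed

lemma bead_less_iff: "bead B c < bead B e \<longleftrightarrow> c \<notin> B \<and> e \<in> B"
  by (simp add: bead_def)

lemma strict_decreasing_range_eq:
  fixes f g :: "nat \<Rightarrow> int"
  assumes f: "\<And>i j. i < j \<Longrightarrow> f j < f i" and g: "\<And>i j. i < j \<Longrightarrow> g j < g i" and eq: "range f = range g"
  shows "f = g"
proof
  fix j
  show "f j = g j"
  proof (induction j rule: less_induct)
    case (less j)
    obtain k where k: "f j = g k" using eq by (metis rangeE rangeI)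
    obtain l where l: "g j = f l" using eq by (metis rangeE rangeI)
    have "\<not> k < j" using less[of k] f[of k j] k by auto
    moreover have "\<not> l < j" using less[of l] g[of l j] l by auto
    ultimately have "f j \<le> g j" "g j \<le> f j"
      using f[of j l] g[of j k] k l by (metis le_less linorder_neqE_nat)+
    then show ?case by simp
  qed
qed

context
  fixes \<nu> :: "nat list"
  assumes \<nu>: "is_partition \<nu>"
begin

lemma slot_strict: "i < j \<Longrightarrow> slot \<nu> j < slot \<nu> i"
  using row_antimono[OF \<nu>, of i j] by (simp add: slot_def)

lemma slot_less_iff: "slot \<nu> j < slot \<nu> i \<longleftrightarrow> i < j"
  using slot_strict by (metis linorder_neqE_nat not_less_iff_gr_or_eq)

lemma slot_eq_iff: "slot \<nu> j = slot \<nu> i \<longleftrightarrow> i = j"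
  using slot_less_iff by (metis less_irrefl linorder_neqE_nat)

lemma addable_slot:
  "addable \<nu> A \<longleftrightarrow> (\<exists>j. A = (slot \<nu> j + int j + 1, - int j - 1) \<and> slot \<nu> j + 1 \<notin> beads \<nu>)"
proof -
  have "slot \<nu> j + 1 \<notin> beads \<nu> \<longleftrightarrow> j = 0 \<or> row \<nu> j < row \<nu> (j - 1)" for j
  proof
    assume n: "slot \<nu> j + 1 \<notin> beads \<nu>"
    have "row \<nu> j < row \<nu> (j - 1)" if "j \<noteq> 0"
    proof (rule ccontr)
      assume "\<not> row \<nu> j < row \<nu> (j - 1)"
      then have "slot \<nu> j + 1 = slot \<nu> (j - 1)"
        using row_antimono[OF \<nu>, of "j - 1" j] that by (simp add: slot_def)
      then show False using n by (simp add: beads_def)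
    qed
    then show "j = 0 \<or> row \<nu> j < row \<nu> (j - 1)" by blast
  next
    assume j: "j = 0 \<or> row \<nu> j < row \<nu> (j - 1)"
    show "slot \<nu> j + 1 \<notin> beads \<nu>"
    proof
      assume "slot \<nu> j + 1 \<in> beads \<nu>"
      then obtain i where i: "slot \<nu> i = slot \<nu> j + 1" by (auto simp: beads_def)
      then have "i < j" using slot_less_iff[of j i] by simp
      then have "slot \<nu> (j - 1) \<le> slot \<nu> i" "j \<noteq> 0"
        using slot_less_iff[of i "j - 1"] by auto
      then show False using i j by (simp add: slot_def)
    qed
  qed
  then show ?thesis unfolding addable_row[OF \<nu>] by (simp add: slot_def)
qed

lemma removable_slot:
  "removable \<nu> A \<longleftrightarrow> (\<exists>j. A = (slot \<nu> j + int j, - int j - 1) \<and> slot \<nu> j - 1 \<notin> beads \<nu>)"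
proof -
  have "slot \<nu> j - 1 \<notin> beads \<nu> \<longleftrightarrow> row \<nu> (Suc j) < row \<nu> j" for j
  proof
    assume n: "slot \<nu> j - 1 \<notin> beads \<nu>"
    show "row \<nu> (Suc j) < row \<nu> j"
    proof (rule ccontr)
      assume "\<not> row \<nu> (Suc j) < row \<nu> j"
      then have "slot \<nu> j - 1 = slot \<nu> (Suc j)"
        using row_antimono[OF \<nu>, of j "Suc j"] by (simp add: slot_def)
      then show False using n by (simp add: beads_def)
    qed
  next
    assume j: "row \<nu> (Suc j) < row \<nu> j"
    show "slot \<nu> j - 1 \<notin> beads \<nu>"
    proof
      assume "slot \<nu> j - 1 \<in> beads \<nu>"
      then obtain i where i: "slot \<nu> i = slot \<nu> j - 1" by (auto simp: beads_def)
      then have "j < i" using slot_less_iff[of i j] by simp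
      then have "slot \<nu> i \<le> slot \<nu> (Suc j)"
        using slot_less_iff[of "Suc j" i] by (auto simp: not_less[symmetric])
      then show False using i j by (simp add: slot_def)
    qed
  qed
  then show ?thesis unfolding removable_row[OF \<nu>] by (simp add: slot_def)
qed

lemma addable_content:
  assumes "addable \<nu> A"
  obtains j where "content A = slot \<nu> j" "snd A = - int j - 1" "content A \<in> beads \<nu>" "content A + 1 \<notin> beads \<nu>"
    "A = (slot \<nu> j + int j + 1, - int j - 1)"
  using assms by (auto simp: addable_slot content_def beads_def)

lemma removable_content:
  assumes "removable \<nu> A"
  obtains j where "content A = slot \<nu> j - 1" "snd A = - int j - 1" "content A \<notin> beads \<nu>" "content A + 1 \<in> beads \<nu>"
    "A = (slot \<nu> j + int j, - int j - 1)"
  using assms by (auto simp: removable_slot content_def beads_def)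

lemma ex_addable:
  assumes "c \<in> beads \<nu>" "c + 1 \<notin> beads \<nu>"
  obtains A where "addable \<nu> A" "content A = c"
proof -
  obtain j where "c = slot \<nu> j" using assms(1) by (auto simp: beads_def)
  then show ?thesis
    using that[of "(slot \<nu> j + int j + 1, - int j - 1)"] assms(2) by (auto simp: addable_slot content_def)
qed

lemma ex_removable:
  assumes "c \<notin> beads \<nu>" "c + 1 \<in> beads \<nu>"
  obtains A where "removable \<nu> A" "content A = c"
proof -
  obtain j where "c + 1 = slot \<nu> j" using assms(2) by (auto simp: beads_def)
  then have c: "c = slot \<nu> j - 1" by simp
  then show ?thesis
    using that[of "(slot \<nu> j + int j, - int j - 1)"] assms(1) by (auto simp: removable_slot content_def)
qed

lemma ex_addable_iff: "(\<exists>A. addable \<nu> A \<and> content A = c) \<longleftrightarrow> c \<in> beads \<nu> \<and> c + 1 \<notin> beads \<nu>"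
proof
  assume "\<exists>A. addable \<nu> A \<and> content A = c"
  then obtain A where "addable \<nu> A" "content A = c" by blast
  then show "c \<in> beads \<nu> \<and> c + 1 \<notin> beads \<nu>" using addable_content[of A] by blast
qed (use ex_addable in blast)

lemma ex_removable_iff: "(\<exists>A. removable \<nu> A \<and> content A = c) \<longleftrightarrow> c \<notin> beads \<nu> \<and> c + 1 \<in> beads \<nu>"
proof
  assume "\<exists>A. removable \<nu> A \<and> content A = c"
  then obtain A where "removable \<nu> A" "content A = c" by blast
  then show "c \<notin> beads \<nu> \<and> c + 1 \<in> beads \<nu>" using removable_content[of A] by blast
qed (use ex_removable in blast)

lemma inj_on_content_addable: "inj_on content {A. addable \<nu> A}"
proof (rule inj_onI)
  fix A C assume a: "A \<in> {A. addable \<nu> A}" "C \<in> {A. addable \<nu> A}" "content A = content C"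
  obtain i where i: "content A = slot \<nu> i" "A = (slot \<nu> i + int i + 1, - int i - 1)"
    using addable_content a by blast
  obtain j where j: "content C = slot \<nu> j" "C = (slot \<nu> j + int j + 1, - int j - 1)"
    using addable_content a by blast
  have "i = j" using i j a(3) slot_eq_iff[of i j] by simp
  then show "A = C" using i j by simp
qed

lemma inj_on_content_removable: "inj_on content {A. removable \<nu> A}"
proof (rule inj_onI)
  fix A C assume a: "A \<in> {A. removable \<nu> A}" "C \<in> {A. removable \<nu> A}" "content A = content C"
  obtain i where i: "content A = slot \<nu> i - 1" "A = (slot \<nu> i + int i, - int i - 1)"
    using removable_content a by blast
  obtain j where j: "content C = slot \<nu> j - 1" "C = (slot \<nu> j + int j, - int j - 1)"
    using removable_content a by blast
  have "i = j" using i j a(3) slot_eq_iff[of i j] by simp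
  then show "A = C" using i j by simp
qed

lemma finite_corners_beads: "finite (corners (beads \<nu>))"
proof -
  have "corners (beads \<nu>) \<subseteq> {- int (length \<nu>) - 1..slot \<nu> 0}"
  proof
    fix c assume c: "c \<in> corners (beads \<nu>)"
    have low: "e \<in> beads \<nu>" if "e \<le> - int (length \<nu>)" for e
    proof -
      have "e = slot \<nu> (nat (- e))" using that by (auto simp: slot_def row_def)
      then show ?thesis unfolding beads_def by blast
    qed
    have high: "e \<le> slot \<nu> 0" if "e \<in> beads \<nu>" for e
      using that slot_less_iff by (fastforce simp: beads_def not_less[symmetric])
    have "- int (length \<nu>) - 1 \<le> c" using c low[of c] low[of "c + 1"] by (force simp: corners_def)
    moreover have "c \<le> slot \<nu> 0" using c high[of c] high[of "c + 1"] by (force simp: corners_def)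
    ultimately show "c \<in> {- int (length \<nu>) - 1..slot \<nu> 0}" by simp
  qed
  then show ?thesis by (rule finite_subset) simp
qed

lemma telescope:
  assumes "0 < d"
  shows "track d (beads \<nu>) c 1 - track d (beads \<nu>) c (int s + 1)
    = int (card {t\<in>{1..s}. c + d * int t \<notin> beads \<nu> \<and> c + d * int t + 1 \<in> beads \<nu>})
    - int (card {t\<in>{1..s}. c + d * int t \<in> beads \<nu> \<and> c + d * int t + 1 \<notin> beads \<nu>})"
proof (induction s)
  case (Suc s)
  have split: "{t\<in>{1..Suc s}. R t} = {t\<in>{1..s}. R t} \<union> (if R (Suc s) then {Suc s} else {})" for R
    by (auto simp: le_Suc_eq)
  have "track d (beads \<nu>) c (int (Suc s)) = track d (beads \<nu>) c (int (Suc s) + 1)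
      + (bead (beads \<nu>) (c + d * int (Suc s) + 1) - bead (beads \<nu>) (c + d * int (Suc s)))"
    by (rule track_step[OF assms finite_corners_beads])
  then show ?case using Suc unfolding split by (auto simp: bead_def card_insert_if add.commute)
qed simp

text \<open>Boxes of one kind are determined by their contents, so those of one residue in a range
  are counted by positions of the walk.\<close>

lemma card_residue_boxes:
  assumes inj: "inj_on content {D. R D}" and d: "0 < d"
    and in_range: "\<And>D. R D \<Longrightarrow> Q D \<longleftrightarrow> int d dvd content D - c \<and> c < content D \<and> content D \<le> c + int d * int s"
    and ex: "\<And>t. (\<exists>D. R D \<and> content D = c + int d * int t) \<longleftrightarrow> T t"
  shows "card {D. R D \<and> Q D} = card {t\<in>{1..s}. T t}"
proof -
  have "content ` {D. R D \<and> Q D} = (\<lambda>t. c + int d * int t) ` {t\<in>{1..s}. T t}"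
  proof (intro equalityI subsetI)
    fix e assume "e \<in> content ` {D. R D \<and> Q D}"
    then obtain D where D: "R D" "e = content D" "int d dvd e - c" "c < e" "e \<le> c + int d * int s"
      using in_range by blast
    obtain u where u: "e - c = int d * u" using D(3) by blast
    then have "0 < int d * u" "int d * u \<le> int d * int s" using D by auto
    then have u1: "0 < u" "u \<le> int s" using d by (auto simp: zero_less_mult_iff)
    then have e: "e = c + int d * int (nat u)" using u by simp
    then have "T (nat u)" using ex[of "nat u"] D by metis
    moreover have "nat u \<in> {1..s}" using u1 by auto
    ultimately show "e \<in> (\<lambda>t. c + int d * int t) ` {t\<in>{1..s}. T t}" using e by blast
  next
    fix e assume "e \<in> (\<lambda>t. c + int d * int t) ` {t\<in>{1..s}. T t}"
    then obtain t where t: "e = c + int d * int t" "1 \<le> t" "t \<le> s" "T t" by auto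
    then obtain D where D: "R D" "content D = e" using ex by blast
    have "int d * int t \<le> int d * int s" "0 < int d * int t" using t d by auto
    then have "Q D" using in_range[OF D(1)] D(2) t by simp
    then show "e \<in> content ` {D. R D \<and> Q D}" using D by blast
  qed
  moreover have "inj_on content {D. R D \<and> Q D}" using inj by (rule inj_on_subset) auto
  moreover have "inj_on (\<lambda>t. c + int d * int t) {t\<in>{1..s}. T t}" using d by (auto simp: inj_on_def)
  ultimately show ?thesis by (metis (no_types, lifting) card_image)
qed

lemma residue_eq_iff: "residue d C = residue d A \<longleftrightarrow> int d dvd content C - content A"
  by (simp add: residue_def content_def mod_eq_dvd_iff)

text \<open>Normality compares rows, the walk compares contents. In a common row the contents of the
  two boxes differ by 1, so their residues differ; in different rows the two orders agree.\<close>

lemma above_addable: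
  assumes "2 \<le> d" "removable \<nu> A" "addable \<nu> C" "residue d C = residue d A"
  shows "snd A < snd C \<longleftrightarrow> content A < content C" "snd C < snd A \<longleftrightarrow> content C < content A" "content C \<noteq> content A"
proof -
  obtain i where i: "content A = slot \<nu> i - 1" "snd A = - int i - 1" using removable_content assms by blast
  obtain j where j: "content C = slot \<nu> j" "snd C = - int j - 1" using addable_content assms by blast
  have ne: "content A \<noteq> content C"
  proof
    assume eq: "content A = content C"
    have "content C \<in> beads \<nu>" using addable_content[OF assms(3)] by blast
    moreover have "content A \<notin> beads \<nu>" using removable_content[OF assms(2)] by blast
    ultimately show False using eq by simp
  qed
  have "i \<noteq> j"
  proof
    assume "i = j"
    then have "int d dvd 1" using assms(4) i j unfolding residue_eq_iff by simp
    then show False using assms(1) by simp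
  qed
  then consider "i < j" | "j < i" by linarith
  then have "content C < content A \<and> snd C < snd A \<or> content A < content C \<and> snd A < snd C"
  proof cases
    case 1
    then have "slot \<nu> j < slot \<nu> i" "snd C < snd A" using slot_less_iff i(2) j(2) by simp_all
    then show ?thesis using ne i(1) j(1) by linarith
  next
    case 2
    then have "slot \<nu> i < slot \<nu> j" "snd A < snd C" using slot_less_iff i(2) j(2) by simp_all
    then show ?thesis using i(1) j(1) by linarith
  qed
  then show "content C \<noteq> content A" "snd A < snd C \<longleftrightarrow> content A < content C" "snd C < snd A \<longleftrightarrow> content C < content A"
    by linarith+
qed

lemma above_removable:
  assumes "removable \<nu> A" "removable \<nu> C"
  shows "snd A < snd C \<longleftrightarrow> content A < content C"
proof -
  obtain i where i: "content A = slot \<nu> i - 1" "snd A = - int i - 1" using removable_content assms by blast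
  obtain j where j: "content C = slot \<nu> j - 1" "snd C = - int j - 1" using removable_content assms by blast
  show ?thesis using i j slot_less_iff[of i j] by auto
qed

lemma addable_above_addable:
  assumes "addable \<nu> A" "addable \<nu> C"
  shows "snd A \<le> snd C \<longleftrightarrow> content A \<le> content C"
proof -
  obtain i where i: "content A = slot \<nu> i" "snd A = - int i - 1" using addable_content assms by blast
  obtain j where j: "content C = slot \<nu> j" "snd C = - int j - 1" using addable_content assms by blast
  show ?thesis using i j slot_less_iff[of j i] by auto
qed

text \<open>The counts telescope along positions 1 to \<open>s\<close>. Position \<open>s\<close>
  holds the addable box \<open>C\<close>, so the strict bound for removable boxes and the weak one
  for addable boxes give the same range.\<close>

lemma normal_condition:
  assumes d: "2 \<le> d" and A: "removable \<nu> A" and C: "addable \<nu> C" "content C = content A + int d * int s" "1 \<le> s"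
  shows "card {D. addable \<nu> D \<and> residue d D = residue d A \<and> snd A < snd D \<and> snd D \<le> snd C}
      \<le> card {D. removable \<nu> D \<and> residue d D = residue d A \<and> snd A < snd D \<and> snd D < snd C}
    \<longleftrightarrow> track (int d) (beads \<nu>) (content A) (int s + 1) \<le> track (int d) (beads \<nu>) (content A) 1"
proof -
  let ?c = "content A"
  have d0: "0 < d" using d by simp
  have CA: "residue d C = residue d A" using C(2) by (simp add: residue_eq_iff)
  have add: "card {D. addable \<nu> D \<and> residue d D = residue d A \<and> snd A < snd D \<and> snd D \<le> snd C}
    = card {t\<in>{1..s}. ?c + int d * int t \<in> beads \<nu> \<and> ?c + int d * int t + 1 \<notin> beads \<nu>}"
  proof (rule card_residue_boxes[OF inj_on_content_addable d0])
    fix D assume D: "addable \<nu> D"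
    show "residue d D = residue d A \<and> snd A < snd D \<and> snd D \<le> snd C \<longleftrightarrow>
      int d dvd content D - ?c \<and> ?c < content D \<and> content D \<le> ?c + int d * int s"
      using above_addable(1)[OF d A D] addable_above_addable[OF D C(1)] C(2) residue_eq_iff by metis
  next
    fix t
    show "(\<exists>D. addable \<nu> D \<and> content D = ?c + int d * int t) \<longleftrightarrow>
      ?c + int d * int t \<in> beads \<nu> \<and> ?c + int d * int t + 1 \<notin> beads \<nu>"
      by (rule ex_addable_iff)
  qed
  have rem: "card {D. removable \<nu> D \<and> residue d D = residue d A \<and> snd A < snd D \<and> snd D < snd C}
    = card {t\<in>{1..s}. ?c + int d * int t \<notin> beads \<nu> \<and> ?c + int d * int t + 1 \<in> beads \<nu>}"
  proof (rule card_residue_boxes[OF inj_on_content_removable d0])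
    fix D assume D: "removable \<nu> D"
    have "snd D < snd C \<longleftrightarrow> content D \<le> content C" if "residue d D = residue d A"
      using above_addable[OF d D C(1)] CA that by auto
    then show "residue d D = residue d A \<and> snd A < snd D \<and> snd D < snd C \<longleftrightarrow>
      int d dvd content D - ?c \<and> ?c < content D \<and> content D \<le> ?c + int d * int s"
      using above_removable[OF A D] C(2) residue_eq_iff by metis
  next
    fix t
    show "(\<exists>D. removable \<nu> D \<and> content D = ?c + int d * int t) \<longleftrightarrow>
      ?c + int d * int t \<notin> beads \<nu> \<and> ?c + int d * int t + 1 \<in> beads \<nu>"
      by (rule ex_removable_iff)
  qed
  show ?thesis using telescope[of "int d" ?c s] d0 unfolding add rem by linarith
qed

lemma residue_offset:
  assumes "0 < d" "residue d C = residue d A" "content A < content C"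
  obtains s where "1 \<le> s" "content C = content A + int d * int s"
proof -
  obtain u where u: "content C - content A = int d * u" using assms(2) residue_eq_iff by blast
  then have "0 < int d * u" using assms by simp
  then have "0 < u" using assms by (simp add: zero_less_mult_iff)
  then show ?thesis using that[of "nat u"] u by force
qed

text \<open>Normality keeps the walk to the right at or below its value at 1, one less than at 0;
  being the lowest normal box excludes larger values to the left.\<close>

lemma good_box_last_argmax:
  assumes d: "2 \<le> d" and A: "good_box d \<nu> A"
  shows "last_argmax (track (int d) (beads \<nu>) (content A)) 0"
proof -
  define P where "P = track (int d) (beads \<nu>) (content A)"
  have d0: "0 < d" "0 < int d" using d by auto
  have normal: "normal_box d \<nu> A" and rem: "removable \<nu> A"
    using A by (auto simp: good_box_def normal_box_def)
  have bits: "content A \<notin> beads \<nu>" "content A + 1 \<in> beads \<nu>" using removable_content[OF rem] by blast+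
  have step: "P t = P (t + 1) + (bead (beads \<nu>) (content A + int d * t + 1) - bead (beads \<nu>) (content A + int d * t))" for t
    unfolding P_def by (rule track_step[OF d0(2) finite_corners_beads])
  have P0: "P 0 = P 1 + 1" using step[of 0] bits by (simp add: bead_def)
  \<comment> \<open>Going right, the walk rises only at addable boxes, and normality controls it
    exactly there.\<close>
  have upper: "P (int t + 1) \<le> P 1" for t
  proof (induction t)
    case (Suc t)
    let ?k = "content A + int d * int (Suc t)"
    show ?case
    proof (rule ccontr)
      assume n: "\<not> P (int (Suc t) + 1) \<le> P 1"
      have "P (int (Suc t)) = P (int (Suc t) + 1) + (bead (beads \<nu>) (?k + 1) - bead (beads \<nu>) ?k)"
        by (rule step)
      moreover have "P (int (Suc t)) \<le> P 1" using Suc by (simp add: add.commute)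
      ultimately have "bead (beads \<nu>) (?k + 1) < bead (beads \<nu>) ?k" using n by linarith
      then have "?k \<in> beads \<nu>" "?k + 1 \<notin> beads \<nu>" unfolding bead_less_iff by blast+
      then obtain C where C: "addable \<nu> C" "content C = ?k" using ex_addable by blast
      have CA: "residue d C = residue d A" using C(2) by (simp add: residue_eq_iff)
      have "content A < content C" using C(2) d0 by simp
      then have above: "snd A < snd C" using above_addable(1)[OF d rem C(1) CA] by simp
      note card_le = normal[unfolded normal_box_def, THEN conjunct2, rule_format, OF conjI[OF C(1) conjI[OF CA above]]]
      have "P (int (Suc t) + 1) \<le> P 1"
        unfolding P_def by (rule normal_condition[OF d rem C(1,2) _ , THEN iffD1, OF _ card_le]) simp
      then show False using n by blast
    qed
  qed simp
  have above: "P t \<le> P 1" if "0 < t" for t using upper[of "nat (t - 1)"] that by simp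
  have below: "P t \<le> P 0" if "t < 0" for t
  proof (rule ccontr)
    assume "\<not> P t \<le> P 0"
    then have "P 0 < P t" "t \<le> 0" using that by simp_all
    \<comment> \<open>At the last position with a value above \<open>P 0\<close> the walk drops to
      exactly \<open>P 0\<close> and never exceeds it afterwards. There is a removable box there, it
      is normal, and it lies below \<open>A\<close>.\<close>
    then obtain u where u: "P 0 < P u" "t \<le> u" "u \<le> 0" "\<forall>l. u < l \<and> l \<le> 0 \<longrightarrow> \<not> P 0 < P l"
      by (rule last_below[where A = "\<lambda>l. P 0 < P l"]) blast
    have "u \<noteq> 0" using u(1) by auto
    then have le: "P l \<le> P 0" if "u < l" for l
      using u(4) above[of l] P0 that by (cases "l \<le> 0") (auto simp: not_less)
    let ?k = "content A + int d * u"
    have "bead (beads \<nu>) ?k < bead (beads \<nu>) (?k + 1)" using step[of u] u(1) le[of "u + 1"] by linarith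
    then have k: "?k \<notin> beads \<nu>" "?k + 1 \<in> beads \<nu>" unfolding bead_less_iff by blast+
    then have eq: "P (u + 1) = P 0" using step[of u] u(1) le[of "u + 1"] by (simp add: bead_def)
    then obtain C where C: "removable \<nu> C" "content C = ?k" using ex_removable k by blast
    have CA: "residue d C = residue d A" using C(2) by (simp add: residue_eq_iff)
    have "int d * u < 0" using d0 \<open>u \<noteq> 0\<close> u(3) by (simp add: mult_less_0_iff)
    then have "snd C < snd A" using above_removable[OF C(1) rem] C(2) by simp
    moreover have "normal_box d \<nu> C"
      unfolding normal_box_def
    proof (intro conjI allI impI)
      show "removable \<nu> C" by (rule C)
      fix D assume D: "addable \<nu> D \<and> residue d D = residue d C \<and> snd C < snd D"
      then have "content C < content D" using above_addable(1)[OF d C(1), of D] by simp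
      then obtain s where s: "1 \<le> s" "content D = content C + int d * int s"
        using residue_offset[OF d0(1)] D by blast
      have "track (int d) (beads \<nu>) (content C) t = P (u + t)" for t
        unfolding C(2) P_def by (rule track_shift[OF d0(2)])
      then show "card {E. addable \<nu> E \<and> residue d E = residue d C \<and> snd C < snd E \<and> snd E \<le> snd D}
        \<le> card {E. removable \<nu> E \<and> residue d E = residue d C \<and> snd C < snd E \<and> snd E < snd D}"
        using normal_condition[OF d C(1) _ s(2,1)] D le[of "u + (int s + 1)"] eq by simp
    qed
    moreover have "snd A \<le> snd C" if "normal_box d \<nu> C" using A CA that unfolding good_box_def by blast
    ultimately show False by simp
  qed
  show ?thesis
    unfolding last_argmax_def P_def[symmetric]
  proof (intro conjI allI impI)
    show "P t < P 0" if "0 < t" for t using above[OF that] P0 by simp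
    show "P t \<le> P 0" if "t \<le> 0" for t using below[of t] that by (cases "t = 0") auto
  qed
qed

end

lemma beads_inject:
  assumes "is_partition \<nu>" "is_partition \<mu>" "beads \<nu> = beads \<mu>"
  shows "\<nu> = \<mu>"
proof (rule row_inject[OF assms(1,2)])
  have "slot \<nu> = slot \<mu>"
  proof (rule strict_decreasing_range_eq[of "slot \<nu>" "slot \<mu>"])
    show "slot \<nu> j < slot \<nu> i" if "i < j" for i j using slot_strict[OF assms(1) that] .
    show "slot \<mu> j < slot \<mu> i" if "i < j" for i j using slot_strict[OF assms(2) that] .
    show "range (slot \<nu>) = range (slot \<mu>)" using assms(3) by (simp add: beads_def)
  qed
  then show "row \<nu> = row \<mu>" by (auto simp: slot_def fun_eq_iff)
qed

lemma beads_remove: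
  assumes \<nu>: "is_partition \<nu>" and \<mu>: "is_partition \<mu>" and A: "removable \<nu> A"
    and eq: "young_diagram \<mu> = young_diagram \<nu> - {A}"
  shows "beads \<mu> = lower_at (content A) (beads \<nu>)"
proof -
  obtain j where j: "A = (slot \<nu> j + int j, - int j - 1)" "content A = slot \<nu> j - 1"
    using removable_content[OF \<nu> A] by blast
  have Aj: "A = (int (row \<nu> j), - int j - 1)" using j(1) by (simp add: slot_def)
  have pos: "1 \<le> row \<nu> j"
    using A unfolding removable_def Aj mem_young_diagram_row by simp
  have "row \<mu> i = (if i = j then row \<nu> j - 1 else row \<nu> i)" for i
  proof -
    have mem: "1 \<le> x \<and> x \<le> int (row \<mu> i) \<longleftrightarrow> 1 \<le> x \<and> x \<le> int (row \<nu> i) \<and> \<not> (i = j \<and> x = int (row \<nu> j))" for x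
      using mem_young_diagram_row[of x i \<mu>] mem_young_diagram_row[of x i \<nu>] unfolding eq Aj by auto
    show ?thesis
    proof (cases "i = j")
      case True
      then show ?thesis
        using mem[of "int (row \<mu> j)"] mem[of "int (row \<nu> j) - 1"] pos by simp linarith
    next
      case False
      then show ?thesis using mem[of "int (row \<mu> i)"] mem[of "int (row \<nu> i)"] by simp linarith
    qed
  qed
  then have slot: "slot \<mu> i = (if i = j then slot \<nu> j - 1 else slot \<nu> i)" for i
    using pos by (simp add: slot_def)
  have "c \<in> beads \<mu> \<longleftrightarrow> c = slot \<nu> j - 1 \<or> (c \<in> beads \<nu> \<and> c \<noteq> slot \<nu> j)" for c
  proof -
    have "c \<in> beads \<mu> \<longleftrightarrow> (\<exists>i. c = slot \<mu> i)" by (auto simp: beads_def)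
    also have "\<dots> \<longleftrightarrow> c = slot \<nu> j - 1 \<or> (\<exists>i. i \<noteq> j \<and> c = slot \<nu> i)" by (auto simp: slot)
    also have "\<dots> \<longleftrightarrow> c = slot \<nu> j - 1 \<or> (c \<in> beads \<nu> \<and> c \<noteq> slot \<nu> j)"
      by (auto simp: beads_def slot_eq_iff[OF \<nu>])
    finally show ?thesis .
  qed
  then show ?thesis using j(2) by (auto simp: lower_at_def)
qed

lemma lowers_good_box:
  assumes d: "2 \<le> d" and \<nu>: "is_partition \<nu>" and \<mu>: "is_partition \<mu>" and A: "good_box d \<nu> A"
    and eq: "young_diagram \<mu> = young_diagram \<nu> - {A}"
  shows "lowers (int d) (residue d A) (beads \<nu>) (beads \<mu>)"
proof -
  have "removable \<nu> A" using A by (simp add: good_box_def normal_box_def)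
  then have "good_move (int d) (beads \<nu>) (content A) (beads \<mu>)"
    using good_box_last_argmax[OF \<nu> d A] beads_remove[OF \<nu> \<mu> _ eq] finite_corners_beads[OF \<nu>]
    by (simp add: good_move_def)
  moreover have "int d dvd content A - residue d A"
    by (simp add: residue_def content_def)
  ultimately show ?thesis unfolding lowers_def by blast
qed

lemma is_partition_good_path: "good_path d rs \<nu> \<Longrightarrow> is_partition \<nu>"
  by (induction rule: good_path.induct) (auto simp: is_partition_def)

lemma length_good_path: "good_path d rs \<nu> \<Longrightarrow> length rs = card (young_diagram \<nu>)"
proof (induction rule: good_path.induct)
  case empty
  then show ?case by (simp add: young_diagram_def)
next
  case (step rs \<mu> \<nu> A)
  then have "A \<in> young_diagram \<nu>" by (simp add: good_box_def normal_box_def removable_def)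
  then have "card (young_diagram \<nu>) = Suc (card (young_diagram \<mu>))"
    using step.hyps(4) finite_young_diagram[of \<nu>] by (metis card.remove)
  then show ?case using step by simp
qed

lemma twin_good_paths:
  assumes d: "2 \<le> d"
  shows "good_path d rs \<nu> \<Longrightarrow> good_path d (map (\<lambda>r. (- r) mod int d) rs) \<mu> \<Longrightarrow>
    twin (int d) (length rs) (beads \<nu>) (beads \<mu>)"
proof (induction rs arbitrary: \<nu> \<mu> rule: rev_induct)
  case Nil
  then have "\<nu> = []" "\<mu> = []" by (auto elim: good_path.cases)
  then show ?case by (simp add: beads_Nil twin_vacuum)
next
  case (snoc r rs)
  from snoc.prems(1) obtain \<nu>' A where 1: "good_path d rs \<nu>'" "is_partition \<nu>" "good_box d \<nu> A"
    "young_diagram \<nu>' = young_diagram \<nu> - {A}" "r = residue d A"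
    by (cases rule: good_path.cases) auto
  from snoc.prems(2) obtain \<mu>' A' where 2: "good_path d (map (\<lambda>r. (- r) mod int d) rs) \<mu>'" "is_partition \<mu>"
    "good_box d \<mu> A'" "young_diagram \<mu>' = young_diagram \<mu> - {A'}" "(- r) mod int d = residue d A'"
    by (cases rule: good_path.cases) auto
  have "lowers (int d) r (beads \<nu>) (beads \<nu>')"
    using lowers_good_box[OF d 1(2) is_partition_good_path[OF 1(1)] 1(3,4)] 1(5) by simp
  moreover have "lowers (int d) (- r) (beads \<mu>) (beads \<mu>')"
  proof -
    have "residue d A' mod int d = (- r) mod int d" unfolding 2(5)[symmetric] by simp
    then have "int d dvd residue d A' - (- r)" by (simp only: mod_eq_dvd_iff)
    then show ?thesis
      using lowers_good_box[OF d 2(2) is_partition_good_path[OF 2(1)] 2(3,4)] lowers_cong by metis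
  qed
  ultimately show ?case using twin_Suc snoc.IH[OF 1(1) 2(1)] by simp
qed

text \<open>The length of a path is the number of boxes, which puts competing paths on the same
  level of \<open>twin\<close>.\<close>

lemma mullineux_eqI:
  assumes d: "2 \<le> d" and \<nu>: "d_regular d \<nu>"
    and paths: "good_path d rs \<nu>" "good_path d (map (\<lambda>r. (- r) mod int d) rs) \<mu>"
  shows "mullineux d \<nu> = \<mu>"
proof -
  have "\<mu>' = \<mu>" if "\<exists>rs. good_path d rs \<nu> \<and> good_path d (map (\<lambda>r. (- r) mod int d) rs) \<mu>'" for \<mu>'
  proof -
    from that obtain rs' where rs': "good_path d rs' \<nu>" "good_path d (map (\<lambda>r. (- r) mod int d) rs') \<mu>'" by blast
    have "length rs' = length rs" using length_good_path paths(1) rs'(1) by metis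
    then have "beads \<mu>' = beads \<mu>"
      using twin_unique[of "int d"] twin_good_paths[OF d paths] twin_good_paths[OF d rs'] d by force
    then show ?thesis using beads_inject is_partition_good_path paths(2) rs'(2) by blast
  qed
  then have "(THE \<mu>. \<exists>rs. good_path d rs \<nu> \<and> good_path d (map (\<lambda>r. (- r) mod int d) rs) \<mu>) = \<mu>"
    using paths by (intro the_equality) blast+
  then show ?thesis using \<nu> is_partition_good_path[OF paths(1)] by (simp add: mullineux_def)
qed

section \<open>Wall-crossing\<close>

lemma down_closed_nat:
  fixes A :: "nat set"
  assumes "finite A" "\<And>i j. j \<in> A \<Longrightarrow> i \<le> j \<Longrightarrow> i \<in> A"
  shows "j < card A \<longleftrightarrow> j \<in> A"
proof -
  obtain m where m: "m \<notin> A" using assms(1) ex_new_if_finite infinite_UNIV_nat by blast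
  define l where "l = (LEAST m. m \<notin> A)"
  have l: "l \<notin> A" "\<And>i. i < l \<Longrightarrow> i \<in> A"
    unfolding l_def using LeastI[of "\<lambda>m. m \<notin> A", OF m] not_less_Least by blast+
  have "i < l" if "i \<in> A" for i
    using assms(2)[OF that, of l] l(1) by (meson not_less)
  then have A: "A = {..<l}" using l(2) by blast
  show ?thesis by (simp add: A)
qed

lemma less_row_conjugate:
  assumes \<nu>: "is_partition \<nu>"
  shows "j < row (conjugate \<nu>) i \<longleftrightarrow> i < row \<nu> j"
proof (cases \<nu>)
  case Nil
  then show ?thesis by (simp add: conjugate_def row_def)
next
  case (Cons p qs)
  have row0: "row \<nu> j \<le> p" using row_antimono[OF \<nu>, of 0 j] by (simp add: row_def Cons)
  define L where "L = length (filter (\<lambda>q. i < q) \<nu>)"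
  have "L = card {j. j < length \<nu> \<and> i < \<nu> ! j}" by (simp add: L_def length_filter_conv_card)
  also have "{j. j < length \<nu> \<and> i < \<nu> ! j} = {j. i < row \<nu> j}" by (auto simp: row_def)
  finally have L: "L = card {j. i < row \<nu> j}" .
  have "finite {j. i < row \<nu> j}"
    by (rule finite_subset[of _ "{..<length \<nu>}"]) (auto simp: row_def split: if_splits)
  then have "j < L \<longleftrightarrow> j \<in> {j. i < row \<nu> j}"
    unfolding L using row_antimono[OF \<nu>] by (intro down_closed_nat) (auto intro: less_le_trans)
  then have L': "j < L \<longleftrightarrow> i < row \<nu> j" by simp
  have "row (conjugate \<nu>) i = (if i < p then L else 0)"
    by (simp add: conjugate_def Cons row_def L_def)
  then show ?thesis using L' row0 by auto
qed

lemma is_partition_conjugate: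
  assumes \<nu>: "is_partition \<nu>"
  shows "is_partition (conjugate \<nu>)"
proof -
  have entry: "conjugate \<nu> ! i = row (conjugate \<nu>) i" if "i < length (conjugate \<nu>)" for i
    using that by (simp add: row_def)
  have "row (conjugate \<nu>) j \<le> row (conjugate \<nu>) i" if "i < j" for i j
  proof (rule ccontr)
    assume "\<not> row (conjugate \<nu>) j \<le> row (conjugate \<nu>) i"
    then have "row (conjugate \<nu>) i < row (conjugate \<nu>) j" by simp
    then have "j < row \<nu> (row (conjugate \<nu>) i)" using less_row_conjugate[OF \<nu>] by simp
    then have "row (conjugate \<nu>) i < row (conjugate \<nu>) i"
      using less_row_conjugate[OF \<nu>, of "row (conjugate \<nu>) i" i] that by simp
    then show False by simp
  qed
  then have "sorted_wrt (\<ge>) (conjugate \<nu>)" by (simp add: sorted_wrt_iff_nth_less entry)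
  moreover have "0 < conjugate \<nu> ! i" if "i < length (conjugate \<nu>)" for i
  proof (cases \<nu>)
    case (Cons p qs)
    then have "i < row \<nu> 0" using that by (simp add: conjugate_def row_def)
    then show ?thesis using less_row_conjugate[OF \<nu>, of 0 i] entry[OF that] by simp
  qed (use that in \<open>simp add: conjugate_def\<close>)
  ultimately show ?thesis
    unfolding is_partition_def by (metis in_set_conv_nth less_irrefl)
qed

lemma young_diagram_conjugate:
  assumes \<nu>: "is_partition \<nu>"
  shows "young_diagram (conjugate \<nu>) = flip ` young_diagram \<nu>"
proof -
  have "(x, y) \<in> young_diagram (conjugate \<nu>) \<longleftrightarrow> flip (x, y) \<in> young_diagram \<nu>" for x y
  proof (cases "1 \<le> x \<and> y \<le> -1")
    case True
    have "x \<le> int (row (conjugate \<nu>) (nat (- y - 1))) \<longleftrightarrow> nat (x - 1) < row (conjugate \<nu>) (nat (- y - 1))"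
      using True by linarith
    also have "\<dots> \<longleftrightarrow> nat (- y - 1) < row \<nu> (nat (x - 1))" by (rule less_row_conjugate[OF \<nu>])
    also have "\<dots> \<longleftrightarrow> - y \<le> int (row \<nu> (nat (x - 1)))" using True by linarith
    finally show ?thesis using True by (simp add: mem_young_diagram flip_def)
  qed (auto simp: mem_young_diagram flip_def)
  then show ?thesis unfolding set_eq_iff mem_flip_image by auto
qed

section \<open>Crossing a wall: from slopes just below it to slopes just above it\<close>

lemma box_paths:
  assumes ab: "0 < a" "a < b" and cop: "coprime a b"
  shows "is_partition \<nu> \<Longrightarrow> is_partition \<mu> \<Longrightarrow> initial a b (young_diagram \<nu>) \<Longrightarrow>
    initial (b - a) b (young_diagram \<mu>) \<Longrightarrow> card (young_diagram \<nu>) = n \<Longrightarrow> card (young_diagram \<mu>) = n \<Longrightarrow>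
    \<exists>rs. good_path (nat b) rs \<nu> \<and> good_path (nat b) (map (\<lambda>r. (- r) mod int (nat b)) rs) \<mu>"
proof (induction n arbitrary: \<nu> \<mu>)
  case 0
  have Nil: "is_partition []" "young_diagram [] = {}" by (auto simp: is_partition_def young_diagram_def)
  have "\<nu> = []" "\<mu> = []"
    using 0 finite_young_diagram young_diagram_inject[OF _ Nil(1)] Nil(2) by auto
  then show ?case using good_path.empty[of "nat b"] by (intro exI[of _ "[]"]) simp
next
  case (Suc n)
  have ab': "0 < b - a" "b - a < b" "0 < b" using ab by auto
  have cop': "coprime (b - a) b"
    using cop by (metis coprime_commute coprime_diff_one_left coprime_iff_gcd_eq_1 gcd_diff1 gcd.commute gcd_diff2)
  have ne: "young_diagram \<nu> \<noteq> {}" "young_diagram \<mu> \<noteq> {}" using Suc.prems by auto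
  obtain A where A: "A \<in> young_diagram \<nu>" "\<And>B. B \<in> young_diagram \<nu> \<Longrightarrow> B \<noteq> A \<Longrightarrow> before a b B A"
    using last_box[OF finite_young_diagram ne(1) ab'(3)] by blast
  obtain A' where A': "A' \<in> young_diagram \<mu>" "\<And>B. B \<in> young_diagram \<mu> \<Longrightarrow> B \<noteq> A' \<Longrightarrow> before (b - a) b B A'"
    using last_box[OF finite_young_diagram ne(2) ab'(3)] by blast
  have init: "initial a b (young_diagram \<nu> - {A})" "initial (b - a) b (young_diagram \<mu> - {A'})"
    using initial_remove_last[OF ab Suc.prems(3) A] initial_remove_last[OF ab'(1,2) Suc.prems(4) A'] by blast+
  obtain \<nu>' where \<nu>': "is_partition \<nu>'" "young_diagram \<nu>' = young_diagram \<nu> - {A}"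
    using partition_of_diagram[OF _ down_closed_initial[OF ab init(1)]] finite_young_diagram by blast
  obtain \<mu>' where \<mu>': "is_partition \<mu>'" "young_diagram \<mu>' = young_diagram \<mu> - {A'}"
    using partition_of_diagram[OF _ down_closed_initial[OF ab'(1,2) init(2)]] finite_young_diagram by blast
  have cards: "card (young_diagram \<nu>') = n" "card (young_diagram \<mu>') = n"
    using Suc.prems(5,6) A(1) A'(1) finite_young_diagram \<nu>'(2) \<mu>'(2) by simp_all
  obtain rs where rs: "good_path (nat b) rs \<nu>'" "good_path (nat b) (map (\<lambda>r. (- r) mod int (nat b)) rs) \<mu>'"
    using Suc.IH[OF \<nu>'(1) \<mu>'(1)] init \<nu>'(2) \<mu>'(2) cards by auto
  have good: "good_box (nat b) \<nu> A" "good_box (nat b) \<mu> A'"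
    using good_last_box[OF ab cop Suc.prems(1,3) A] good_last_box[OF ab'(1,2) cop' Suc.prems(2,4) A'] by blast+
  have "weight a b A = weight a b (flip A')"
  proof (rule max_weight_eq[OF Suc.prems(3) A(1)])
    show "weight a b B \<le> weight a b A" if "B \<in> young_diagram \<nu>" for B
      using A(2)[OF that] by (cases "B = A") (auto simp: before_def)
    show "finite (flip ` young_diagram \<mu>)" "flip A' \<in> flip ` young_diagram \<mu>"
      using finite_young_diagram A' by auto
    show "flip ` young_diagram \<mu> \<subseteq> boxes" using Suc.prems(4) by (auto simp: initial_def)
    show "weight a b B \<le> weight a b (flip A')" if "B \<in> flip ` young_diagram \<mu>" for B
    proof -
      have "flip B \<in> young_diagram \<mu>" using that by (simp add: mem_flip_image)
      then have "weight (b - a) b (flip B) \<le> weight (b - a) b A'"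
        using A'(2)[of "flip B"] by (cases "flip B = A'") (auto simp: before_def)
      then show ?thesis using weight_flip[of b a B] weight_flip[of b a "flip A'"] by simp
    qed
    show "weight a b B \<le> weight a b C" if "B \<in> flip ` young_diagram \<mu>" "C \<in> boxes - flip ` young_diagram \<mu>" for B C
    proof -
      have "flip B \<in> young_diagram \<mu>" "flip C \<notin> young_diagram \<mu>" "flip C \<in> boxes"
        using that by (auto simp: mem_flip_image)
      then have "weight (b - a) b (flip B) \<le> weight (b - a) b (flip C)"
        using initial_weight_le[OF Suc.prems(4)] by blast
      then show ?thesis by (simp only: weight_flip)
    qed
    show "card (young_diagram \<nu>) = card (flip ` young_diagram \<mu>)"
      using Suc.prems(5,6) by (simp add: card_image inj_on_subset[OF inj_flip])
  qed
  \<comment> \<open>Transposition negates contents, so equal weights make \<open>a\<close> times the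
    sum of the contents a multiple of \<open>b\<close>; coprimality then gives opposite
    residues.\<close>
  then have "a * (content A + content A') = b * (snd A + fst A')"
    by (simp add: weight_content content_flip algebra_simps) (simp add: flip_def)
  then have "b dvd a * (content A + content A')" by (metis dvd_triv_left)
  then have "b dvd content A + content A'"
    using cop by (metis coprime_commute coprime_dvd_mult_right_iff)
  then have "b dvd content A' - (- content A)" by (simp add: add.commute)
  then have res: "residue (nat b) A' = (- residue (nat b) A) mod int (nat b)"
    using ab by (simp add: residue_def content_def mod_eq_dvd_iff[symmetric] mod_minus_eq)
  have "good_path (nat b) (rs @ [residue (nat b) A]) \<nu>"
    by (rule good_path.step[OF rs(1) Suc.prems(1) good(1) \<nu>'(2)])
  moreover have "good_path (nat b) (map (\<lambda>r. (- r) mod int (nat b)) rs @ [residue (nat b) A']) \<mu>"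
    by (rule good_path.step[OF rs(2) Suc.prems(2) good(2) \<mu>'(2)])
  ultimately show ?case
    by (intro exI[of _ "rs @ [residue (nat b) A]"]) (simp add: res)
qed

text \<open>The image under \<open>mullineux\<close> is not computed: it is recognised as the first
  boxes for \<open>b - a\<close>, and its transpose is initial for slopes just above
  \<open>a / b\<close>.\<close>

lemma wall_crossing_initial:
  assumes ab: "0 < a" "a < b" and cop: "coprime a b" and \<nu>: "is_partition \<nu>"
    and init: "initial a b (young_diagram \<nu>)"
  shows "is_partition (wall_crossing (nat b) \<nu>)"
    and "initial (b - a) b (flip ` young_diagram (wall_crossing (nat b) \<nu>))"
    and "card (young_diagram (wall_crossing (nat b) \<nu>)) = card (young_diagram \<nu>)"
proof -
  have ab': "0 < b - a" "b - a < b" using ab by auto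
  obtain S where S: "initial (b - a) b S" "card S = card (young_diagram \<nu>)"
    using ex_initial[OF ab'] by blast
  have "finite S" using S by (simp add: initial_def)
  then obtain \<mu> where \<mu>: "is_partition \<mu>" "young_diagram \<mu> = S"
    using partition_of_diagram down_closed_initial[OF ab' S(1)] by blast
  then obtain rs where rs: "good_path (nat b) rs \<nu>" "good_path (nat b) (map (\<lambda>r. (- r) mod int (nat b)) rs) \<mu>"
    using box_paths[OF ab cop \<nu> \<mu>(1) init] S by auto
  have "mullineux (nat b) \<nu> = \<mu>"
    using mullineux_eqI[OF _ d_regular_initial[OF ab \<nu> init] rs] ab by simp
  then have w: "wall_crossing (nat b) \<nu> = conjugate \<mu>" by (simp add: wall_crossing_def)
  show "is_partition (wall_crossing (nat b) \<nu>)" unfolding w by (rule is_partition_conjugate[OF \<mu>(1)])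
  show "initial (b - a) b (flip ` young_diagram (wall_crossing (nat b) \<nu>))"
    using S(1) by (simp add: w young_diagram_conjugate[OF \<mu>(1)] \<mu>(2))
  show "card (young_diagram (wall_crossing (nat b) \<nu>)) = card (young_diagram \<nu>)"
    using S(2) by (simp add: w young_diagram_conjugate[OF \<mu>(1)] \<mu>(2) card_image inj_on_subset[OF inj_flip])
qed

section \<open>From one Farey fraction to the next\<close>

lemma hook_card:
  assumes "finite S" "\<And>y. y2 < y \<Longrightarrow> y \<le> y1 \<Longrightarrow> (x1, y) \<in> S" "\<And>x. x1 < x \<Longrightarrow> x \<le> x2 \<Longrightarrow> (x, y1) \<in> S"
    and "x1 \<le> x2" "y2 \<le> (y1::int)"
  shows "(x2 - x1) + (y1 - y2) \<le> int (card (S :: box set))"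
proof -
  let ?V = "{x1} \<times> {y2<..y1}" and ?H = "{x1<..x2} \<times> {y1}"
  have "card (?V \<union> ?H) = card ?V + card ?H" by (rule card_Un_disjoint) auto
  also have "\<dots> = nat (y1 - y2) + nat (x2 - x1)" by (simp add: card_cartesian_product)
  finally have "int (card (?V \<union> ?H)) = (x2 - x1) + (y1 - y2)" using assms(4,5) by simp
  moreover have "card (?V \<union> ?H) \<le> card S" using assms(2,3) by (intro card_mono[OF assms(1)]) auto
  ultimately show ?thesis by linarith
qed

text \<open>If the order of \<open>B \<in> S\<close> and \<open>C \<notin> S\<close> changed between the two slopes, then the slope at which
  their weights agree would have as denominator the length of a hook inside \<open>S\<close>.\<close>

lemma initial_next_slope:
  assumes ab: "0 \<le> a" "a < b" "0 < a'" "a' < b'" "a * b' < a' * b"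
    and S: "finite S" "down_closed S" "card S = n"
    and after: "\<And>B C. B \<in> S \<Longrightarrow> C \<in> boxes \<Longrightarrow> C \<notin> S \<Longrightarrow>
      weight a b B < weight a b C \<or> weight a b B = weight a b C \<and> content B < content C"
    and gap: "\<And>e f. 0 < f \<Longrightarrow> f \<le> int n \<Longrightarrow> a * f < e * b \<Longrightarrow> e * b' < a' * f \<Longrightarrow> False"
  shows "initial a' b' S"
  unfolding initial_def
proof (intro conjI ballI)
  show "S \<subseteq> boxes" using S(2) by (simp add: down_closed_def)
  show "finite S" by (rule S)
  fix B C assume B: "B \<in> S" and C: "C \<in> boxes - S"
  obtain x y where xy: "B = (x, y)" by fastforce
  obtain x' y' where xy': "C = (x', y')" by fastforce
  have b0: "0 < b" "0 < b'" using ab by auto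
  note dcS = down_closedD[OF S(2)]
  \<comment> \<open>Divided by \<open>q\<close>, the difference of weights is affine in the slope
    \<open>p / q\<close>, and its coefficient is the difference of contents.\<close>
  have diff: "weight p q (u, v) - weight p q (x, y) = p * ((u + v) - (x + y)) + q * (y - v)" for p q u v
    by (simp add: weight_def algebra_simps)
  show "before a' b' B C"
  proof (rule ccontr)
    assume n: "\<not> before a' b' B C"
    define \<Delta> where "\<Delta> = (x' + y') - (x + y)"
    define \<eta> where "\<eta> = y - y'"
    have w: "0 < a * \<Delta> + b * \<eta> \<or> a * \<Delta> + b * \<eta> = 0 \<and> 0 < \<Delta>"
      using after[OF B, of C] C diff[of a b x' y'] unfolding xy xy' \<Delta>_def \<eta>_def content_def by auto
    have w': "a' * \<Delta> + b' * \<eta> < 0 \<or> a' * \<Delta> + b' * \<eta> = 0 \<and> 0 \<le> \<Delta>"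
      using n diff[of a' b' x' y'] unfolding xy xy' \<Delta>_def \<eta>_def content_def before_def by auto
    have id: "b * (a' * \<Delta> + b' * \<eta>) = b' * (a * \<Delta> + b * \<eta>) + (a' * b - a * b') * \<Delta>"
      by (simp add: algebra_simps)
    \<comment> \<open>The difference falls from positive to negative, up to the tie rules, while the
      slope grows; so its coefficient is negative.\<close>
    have neg: "\<Delta> < 0"
    proof (rule ccontr)
      assume "\<not> \<Delta> < 0"
      then have "0 \<le> \<Delta>" by simp
      have le: "b * (a' * \<Delta> + b' * \<eta>) \<le> 0" using w' b0 by (auto simp: mult_le_0_iff)
      have "0 \<le> (a' * b - a * b') * \<Delta>" using \<open>0 \<le> \<Delta>\<close> ab(5) by simp
      moreover have "0 \<le> b' * (a * \<Delta> + b * \<eta>)" using w b0 by (auto intro: mult_nonneg_nonneg)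
      ultimately have "b' * (a * \<Delta> + b * \<eta>) = 0" "(a' * b - a * b') * \<Delta> = 0" using id le by linarith+
      then show False using w b0 ab(5) by auto
    qed
    have x'x: "x' < x"
    proof -
      have "a' * \<Delta> + b' * \<eta> < 0" using w' neg by auto
      moreover have "(b' - a') * \<Delta> < 0" using neg ab by (simp add: mult_less_0_iff)
      ultimately have "b' * (\<Delta> + \<eta>) < 0" by (simp add: algebra_simps)
      then have "\<Delta> + \<eta> < 0" using b0 by (simp add: mult_less_0_iff)
      then show ?thesis by (simp add: \<Delta>_def \<eta>_def)
    qed
    have "0 \<le> - (a * \<Delta>)" using neg ab by (simp add: mult_nonneg_nonpos)
    then have "0 < b * \<eta>" using w neg by linarith
    then have y'y: "y' < y" using b0 by (simp add: \<eta>_def zero_less_mult_iff)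
    have "(x', y') \<in> boxes" "(x', y') \<notin> S" using C xy' by auto
    \<comment> \<open>\<open>C\<close> is replaced by the first box outside \<open>S\<close> met
      when going down its column from row \<open>y\<close>. It is no heavier than \<open>C\<close>
      at the new slope, and the hook leading to it from \<open>B\<close> lies inside
      \<open>S\<close>.\<close>
    then obtain y2 where y2: "(x', y2) \<notin> S" "y' \<le> y2" "y2 \<le> y" "\<forall>l. y2 < l \<and> l \<le> y \<longrightarrow> (x', l) \<in> S"
      using last_below[of "\<lambda>l. (x', l) \<notin> S" y' y] y'y by (metis less_imp_le)
    have xS: "(u, y) \<in> S" if "x' \<le> u" "u \<le> x" for u
      using dcS(3)[of x y u y] dcS(2)[of x y] B that \<open>(x', y') \<in> boxes\<close> xy by simp
    then have "y2 < y" using y2(1,3) x'x by (metis less_imp_le le_less order_refl)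
    have yneg: "y \<le> -1" using dcS(2)[of x y] B xy by simp
    \<comment> \<open>\<open>e / f\<close> is the slope at which \<open>B\<close> and
      \<open>(x', y2)\<close> have equal weight, and \<open>f\<close> is the number of boxes in the
      hook.\<close>
    define e where "e = y - y2"
    define f where "f = (x - x') + (y - y2)"
    have "(x', y2) \<in> boxes" using \<open>(x', y') \<in> boxes\<close> y2(3) yneg by simp
    then have "0 < a * (- f) + b * e \<or> a * (- f) + b * e = 0 \<and> 0 < - f"
      using after[OF B, of "(x', y2)"] y2(1) diff[of a b x' y2]
      unfolding xy e_def f_def content_def by (auto simp: algebra_simps)
    moreover have "0 < f" using x'x \<open>y2 < y\<close> by (simp add: f_def)
    ultimately have 1: "a * f < e * b" by (auto simp: algebra_simps)
    have "a' * (x' - x) + (b' - a') * (y - y') < 0"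
    proof -
      have "a' * (x' - x) + (b' - a') * (y - y') = a' * \<Delta> + b' * \<eta>"
        by (simp add: \<Delta>_def \<eta>_def algebra_simps)
      then show ?thesis using w' neg by auto
    qed
    moreover have "(b' - a') * (y - y2) \<le> (b' - a') * (y - y')" using ab y2 by (intro mult_left_mono) auto
    ultimately have "a' * (x' - x) + (b' - a') * (y - y2) < 0" by linarith
    then have 2: "e * b' < a' * f" by (simp add: e_def f_def algebra_simps)
    have "f \<le> int n"
      using hook_card[OF S(1), of y2 y x' x] y2(4) xS x'x \<open>y2 < y\<close> S(3) unfolding f_def by auto
    then show False using gap[OF \<open>0 < f\<close> _ 1 2] by blast
  qed
qed

lemma denominator_le:
  assumes "0 < f" "q = of_int e / of_int f"
  shows "int (denominator q) \<le> f"
proof -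
  obtain p r where pr: "quotient_of q = (p, r)" by fastforce
  have r: "0 < r" "coprime p r" using quotient_of_denom_pos[OF pr] quotient_of_coprime[OF pr] by auto
  have "of_int p / of_int r = (of_int e / of_int f :: rat)" using quotient_of_div[OF pr] assms(2) by simp
  then have "of_int (p * f) = (of_int (e * r) :: rat)" using r assms(1) by (simp add: frac_eq_eq)
  then have "p * f = e * r" by (simp only: of_int_eq_iff)
  then have "r dvd p * f" by simp
  then have "r dvd f" using r(2) by (metis coprime_commute coprime_dvd_mult_right_iff)
  then show ?thesis using assms(1) r(1) zdvd_imp_le by (simp add: denominator_def pr)
qed

lemma quotient_of_coprime_fraction:
  assumes "0 < b" "coprime a b"
  shows "quotient_of (of_int a / of_int b) = (a, b)"
  using assms by (metis Fract_of_int_quotient normalize_stable quotient_of_Fract)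

lemma less_fraction_iff:
  "0 < b \<Longrightarrow> 0 < d \<Longrightarrow> (of_int a / of_int b :: rat) < of_int c / of_int d \<longleftrightarrow> a * d < c * b"
proof -
  assume "0 < b" "0 < d"
  then have "(of_int a / of_int b :: rat) < of_int c / of_int d \<longleftrightarrow> (of_int (a * d) :: rat) < of_int (c * b)"
    by (simp add: divide_simps mult.commute)
  then show ?thesis by (simp only: of_int_less_iff)
qed

text \<open>Among boxes of equal weight larger content means larger \<open>y\<close>, so
  \<open>box_greater\<close> breaks ties as slopes just above \<open>a / b\<close> do.\<close>

lemma is_n_smallest_boxes_flip:
  assumes ab: "0 < a" "0 < b" and S: "initial (b - a) b (flip ` S)" "card S = n"
  shows "is_n_smallest_boxes a b n S"
proof -
  have "finite (flip ` S)" "flip ` S \<subseteq> boxes" using S(1) by (auto simp: initial_def)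
  then have fin: "finite S" "S \<subseteq> boxes"
    using finite_imageD[of flip S] inj_on_subset[OF inj_flip] by auto
  have "box_greater a b C B" if "B \<in> S" "C \<in> boxes - S" for B C
  proof -
    have "flip B \<in> flip ` S" "flip C \<in> boxes" "flip C \<notin> flip ` S"
      using that by (auto simp: mem_flip_image)
    then have "before (b - a) b (flip B) (flip C)" by (rule initial_before[OF S(1)])
    then consider "weight a b B < weight a b C" | "weight a b B = weight a b C" "content B < content C"
      by (auto simp: before_def weight_flip content_flip)
    then show ?thesis
    proof cases
      case 1
      then show ?thesis by (auto simp: box_greater_def weight_def split_beta)
    next
      case 2
      then have "a * content B < a * content C" using ab by simp
      then have "b * snd B < b * snd C" using 2 by (simp add: weight_content)
      then have "snd B < snd C" using ab by simp
      then show ?thesis using 2(1) by (auto simp: box_greater_def weight_def split_beta)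
    qed
  qed
  then show ?thesis using fin S(2) by (simp add: is_n_smallest_boxes_def)
qed

text \<open>Slope \<open>0 / 1\<close> serves as the Farey fraction before the first wall: just
  above it the boxes are filled along the first row.\<close>

lemma initial_wall:
  assumes n: "2 \<le> n" and ab: "0 < a" "a < b"
    and gap: "\<forall>e f. 0 < f \<and> f \<le> int n \<and> 0 < e \<longrightarrow> \<not> e * b < a * f"
  shows "is_partition [n]" "card (young_diagram [n]) = n" "initial a b (young_diagram [n])"
proof -
  have D: "young_diagram [n] = (\<lambda>x. (x, -1)) ` {1..int n}"
    by (auto simp: mem_young_diagram row_def split: if_splits)
  show p: "is_partition [n]" using n by (simp add: is_partition_def)
  show c: "card (young_diagram [n]) = n" by (simp add: D card_image inj_on_def)
  show "initial a b (young_diagram [n])"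
  proof (rule initial_next_slope[of 0 1, OF _ _ ab _ finite_young_diagram down_closed_young_diagram[OF p] c])
    fix B C assume "B \<in> young_diagram [n]" "C \<in> boxes" "C \<notin> young_diagram [n]"
    then obtain x p q where "B = (x, -1)" "x \<le> int n" "C = (p, q)" "1 \<le> p" "q \<le> -1" "q = -1 \<longrightarrow> int n < p"
      unfolding D by (cases C) (auto simp: image_iff)
    then show "weight 0 1 B < weight 0 1 C \<or> weight 0 1 B = weight 0 1 C \<and> content B < content C"
      by (auto simp: weight_def content_def)
  qed (use ab gap in auto)
qed

section \<open>Induction along the walls\<close>

theorem mainTheorem2:
  fixes n k :: nat and a b :: int and w :: "nat \<Rightarrow> rat" and lam :: "nat \<Rightarrow> nat list"
  assumes "2 \<le> n"
    and "0 < b" and "coprime a b"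
    and "of_int a / of_int b \<in> farey n"
    and "0 < (of_int a / of_int b :: rat)" and "(of_int a / of_int b :: rat) < 1"
    and "strict_mono_on {1..k} w"
    and "w ` {1..k} = {q \<in> farey n. 0 < q \<and> q \<le> of_int a / of_int b}"
    and "w k = of_int a / of_int b"
    and "lam 0 = [n]"
    and "\<And>i. i \<in> {1..k} \<Longrightarrow> lam i = wall_crossing (denominator (w i)) (lam (i - 1))"
  shows "is_n_smallest_boxes a b n (young_diagram (lam k))"
proof -
  define num where "num i = fst (quotient_of (w i))" for i
  define den where "den i = snd (quotient_of (w i))" for i
  have den_pos: "0 < den i" and cop: "coprime (num i) (den i)" and w: "w i = of_int (num i) / of_int (den i)" for i
    using quotient_of_denom_pos quotient_of_coprime quotient_of_div unfolding num_def den_def by (metis prod.collapse)+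
  have denom: "denominator (w i) = nat (den i)" for i by (simp add: denominator_def den_def)
  have range: "0 < w i" "w i < 1" if "i \<in> {1..k}" for i
  proof -
    have "w i \<in> {q \<in> farey n. 0 < q \<and> q \<le> of_int a / of_int b}" using that assms(8) by blast
    then show "0 < w i" "w i < 1" using assms(6) by auto
  qed
  have num: "0 < num i" "num i < den i" if "i \<in> {1..k}" for i
    using range[OF that] den_pos[of i] unfolding w[of i] by (simp_all add: zero_less_divide_iff)
  have k: "1 \<le> k"
  proof -
    have "of_int a / of_int b \<in> w ` {1..k}" using assms(4,5,8) by simp
    then show ?thesis by auto
  qed
  \<comment> \<open>A positive fraction below a wall with denominator at most \<open>n\<close> is
    itself a wall, as reducing it can only shrink the denominator.\<close>
  have found: "\<exists>j\<in>{1..k}. w j = of_int e / of_int f"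
    if "0 < f" "f \<le> int n" "0 < e" "of_int e / of_int f < w i" "i \<in> {1..k}" for e f i
  proof -
    let ?q = "of_int e / of_int f :: rat"
    have "int (denominator ?q) \<le> int n" using denominator_le[OF that(1) refl, of e] that(2) by linarith
    moreover have "0 < ?q" using that by simp
    moreover have "w i \<in> {q \<in> farey n. 0 < q \<and> q \<le> of_int a / of_int b}" using that assms(8) by blast
    then have "?q \<le> of_int a / of_int b" using that(4) by simp
    ultimately have "?q \<in> {q \<in> farey n. 0 < q \<and> q \<le> of_int a / of_int b}"
      using assms(6) by (simp add: farey_def)
    then show ?thesis unfolding assms(8)[symmetric] by force
  qed
  have mono: "i < j" if "w i < w j" "i \<in> {1..k}" "j \<in> {1..k}" for i j
    using that assms(7) by (metis strict_mono_on_def linorder_neqE_nat order_less_asym order_less_irrefl)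
  \<comment> \<open>The invariant describes \<open>lam i\<close> for slopes just above
    \<open>w i\<close>, hence in transposed form.\<close>
  have "is_partition (lam i) \<and> card (young_diagram (lam i)) = n \<and>
      initial (den i - num i) (den i) (flip ` young_diagram (lam i))" if "1 \<le> i" "i \<le> k" for i
    using that
  proof (induction i rule: dec_induct)
    case base
    have i: "1 \<in> {1..k}" using k by simp
    have nogap: "\<forall>e f. 0 < f \<and> f \<le> int n \<and> 0 < e \<longrightarrow> \<not> e * den 1 < num 1 * f"
    proof (intro allI impI notI)
      fix e f
      assume "0 < f \<and> f \<le> int n \<and> 0 < e" "e * den 1 < num 1 * f"
      then have f: "0 < f" "f \<le> int n" "0 < e" "e * den 1 < num 1 * f" by auto
      have "of_int e / of_int f < w 1" unfolding w[of 1] using less_fraction_iff[OF f(1) den_pos] f(4) by blast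
      then obtain j where "j \<in> {1..k}" "w j < w 1" using found[OF f(1-3) _ i] by metis
      then show False using mono[of j 1] i by auto
    qed
    have row: "is_partition [n]" "card (young_diagram [n]) = n" "initial (num 1) (den 1) (young_diagram [n])"
      by (rule initial_wall[OF assms(1) num[OF i] nogap])+
    have "lam 1 = wall_crossing (nat (den 1)) [n]" using assms(10) assms(11)[OF i] denom by simp
    then show ?case using wall_crossing_initial[OF num[OF i] cop row(1,3)] row(2) by simp
  next
    case (step i)
    then have i: "i \<in> {1..k}" "Suc i \<in> {1..k}" by auto
    then have IH: "is_partition (lam i)" "card (young_diagram (lam i)) = n"
      "initial (den i - num i) (den i) (flip ` young_diagram (lam i))" using step by auto
    have "w i < w (Suc i)" using assms(7) i unfolding strict_mono_on_def by simp
    then have less: "num i * den (Suc i) < num (Suc i) * den i"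
      unfolding w[of i] w[of "Suc i"] using less_fraction_iff den_pos by blast
    have "initial (num (Suc i)) (den (Suc i)) (young_diagram (lam i))"
    proof (rule initial_next_slope[OF _ _ num[OF i(2)] less finite_young_diagram down_closed_young_diagram[OF IH(1)] IH(2)])
      show "0 \<le> num i" "num i < den i" using num[OF i(1)] by auto
      fix B C assume "B \<in> young_diagram (lam i)" "C \<in> boxes" "C \<notin> young_diagram (lam i)"
      then have "flip B \<in> flip ` young_diagram (lam i)" "flip C \<in> boxes"
        "flip C \<notin> flip ` young_diagram (lam i)"
        by (auto simp: mem_flip_image)
      then have "before (den i - num i) (den i) (flip B) (flip C)" by (rule initial_before[OF IH(3)])
      then show "weight (num i) (den i) B < weight (num i) (den i) C \<or>
          weight (num i) (den i) B = weight (num i) (den i) C \<and> content B < content C"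
        by (auto simp: before_def weight_flip content_flip)
    next
      \<comment> \<open>Such a fraction would be a wall with index strictly between \<open>i\<close>
        and \<open>Suc i\<close>.\<close>
      fix e f assume f: "0 < f" "f \<le> int n" "num i * f < e * den i" "e * den (Suc i) < num (Suc i) * f"
      have lt: "w i < of_int e / of_int f" "of_int e / of_int f < w (Suc i)"
        unfolding w[of i] w[of "Suc i"] using less_fraction_iff den_pos f by blast+
      have "0 < num i * f" using num(1)[OF i(1)] f(1) by simp
      then have "0 < e * den i" using f(3) by simp
      then have "0 < e" using den_pos[of i] by (simp add: zero_less_mult_iff)
      then obtain j where "j \<in> {1..k}" "w j = of_int e / of_int f" using found[OF f(1,2) _ lt(2) i(2)] by blast
      then show False using mono[of i j] mono[of j "Suc i"] lt i by simp
    qed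
    moreover have "lam (Suc i) = wall_crossing (nat (den (Suc i))) (lam i)" using assms(11)[OF i(2)] denom by simp
    ultimately show ?case using wall_crossing_initial[OF num[OF i(2)] cop IH(1)] IH(2) by simp
  qed
  then have final: "card (young_diagram (lam k)) = n" "initial (den k - num k) (den k) (flip ` young_diagram (lam k))"
    using k by auto
  \<comment> \<open>\<open>num\<close> and \<open>den\<close> are the reduced terms; coprimality of
    \<open>a\<close> and \<open>b\<close> identifies them at the last wall.\<close>
  have "quotient_of (w k) = (a, b)"
    unfolding assms(9) by (rule quotient_of_coprime_fraction[OF assms(2,3)])
  then have eq: "num k = a" "den k = b" by (simp_all add: num_def den_def)
  have "0 < a" using num(1)[of k] k eq by simp
  then show ?thesis using is_n_smallest_boxes_flip[of a b "young_diagram (lam k)" n] final assms(2) unfolding eq by blast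
qed

end
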